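(* Let $c(n)=\sum_{0\le r,s,t\le n}\frac{n!}{r!\,s!\,t!\,(n-r-s-t)!}r^{n-r-s-t}s^{n-r-s+1}$ (with $0^0=1$, $1/m!=0$ for negative $m$). Then, as $n\to\infty$, $$c(n)\sim e^{\frac n{s_n}(n-r_n+\frac12)-3n+2r_n+2s_n+t_n+1}\Big(\frac n{s_n}\Big)^n\frac{r_n^{1/2}s_n^{3/2}}{n}\sim e^{\frac n{s_n}(n-r_n+\frac12)-3n+2r_n+2s_n+t_n+1}\Big(\frac n{s_n}\Big)^n\frac{n}{4\log^2 n},$$ where $(r_n,s_n,t_n)$ is, for large $n$, the unique solution with $r,s,t>0$, $r+s+t<n$ of the system $$-\log r-\log s+\frac{n-r-s-t}{r}-\psi(r+1)+\psi(n-r-s-t+1)=0,$$ $$-\log r-\log s+\frac{n-r-s+1}{s}-\psi(s+1)+\psi(n-r-s-t+1)=0,$$ $$-\log r-\psi(t+1)+\psi(n-r-s-t+1)=0.$$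
   Context: $\psi$ denotes the digamma function $\Gamma'/\Gamma$. *)

theory Defs
  imports "HOL-Analysis.Analysis" "HOL-Library.Landau_Symbols"
begin

(* The guard r + s + t \<le> n renders the convention 1/m! = 0 for m < 0, and it makes every
   natural-number subtraction below exact. *)
definition c :: "nat \<Rightarrow> real" where
  "c n = (\<Sum>r\<le>n. \<Sum>s\<le>n. \<Sum>t\<le>n.
     if r + s + t \<le> n
     then fact n / (fact r * fact s * fact t * fact (n - r - s - t))
            * real r ^ (n - r - s - t) * real s ^ (n - r - s + 1)
     else 0)"

definition saddle_point :: "nat \<Rightarrow> real \<Rightarrow> real \<Rightarrow> real \<Rightarrow> bool" where
  "saddle_point n r s t \<longleftrightarrow>
     r > 0 \<and> s > 0 \<and> t > 0 \<and> r + s + t < real n \<and>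
     - ln r - ln s + (real n - r - s - t) / r - Digamma (r + 1)
       + Digamma (real n - r - s - t + 1) = 0 \<and>
     - ln r - ln s + (real n - r - s + 1) / s - Digamma (s + 1)
       + Digamma (real n - r - s - t + 1) = 0 \<and>
     - ln r - Digamma (t + 1) + Digamma (real n - r - s - t + 1) = 0"

end

theory Submission
  imports Defs "HOL-Probability.Distributions" "HOL-Real_Asymp.Real_Asymp"
begin

text \<open>
  Summing over \<open>t\<close> by the binomial theorem turns \<open>c n\<close> into the double sum of
  \<open>n! / (r! s! m!) * s ^ (m + 1) * (1 + r) ^ m\<close> with \<open>m = n - r - s\<close>. Its logarithm has
  Hessian \<open>- (m / r\<^sup>2, m / s\<^sup>2)\<close> on the diagonal, of order \<open>4 (ln n)\<^sup>2 / n\<close>, and a mixed derivative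
  smaller by a factor \<open>ln n\<close>; so the rescaled summands tend to a standard Gaussian, and the sum is
  \<open>2 * pi * n / (4 (ln n)\<^sup>2)\<close> times the peak.

  The point \<open>(r\<^sub>n, s\<^sub>n)\<close> of the three-variable system is not exactly critical for the double sum, but the
  gradient there is \<open>O(ln n / n)\<close>, which displaces the maximum by much less than the width
  \<open>sqrt n / (2 ln n)\<close> of the peak. The peak value is then simplified with the saddle point equations
  and \<open>Digamma (x + 1) = ln x + 1 / (2 x) + O(1 / x\<^sup>2)\<close>.

  Every saddle point for large \<open>n\<close> satisfies \<open>r \<sim> s \<sim> n / (2 ln n)\<close>, \<open>t \<sim> 2 ln n\<close>, a region in
  which the logarithm of the summand of \<open>c n\<close> is strictly concave; this gives uniqueness. Existence comes from maximising
  that logarithm over a box on whose faces its gradient points inwards.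
\<close>

section \<open>Digamma bounds and the Stirling formula\<close>

text \<open>Summing out \<open>t\<close> is more than a convenience: near the saddle the
  \<open>t\<close>-direction has width of order \<open>sqrt (ln n)\<close>, while \<open>r\<close>
  and \<open>s\<close> have width \<open>sqrt n / (2 * ln n)\<close>. The double sum has a single
  scale and turns, after rescaling, into the integral of a step function to which dominated
  convergence applies. The dominating Gaussian is obtained on a box of side about
  \<open>2 * n / ln n\<close>, four times the saddle coordinates; beyond it the summands are
  nonincreasing in each index and are bounded by values on the edge of the box. The leading
  asymptotics of \<open>(r, s, t)\<close> are far too crude to be inserted into the exponent, where
  only an error o(1) is allowed. The peak is therefore compared with the claimed exponent through an
  exact identity, and only its remainder terms are estimated. One of these,
  \<open>m / r - t\<close>, calls for second-order information: its limit is 1/2. The factor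
  \<open>2 * pi\<close> of the Gaussian integral is cancelled by Stirling's formula, which is
  applied to one factorial in the numerator and three in the denominator.\<close>

lemma Digamma_plus1_LIMSEQ_real:
  fixes x :: real
  assumes "x > 0"
  shows "(\<lambda>m. ln (real m) - (\<Sum>n<m. inverse (x + 1 + real n))) \<longlonglongrightarrow> Digamma (x + 1)"
  using Digamma_LIMSEQ[of "x + 1"] assms by simp

text \<open>A comparison principle: \<open>Digamma (y + 1)\<close> has increments exactly
  \<open>1 / (y + 1)\<close> and grows like the logarithm, so a function with smaller increments and
  the same growth lies above it. Each elementary bound below is thereby reduced to one inequality
  for a logarithm.\<close>

lemma Digamma_plus1_le_telescope:
  fixes x :: real and g :: "real \<Rightarrow> real"
  assumes x: "x > 0"
    and step: "\<And>y. y \<ge> x \<Longrightarrow> g (y + 1) - g y \<le> 1 / (y + 1)"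
    and lim: "(\<lambda>m. g (x + real m) - ln (real m)) \<longlonglongrightarrow> 0"
  shows "Digamma (x + 1) \<le> g x"
proof -
  have tele: "g (x + real m) - g x \<le> (\<Sum>n<m. inverse (x + 1 + real n))" for m
  proof (induction m)
    case (Suc m)
    have "g (x + real m + 1) - g (x + real m) \<le> 1 / (x + real m + 1)"
      using step by simp
    with Suc show ?case by (simp add: algebra_simps inverse_eq_divide)
  qed simp
  have "(\<lambda>m. g x - (g (x + real m) - ln (real m))) \<longlonglongrightarrow> g x - 0"
    by (intro tendsto_intros lim)
  moreover have "ln (real m) - (\<Sum>n<m. inverse (x + 1 + real n)) \<le> g x - (g (x + real m) - ln (real m))"
    for m
    using tele[of m] by linarith
  ultimately show ?thesis
    using LIMSEQ_le[OF Digamma_plus1_LIMSEQ_real[OF x]] by simp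
qed

lemma Digamma_plus1_ge_telescope:
  fixes x :: real and g :: "real \<Rightarrow> real"
  assumes x: "x > 0"
    and step: "\<And>y. y \<ge> x \<Longrightarrow> g (y + 1) - g y \<ge> 1 / (y + 1)"
    and lim: "(\<lambda>m. g (x + real m) - ln (real m)) \<longlonglongrightarrow> 0"
  shows "Digamma (x + 1) \<ge> g x"
proof -
  have tele: "g (x + real m) - g x \<ge> (\<Sum>n<m. inverse (x + 1 + real n))" for m
  proof (induction m)
    case (Suc m)
    have "g (x + real m + 1) - g (x + real m) \<ge> 1 / (x + real m + 1)"
      using step by simp
    with Suc show ?case by (simp add: algebra_simps inverse_eq_divide)
  qed simp
  have "(\<lambda>m. g x - (g (x + real m) - ln (real m))) \<longlonglongrightarrow> g x - 0"
    by (intro tendsto_intros lim)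
  moreover have "ln (real m) - (\<Sum>n<m. inverse (x + 1 + real n)) \<ge> g x - (g (x + real m) - ln (real m))"
    for m
    using tele[of m] by linarith
  ultimately show ?thesis
    using LIMSEQ_le[OF _ Digamma_plus1_LIMSEQ_real[OF x]] by simp
qed

lemma Digamma_plus1_le_ln_plus1:
  fixes x :: real
  assumes "x > 0"
  shows "Digamma (x + 1) \<le> ln (x + 1)"
proof (rule Digamma_plus1_le_telescope[OF assms, where g = "\<lambda>y. ln (y + 1)"])
  show "(\<lambda>m. ln (x + real m + 1) - ln (real m)) \<longlonglongrightarrow> 0"
    by real_asymp
  fix y assume "y \<ge> x"
  then have y: "y > 0" using assms by simp
  have "ln (y + 1 + 1) - ln (y + 1) = ln (1 + 1 / (y + 1))"
    using y by (subst ln_divide_pos [symmetric]) (auto simp: field_simps)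
  also have "\<dots> \<le> 1 / (y + 1)"
    using y by (intro ln_add_one_self_le_self) simp
  finally show "ln (y + 1 + 1) - ln (y + 1) \<le> 1 / (y + 1)" .
qed

text \<open>The increment condition is the midpoint rule for the convex function 1/z on an interval
  of length 1 centred at \<open>y + 1\<close>.\<close>

lemma Digamma_plus1_ge_ln_plus_half:
  fixes x :: real
  assumes "x > 0"
  shows "Digamma (x + 1) \<ge> ln (x + 1 / 2)"
proof (rule Digamma_plus1_ge_telescope[OF assms, where g = "\<lambda>y. ln (y + 1 / 2)"])
  show "(\<lambda>m. ln (x + real m + 1 / 2) - ln (real m)) \<longlonglongrightarrow> 0"
    by real_asymp
  fix y assume "y \<ge> x"
  then have y: "y > 0" using assms by simp
  show "1 / (y + 1) \<le> ln (y + 1 + 1 / 2) - ln (y + 1 / 2)"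
    using ln_inverse_approx_ge[of "y + 1 / 2" "y + 1 + 1 / 2"] y by (simp add: field_simps)
qed

text \<open>The increment condition is the trapezium rule for the convex function 1/z on
  \<open>[y, y + 1]\<close>.\<close>

lemma Digamma_plus1_le_ln_plus:
  fixes x :: real
  assumes "x > 0"
  shows "Digamma (x + 1) \<le> ln x + 1 / (2 * x)"
proof (rule Digamma_plus1_le_telescope[OF assms, where g = "\<lambda>y. ln y + 1 / (2 * y)"])
  show "(\<lambda>m. ln (x + real m) + 1 / (2 * (x + real m)) - ln (real m)) \<longlonglongrightarrow> 0"
    by real_asymp
  fix y assume "y \<ge> x"
  then have y: "y > 0" using assms by simp
  have "ln (y + 1) - ln y \<le> (1 / y + 1 / (y + 1)) / 2"
    using ln_inverse_approx_le[of y 1] y by (simp add: inverse_eq_divide)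
  moreover have "1 / (2 * (y + 1)) = (1 / (y + 1)) / 2" "1 / (2 * y) = (1 / y) / 2"
    using y by (simp_all add: field_simps)
  moreover have "l - k \<le> (a + b) / 2 \<Longrightarrow> l + b / 2 - (k + a / 2) \<le> b" for k l a b :: real
    by argo
  ultimately show "ln (y + 1) + 1 / (2 * (y + 1)) - (ln y + 1 / (2 * y)) \<le> 1 / (y + 1)"
    by (simp only:)
qed

text \<open>The upper side is the trapezium bound, without any loss. The error term comes from the
  midpoint bound alone: ln(1 + w) is at least w - w^2/2, and w = 1/(2x) makes the quadratic term
  exactly 1/(8x^2).\<close>

lemma Digamma_plus1_approx:
  fixes x :: real
  assumes x: "x > 0"
  shows "\<bar>Digamma (x + 1) - ln x - 1 / (2 * x)\<bar> \<le> 1 / (8 * x\<^sup>2)"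
proof -
  have "1 / (2 * x) - (1 / (2 * x))\<^sup>2 / 2 \<le> ln (1 + 1 / (2 * x))"
  proof -
    have "0 \<le> ln (1 + w) - (w - w\<^sup>2 / 2)" if w: "w \<ge> 0" for w :: real
    proof -
      have "ln (1 + 0) - (0 - 0\<^sup>2 / 2) \<le> ln (1 + w) - (w - w\<^sup>2 / 2)"
      proof (rule DERIV_nonneg_imp_nondecreasing[OF w])
        fix z :: real assume z: "0 \<le> z" "z \<le> w"
        have "((\<lambda>a. ln (1 + a) - (a - a\<^sup>2 / 2)) has_real_derivative (1 / (1 + z) - (1 - z))) (at z)"
          using z by (auto intro!: derivative_eq_intros)
        moreover have "1 / (1 + z) - (1 - z) \<ge> 0"
          using z by (simp add: field_simps)
        ultimately show "\<exists>D. ((\<lambda>a. ln (1 + a) - (a - a\<^sup>2 / 2)) has_real_derivative D) (at z) \<and> 0 \<le> D"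
          by blast
      qed
      then show ?thesis by simp
    qed
    from this[of "1 / (2 * x)"] x show ?thesis by simp
  qed
  also have "1 + 1 / (2 * x) = (x + 1 / 2) / x"
    using x by (simp add: field_simps)
  also have "ln \<dots> = ln (x + 1 / 2) - ln x"
    using x by (simp add: ln_div)
  finally show ?thesis
    using Digamma_plus1_ge_ln_plus_half[OF x] Digamma_plus1_le_ln_plus[OF x]
    by (simp add: power_divide power_mult_distrib)
qed

section \<open>Trigamma bounds by comparison with a telescoping series\<close>

lemma inverse_telescope_sums:
  fixes x :: real
  assumes "x > 0"
  shows "(\<lambda>k. 1 / (x + real k) - 1 / (x + real (Suc k))) sums (1 / x)"
proof -
  have "(\<lambda>k. 1 / (x + real k)) \<longlonglongrightarrow> 0" by real_asymp
  from telescope_sums'[OF this] show ?thesis by simp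
qed

lemma Polygamma1_sums:
  fixes x :: real
  assumes "x > 0"
  shows "(\<lambda>k. inverse ((x + real k)\<^sup>2)) sums Polygamma 1 x"
proof -
  have "x \<noteq> - of_nat n" for n using assms by (metis neg_le_0_iff_le not_le of_nat_0_le_iff)
  then show ?thesis
    using Polygamma_LIMSEQ[of x 1] assms by (simp add: numeral_2_eq_2)
qed

lemma Polygamma1_plus1_le:
  fixes x :: real
  assumes "x > 0"
  shows "Polygamma 1 (x + 1) \<le> 1 / x"
proof (rule sums_le[OF _ Polygamma1_sums inverse_telescope_sums])
  fix k
  have "x + real k > 0" using assms by simp
  then show "inverse ((x + 1 + real k)\<^sup>2) \<le> 1 / (x + real k) - 1 / (x + real (Suc k))"
    by (simp add: divide_simps add_ac power2_eq_square)
qed (use assms in auto)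

lemma Polygamma1_ge:
  fixes x :: real
  assumes "x > 0"
  shows "1 / x \<le> Polygamma 1 x"
proof (rule sums_le[OF _ inverse_telescope_sums Polygamma1_sums])
  fix k
  have "x + real k > 0" using assms by simp
  then show "1 / (x + real k) - 1 / (x + real (Suc k)) \<le> inverse ((x + real k)\<^sup>2)"
    by (simp add: divide_simps add_ac power2_eq_square)
qed (use assms in auto)

section \<open>Stirling's formula, including its constant\<close>

definition stirling_error :: "real \<Rightarrow> real" where
  "stirling_error x = ln_Gamma x - (x - 1 / 2) * ln x + x"

text \<open>The derivative of \<open>stirling_error\<close> is the error of the approximation ln z +
  1/(2z) to \<open>Digamma (z + 1)\<close>, which lies between -1/(8z^2) and 0; both claims are
  integrated forms of these bounds.\<close>

lemma stirling_error_diff: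
  assumes "0 < x" "x \<le> y"
  shows "stirling_error y \<le> stirling_error x"
    and "stirling_error x - stirling_error y \<le> 1 / (8 * x)"
proof -
  have der: "(stirling_error has_real_derivative (Digamma (z + 1) - ln z - 1 / (2 * z))) (at z)"
    if "z > 0" for z
  proof -
    have "(stirling_error has_real_derivative (Digamma z - (ln z + (z - 1 / 2) / z) + 1)) (at z)"
      unfolding stirling_error_def [abs_def] using that
      by (auto intro!: derivative_eq_intros)
    also have "Digamma z - (ln z + (z - 1 / 2) / z) + 1 = Digamma (z + 1) - ln z - 1 / (2 * z)"
      using that by (subst Digamma_plus1) (auto simp: field_simps)
    finally show ?thesis .
  qed
  show "stirling_error y \<le> stirling_error x"
  proof (rule DERIV_nonpos_imp_nonincreasing[OF assms(2)])
    fix z assume "x \<le> z" "z \<le> y"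
    then have z: "z > 0" using assms by simp
    show "\<exists>D. (stirling_error has_real_derivative D) (at z) \<and> D \<le> 0"
      using der[OF z] Digamma_plus1_le_ln_plus[OF z] by (intro exI conjI) auto
  qed
  have "stirling_error x - 1 / (8 * x) \<le> stirling_error y - 1 / (8 * y)"
  proof (rule DERIV_nonneg_imp_nondecreasing[OF assms(2)])
    fix z assume "x \<le> z" "z \<le> y"
    then have z: "z > 0" using assms by simp
    have "((\<lambda>z. stirling_error z - 1 / (8 * z)) has_real_derivative
        (Digamma (z + 1) - ln z - 1 / (2 * z) + 1 / (8 * z\<^sup>2))) (at z)"
      using z by (auto intro!: derivative_eq_intros der simp: power2_eq_square field_simps)
    then show "\<exists>D. ((\<lambda>z. stirling_error z - 1 / (8 * z)) has_real_derivative D) (at z) \<and> 0 \<le> D"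
      using Digamma_plus1_approx[OF z] by (intro exI conjI) auto
  qed
  moreover have "1 / (8 * y) \<ge> 0" using assms by simp
  ultimately show "stirling_error x - stirling_error y \<le> 1 / (8 * x)" by linarith
qed

text \<open>Along the integers the function decreases and is bounded below; a real argument differs
  from the next integer by a vanishing amount.\<close>

lemma stirling_error_convergent: "\<exists>l. (stirling_error \<longlongrightarrow> l) at_top"
proof -
  have "decseq (\<lambda>n. stirling_error (real (Suc n)))"
    by (rule decseq_SucI) (auto intro!: stirling_error_diff(1))
  moreover have "stirling_error 1 - 1 / 8 \<le> stirling_error (real (Suc n))" for n
    using stirling_error_diff(2)[of 1 "real (Suc n)"] by simp
  ultimately obtain l where l: "(\<lambda>n. stirling_error (real (Suc n))) \<longlonglongrightarrow> l"
    using decseq_convergent by blast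
  have fl: "filterlim (\<lambda>x::real. nat \<lfloor>x\<rfloor>) sequentially at_top"
    by (rule filterlim_compose[OF filterlim_nat_sequentially filterlim_floor_sequentially])
  have l': "((\<lambda>x::real. stirling_error (real (Suc (nat \<lfloor>x\<rfloor>)))) \<longlongrightarrow> l) at_top"
    using filterlim_compose[OF l fl] .
  have "((\<lambda>x. stirling_error x - stirling_error (real (Suc (nat \<lfloor>x\<rfloor>)))) \<longlongrightarrow> 0) at_top"
  proof (rule tendsto_sandwich[of "\<lambda>_. 0" _ _ "\<lambda>x. 1 / (8 * x)"])
    have "\<forall>\<^sub>F x in at_top. x > (0::real)" by (rule eventually_gt_at_top)
    then show "\<forall>\<^sub>F x in at_top. 0 \<le> stirling_error x - stirling_error (real (Suc (nat \<lfloor>x\<rfloor>)))"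
    proof eventually_elim
      case (elim x)
      then show ?case using stirling_error_diff(1)[of x "real (Suc (nat \<lfloor>x\<rfloor>))"] by linarith
    qed
    have "\<forall>\<^sub>F x in at_top. x > (0::real)" by (rule eventually_gt_at_top)
    then show "\<forall>\<^sub>F x in at_top. stirling_error x - stirling_error (real (Suc (nat \<lfloor>x\<rfloor>))) \<le> 1 / (8 * x)"
    proof eventually_elim
      case (elim x)
      then show ?case using stirling_error_diff(2)[of x "real (Suc (nat \<lfloor>x\<rfloor>))"] by linarith
    qed
    show "((\<lambda>x. 1 / (8 * x)) \<longlongrightarrow> (0::real)) at_top" by real_asymp
  qed simp
  from tendsto_add[OF this l'] show ?thesis by auto
qed

text \<open>In Legendre's duplication formula the unknown limit \<open>l\<close> enters twice on one
  side and once on the other, so \<open>l + l - l\<close> equals the limit of the elementary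
  function \<open>g\<close>.\<close>

lemma stirling_error_tendsto: "(stirling_error \<longlongrightarrow> ln (2 * pi) / 2) at_top"
proof -
  obtain l where l: "(stirling_error \<longlongrightarrow> l) at_top"
    using stirling_error_convergent by blast
  have dup: "ln_Gamma z + ln_Gamma (z + 1 / 2) = (1 - 2 * z) * ln 2 + ln pi / 2 + ln_Gamma (2 * z)"
    if z: "z > 0" for z :: real
  proof -
    have "complex_of_real z \<notin> \<int>\<^sub>\<le>\<^sub>0" "complex_of_real z + 1/2 \<notin> \<int>\<^sub>\<le>\<^sub>0"
      using z by (auto elim!: nonpos_Ints_cases simp: complex_eq_iff)
    then have "Gamma (complex_of_real z) * Gamma (complex_of_real z + 1/2) =
        exp ((1 - 2 * complex_of_real z) * of_real (ln 2)) * of_real (sqrt pi) * Gamma (2 * complex_of_real z)"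
      by (rule Gamma_legendre_duplication)
    also have "complex_of_real z + 1/2 = of_real (z + 1/2)" by simp
    also have "2 * complex_of_real z = of_real (2 * z)" by simp
    also have "exp ((1 - complex_of_real (2 * z)) * of_real (ln 2)) = of_real (exp ((1 - 2 * z) * ln 2))"
      by (simp add: exp_of_real [symmetric])
    finally have "complex_of_real (Gamma z * Gamma (z + 1/2)) =
        of_real (exp ((1 - 2 * z) * ln 2) * sqrt pi * Gamma (2 * z))"
      by (simp only: Gamma_complex_of_real of_real_mult [symmetric])
    then have eq: "Gamma z * Gamma (z + 1/2) = exp ((1 - 2 * z) * ln 2) * sqrt pi * Gamma (2 * z)"
      using of_real_eq_iff by blast
    have "ln (Gamma z * Gamma (z + 1/2)) = ln_Gamma z + ln_Gamma (z + 1 / 2)"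
      using z by (simp add: ln_mult_pos ln_Gamma_real_pos Gamma_real_pos)
    moreover have "ln (exp ((1 - 2 * z) * ln 2) * sqrt pi * Gamma (2 * z)) =
        (1 - 2 * z) * ln 2 + ln pi / 2 + ln_Gamma (2 * z)"
      using z by (simp add: ln_mult_pos ln_Gamma_real_pos Gamma_real_pos ln_sqrt)
    ultimately show ?thesis using eq by simp
  qed
  define g where "g z = (1 - 2 * z) * ln 2 + ln pi / 2 - (z - 1 / 2) * ln z - z * ln (z + 1 / 2)
      + 1 / 2 + (2 * z - 1 / 2) * ln (2 * z)" for z :: real
  have "\<forall>\<^sub>F z in at_top. g z = stirling_error z + stirling_error (z + 1 / 2) - stirling_error (2 * z)"
    using eventually_gt_at_top[of 0]
  proof eventually_elim
    case (elim z)
    show ?case using dup[OF elim] unfolding g_def stirling_error_def by (simp add: algebra_simps)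
  qed
  moreover have "((\<lambda>z. stirling_error z + stirling_error (z + 1 / 2) - stirling_error (2 * z))
      \<longlongrightarrow> l + l - l) at_top"
    by (intro tendsto_intros l filterlim_compose[OF l]) real_asymp+
  ultimately have "(g \<longlongrightarrow> l) at_top"
    by (simp add: tendsto_cong)
  moreover have "(g \<longlongrightarrow> ln 2 / 2 + ln pi / 2) at_top"
  proof -
    have "\<forall>\<^sub>F z in at_top. ln 2 / 2 + ln pi / 2 + (1 / 2 - z * ln (1 + 1 / (2 * z))) = g z"
      using eventually_gt_at_top[of 0]
    proof eventually_elim
      case (elim z)
      have "1 + 1 / (2 * z) = (z + 1 / 2) / z" using elim by (simp add: field_simps)
      then have l1: "ln (1 + 1 / (2 * z)) = ln (z + 1 / 2) - ln z" using elim by (simp add: ln_div)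
      have l2: "ln (2 * z) = ln 2 + ln z" using elim by (simp add: ln_mult_pos)
      show ?case unfolding g_def l1 l2 by (simp add: algebra_simps)
    qed
    moreover have "((\<lambda>z. 1 / 2 - z * ln (1 + 1 / (2 * z))) \<longlongrightarrow> (0::real)) at_top"
      by real_asymp
    from tendsto_add[OF tendsto_const[of "ln 2 / 2 + ln pi / 2"] this]
    have "((\<lambda>z. ln 2 / 2 + ln pi / 2 + (1 / 2 - z * ln (1 + 1 / (2 * z))))
        \<longlongrightarrow> ln 2 / 2 + ln pi / 2) at_top"
      by simp
    ultimately show ?thesis by (rule Lim_transform_eventually[rotated])
  qed
  ultimately have "l = ln 2 / 2 + ln pi / 2"
    by (intro tendsto_unique[of "at_top :: real filter"]) auto
  then show ?thesis using l by (simp add: ln_mult_pos add_divide_distrib)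
qed

lemma ln_Gamma_plus1_eq:
  fixes x :: real
  assumes "x > 0"
  shows "ln_Gamma (x + 1) = x * ln x + ln x / 2 - x + stirling_error x"
proof -
  have "Gamma (x + 1) = x * Gamma x"
    using assms by (intro Gamma_plus1) auto
  then have "ln_Gamma (x + 1) = ln x + ln_Gamma x"
    using assms by (simp add: ln_Gamma_real_pos ln_mult_pos Gamma_real_pos)
  then show ?thesis unfolding stirling_error_def by (simp add: algebra_simps)
qed

section \<open>Existence and local uniqueness of the saddle point\<close>

definition saddle_r :: "real \<Rightarrow> real \<Rightarrow> real \<Rightarrow> real \<Rightarrow> real" where
  "saddle_r n r s t = - ln r - ln s + (n - r - s - t) / r - Digamma (r + 1) + Digamma (n - r - s - t + 1)"

definition saddle_s :: "real \<Rightarrow> real \<Rightarrow> real \<Rightarrow> real \<Rightarrow> real" where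
  "saddle_s n r s t = - ln r - ln s + (n - r - s + 1) / s - Digamma (s + 1) + Digamma (n - r - s - t + 1)"

definition saddle_t :: "real \<Rightarrow> real \<Rightarrow> real \<Rightarrow> real \<Rightarrow> real" where
  "saddle_t n r s t = - ln r - Digamma (t + 1) + Digamma (n - r - s - t + 1)"

lemma saddle_point_iff:
  "saddle_point n r s t \<longleftrightarrow> r > 0 \<and> s > 0 \<and> t > 0 \<and> r + s + t < real n \<and>
     saddle_r n r s t = 0 \<and> saddle_s n r s t = 0 \<and> saddle_t n r s t = 0"
  by (simp add: saddle_point_def saddle_r_def saddle_s_def saddle_t_def)

text \<open>The logarithm of the summand of \<open>c n\<close>, extended to real arguments, with the
  constant ln n! dropped since only its critical points matter.\<close>

definition phase :: "real \<Rightarrow> real \<Rightarrow> real \<Rightarrow> real \<Rightarrow> real" where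
  "phase n r s t = (n - r - s - t) * ln r + (n - r - s + 1) * ln s
     - ln_Gamma (r + 1) - ln_Gamma (s + 1) - ln_Gamma (t + 1) - ln_Gamma (n - r - s - t + 1)"

lemma phase_deriv:
  assumes "r > 0" "s > 0" "t > 0" "r + s + t < n"
  shows "((\<lambda>x. phase n x s t) has_real_derivative saddle_r n r s t) (at r)"
    and "((\<lambda>x. phase n r x t) has_real_derivative saddle_s n r s t) (at s)"
    and "((\<lambda>x. phase n r s x) has_real_derivative saddle_t n r s t) (at t)"
  unfolding phase_def saddle_r_def saddle_s_def saddle_t_def using assms
  by (auto intro!: derivative_eq_intros simp: field_simps)

lemma continuous_on_ln_Gamma_real: "continuous_on {0<..} (ln_Gamma :: real \<Rightarrow> real)"
  by (intro continuous_at_imp_continuous_on ballI DERIV_isCont[OF has_field_derivative_ln_Gamma_real]) auto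

text \<open>An endpoint cannot carry the maximum when the derivative there points into the interval;
  in the interior Fermat's theorem applies. Used one coordinate at a time on the faces of a
  box.\<close>

lemma derivative_zero_at_max:
  fixes g :: "real \<Rightarrow> real"
  assumes x: "x \<in> {a..b}" and "a < b"
    and der: "(g has_real_derivative D) (at x)"
    and max: "\<And>y. y \<in> {a..b} \<Longrightarrow> g y \<le> g x"
    and left: "x = a \<Longrightarrow> D > 0" and right: "x = b \<Longrightarrow> D < 0"
  shows "D = 0"
proof -
  consider "x = a" | "x = b" | "a < x" "x < b"
    using x by fastforce
  then show ?thesis
  proof cases
    case 1
    obtain d where d: "d > 0" "\<And>h. 0 < h \<Longrightarrow> h < d \<Longrightarrow> g x < g (x + h)"
      using DERIV_pos_inc_right[OF der left[OF 1]] by blast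
    define h where "h = min (d / 2) (b - a)"
    have "g x < g (x + h)" using d(1) \<open>a < b\<close> by (intro d(2)) (auto simp: h_def min_def)
    moreover have "g (x + h) \<le> g x" using d(1) \<open>a < b\<close> 1 by (intro max) (auto simp: h_def min_def)
    ultimately show ?thesis by simp
  next
    case 2
    obtain d where d: "d > 0" "\<And>h. 0 < h \<Longrightarrow> h < d \<Longrightarrow> g x < g (x - h)"
      using DERIV_neg_dec_left[OF der right[OF 2]] by blast
    define h where "h = min (d / 2) (b - a)"
    have "g x < g (x - h)" using d(1) \<open>a < b\<close> by (intro d(2)) (auto simp: h_def min_def)
    moreover have "g (x - h) \<le> g x" using d(1) \<open>a < b\<close> 2 by (intro max) (auto simp: h_def min_def)
    ultimately show ?thesis by simp
  next
    case 3
    show ?thesis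
    proof (rule DERIV_local_max[OF der, of "min (x - a) (b - x)"])
      show "\<forall>y. \<bar>x - y\<bar> < min (x - a) (b - x) \<longrightarrow> g y \<le> g x"
        by (auto intro!: max)
    qed (use 3 in auto)
  qed
qed

lemma saddle_point_exists_aux:
  fixes n L :: real
  defines "L \<equiv> ln n"
  assumes n: "n > 1" "L > 3" "n - 2 * n / L - 8 * L \<ge> 9 / 10 * n" "n / L + 1 \<le> n" "n / (4 * L) \<ge> 1"
    "3 * ln (4 * L) + 1 < L"
  shows "\<exists>r s t. r > 0 \<and> s > 0 \<and> t > 0 \<and> r + s + t < n \<and>
     saddle_r n r s t = 0 \<and> saddle_s n r s t = 0 \<and> saddle_t n r s t = 0"
proof -
  \<comment> \<open>The expected location is r, s near n/(2L) and t near 2L. The box leaves a factor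
    2 in both directions for r and s, and a factor 4 for t.\<close>
  define a b where "a = n / (4 * L)" and "b = n / L"
  define p q where "p = L / 2" and "q = 8 * L"
  have ab: "1 \<le> a" "a < b" "b + 1 \<le> n" and pq: "0 < p" "p < q"
    using n by (auto simp: a_def b_def p_def q_def field_simps)
  have u: "n - r - s - t \<ge> 9 / 10 * n" "n - r - s - t + 1 \<le> n"
    if "r \<in> {a..b}" "s \<in> {a..b}" "t \<in> {p..q}" for r s t
  proof -
    have "n - (b + b) - q \<ge> 9 / 10 * n" using n(3) by (simp add: b_def q_def)
    then show "n - r - s - t \<ge> 9 / 10 * n" "n - r - s - t + 1 \<le> n"
      using that ab pq by (simp_all only: atLeastAtMost_iff) linarith+
  qed
  have lnn: "ln (9 / 10 * n) = ln (9 / 10) + L" using n by (subst ln_mult_pos) (auto simp: L_def)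
  \<comment> \<open>Keeping \<open>n - r - s - t\<close> above 9/10 of n costs at most 3/25 in
    \<open>Digamma (n - r - s - t + 1)\<close>. This must stay below the gain 1/6 obtained later on
    the face \<open>t = p\<close>.\<close>
  have ln9: "ln (9 / 10 :: real) \<ge> - (3 / 25)"
    using ln_one_minus_pos_lower_bound[of "1/10 :: real"] by (simp add: power2_eq_square)
  have psi_u: "Digamma (n - r - s - t + 1) \<ge> L - 3 / 25" "Digamma (n - r - s - t + 1) \<le> L"
    if "r \<in> {a..b}" "s \<in> {a..b}" "t \<in> {p..q}" for r s t
  proof -
    have up: "n - r - s - t > 0" using u[OF that] n by linarith
    have "ln (9 / 10 * n) \<le> ln (n - r - s - t + 1 / 2)"
      using u[OF that] n up by (subst ln_le_cancel_iff) auto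
    then show "Digamma (n - r - s - t + 1) \<ge> L - 3 / 25"
      using Digamma_plus1_ge_ln_plus_half[OF up] lnn ln9 by linarith
    have "ln (n - r - s - t + 1) \<le> L"
      unfolding L_def using u[OF that] n up by (subst ln_le_cancel_iff) auto
    then show "Digamma (n - r - s - t + 1) \<le> L"
      using Digamma_plus1_le_ln_plus1[OF up] by linarith
  qed
  have lower: "ln r \<ge> L - ln (4 * L)" "Digamma (r + 1) \<ge> L - ln (4 * L)"
    and upper: "ln r \<le> L" "Digamma (r + 1) \<le> L" if "r \<in> {a..b}" for r
  proof -
    have r: "r > 0" using that ab by auto
    have "ln a \<le> ln r" using that ab by (subst ln_le_cancel_iff) auto
    then show *: "ln r \<ge> L - ln (4 * L)"
      using n by (simp add: a_def ln_div L_def)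
    have "ln r \<le> ln (r + 1 / 2)" using r by simp
    then show "Digamma (r + 1) \<ge> L - ln (4 * L)"
      using * Digamma_plus1_ge_ln_plus_half[OF r] by linarith
    show "ln r \<le> L" unfolding L_def using that ab by (subst ln_le_cancel_iff) auto
    have "ln (r + 1) \<le> L" unfolding L_def using that ab by (subst ln_le_cancel_iff) auto
    then show "Digamma (r + 1) \<le> L" using Digamma_plus1_le_ln_plus1[OF r] by linarith
  qed
  have div_a: "x / a \<ge> 18 / 5 * L" if "x \<ge> 9 / 10 * n" for x
    using that n by (simp add: a_def field_simps)
  have div_b: "x / b \<le> L" if "x \<le> n" for x
    using that n by (simp add: b_def field_simps)
  have compact: "compact ({a..b} \<times> ({a..b} \<times> {p..q}))"
    by (intro compact_Times compact_Icc)
  have cont: "continuous_on ({a..b} \<times> ({a..b} \<times> {p..q})) (\<lambda>(r, s, t). phase n r s t)"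
    unfolding phase_def case_prod_beta
    by (intro continuous_intros continuous_on_compose2[OF continuous_on_ln_Gamma_real])
       (use ab pq u n in force)+
  have "{a..b} \<times> ({a..b} \<times> {p..q}) \<noteq> {}" using ab pq by auto
  from continuous_attains_sup[OF compact this cont]
  obtain r s t where rst: "r \<in> {a..b}" "s \<in> {a..b}" "t \<in> {p..q}"
    and max: "\<And>x y z. x \<in> {a..b} \<Longrightarrow> y \<in> {a..b} \<Longrightarrow> z \<in> {p..q} \<Longrightarrow> phase n x y z \<le> phase n r s t"
    by auto
  have pos: "r > 0" "s > 0" "t > 0" "r + s + t < n"
    using rst ab pq u[OF rst] n by auto
  note psi = psi_u[OF rst]
  \<comment> \<open>The fraction decides the sign. At \<open>r = a\<close> it is at least (18/5)L,
    against three negative terms of size at most L each. At \<open>r = b\<close> it is at most L,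
    and the total is at most -L + 3 ln(4L), negative by the last hypothesis. The faces in s are
    treated alike.\<close>
  have "saddle_r n r s t = 0"
  proof (rule derivative_zero_at_max[OF rst(1) ab(2) phase_deriv(1)[OF pos]])
    show "saddle_r n r s t > 0" if "r = a"
    proof -
      have "(n - r - s - t) / r \<ge> 18 / 5 * L" using div_a[OF u(1)[OF rst]] that by simp
      then show ?thesis
        using upper[OF rst(1)] upper[OF rst(2)] psi \<open>L > 3\<close> unfolding saddle_r_def by linarith
    qed
    have "n - r - s - t \<le> n" using u(2)[OF rst] by linarith
    from div_b[OF this] have "r = b \<Longrightarrow> (n - r - s - t) / r \<le> L" by simp
    then show "saddle_r n r s t < 0" if "r = b"
      using that lower[OF rst(1)] lower[OF rst(2)] psi n(6)
      unfolding saddle_r_def by linarith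
  qed (use max rst in auto)
  moreover have "saddle_s n r s t = 0"
  proof (rule derivative_zero_at_max[OF rst(2) ab(2) phase_deriv(2)[OF pos]])
    have "n - r - s + 1 \<ge> 9 / 10 * n" using u(1)[OF rst] pos by linarith
    from div_a[OF this] have "s = a \<Longrightarrow> (n - r - s + 1) / s \<ge> 18 / 5 * L" by simp
    then show "saddle_s n r s t > 0" if "s = a"
      using that upper[OF rst(1)] upper[OF rst(2)] psi n(2)
      unfolding saddle_s_def by linarith
    have "n - r - s + 1 \<le> n" using rst ab by auto
    from div_b[OF this] have "s = b \<Longrightarrow> (n - r - s + 1) / s \<le> L" by simp
    then show "saddle_s n r s t < 0" if "s = b"
      using that lower[OF rst(1)] lower[OF rst(2)] psi n(6)
      unfolding saddle_s_def by linarith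
  qed (use max rst in auto)
  \<comment> \<open>Here the terms of order L cancel and constants decide: at \<open>t = p\<close>
    the margin is -ln(5/6) - 3/25 > 0, and at \<open>t = q\<close> the comparison is between 4L and
    8L + 1/2.\<close>
  moreover have "saddle_t n r s t = 0"
  proof (rule derivative_zero_at_max[OF rst(3) pq(2) phase_deriv(3)[OF pos]])
    have lb: "ln b = L - ln L" using n by (simp add: b_def ln_div L_def)
    have la: "ln a = L - ln 4 - ln L" using n by (simp add: a_def ln_div ln_mult_pos L_def)
    show "saddle_t n r s t > 0" if "t = p"
    proof -
      have "ln r \<le> ln b" using rst pos by (subst ln_le_cancel_iff) auto
      moreover have "Digamma (t + 1) \<le> ln (L / 2 + 1)"
        using Digamma_plus1_le_ln_plus1[OF pos(3)] unfolding that p_def .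
      moreover have "ln (L / 2 + 1) \<le> ln (5 / 6 * L)"
        using n by (subst ln_le_cancel_iff) auto
      moreover have "ln (5 / 6 * L) = ln (5 / 6) + ln L"
        using n by (subst ln_mult_pos) auto
      moreover have "ln (5 / 6 :: real) \<le> - (1 / 6)"
        using ln_le_minus_one[of "5/6 :: real"] by simp
      ultimately show ?thesis using psi lb unfolding saddle_t_def by linarith
    qed
    show "saddle_t n r s t < 0" if "t = q"
    proof -
      have "ln a \<le> ln r" using rst ab by (subst ln_le_cancel_iff) auto
      moreover have "Digamma (t + 1) \<ge> ln (8 * L + 1 / 2)"
        using Digamma_plus1_ge_ln_plus_half[OF pos(3)] unfolding that q_def .
      moreover have "ln (4 * L) < ln (8 * L + 1 / 2)"
        using n by (subst ln_less_cancel_iff) auto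
      moreover have "ln (4 * L) = ln 4 + ln L"
        using n by (subst ln_mult_pos) auto
      ultimately show ?thesis using psi la unfolding saddle_t_def by linarith
    qed
  qed (use max rst in auto)
  ultimately show ?thesis using pos by blast
qed

lemma saddle_point_exists: "\<forall>\<^sub>F n in sequentially. \<exists>r s t. saddle_point n r s t"
proof -
  have "\<forall>\<^sub>F n :: nat in sequentially. real n > 1"
    "\<forall>\<^sub>F n :: nat in sequentially. ln (real n) > 3"
    "\<forall>\<^sub>F n :: nat in sequentially. real n - 2 * real n / ln (real n) - 8 * ln (real n) \<ge> 9 / 10 * real n"
    "\<forall>\<^sub>F n :: nat in sequentially. real n / ln (real n) + 1 \<le> real n"
    "\<forall>\<^sub>F n :: nat in sequentially. real n / (4 * ln (real n)) \<ge> 1"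
    "\<forall>\<^sub>F n :: nat in sequentially. 3 * ln (4 * ln (real n)) + 1 < ln (real n)"
    by real_asymp+
  then show ?thesis
  proof eventually_elim
    case (elim n)
    show ?case unfolding saddle_point_iff using saddle_point_exists_aux[OF elim] .
  qed
qed

text \<open>The expression is the second derivative of \<open>phase\<close> in the direction
  \<open>(dr, ds, dt)\<close>. The mixed term in \<open>dt\<close> and \<open>dr\<close> is split
  between \<open>dt\<^sup>2 / (t + 1)\<close>, which the trigamma term of \<open>t\<close> pays for,
  and \<open>(t + 1) / r\<^sup>2 * dr\<^sup>2\<close>, which \<open>u / r\<^sup>2\<close> pays for.
  The mixed term in \<open>dr\<close> and \<open>ds\<close> costs at most \<open>3 / r\<close> and
  \<open>3 / s\<close> on the diagonal because r and s are comparable.\<close>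

lemma saddle_point_segment_concave:
  fixes n r s t dr ds dt :: real
  defines "u \<equiv> n - r - s - t"
  assumes pos: "r > 0" "s > 0" "t > 0"
    and region: "r \<le> 2 * s" "s \<le> 2 * r" "t + 1 + 2 * r \<le> u" "2 * s \<le> n - r - s"
    and nz: "dr \<noteq> 0 \<or> ds \<noteq> 0 \<or> dt \<noteq> 0"
  shows "- (Polygamma 1 (r + 1) * dr\<^sup>2 + Polygamma 1 (s + 1) * ds\<^sup>2 + Polygamma 1 (t + 1) * dt\<^sup>2
        + Polygamma 1 (u + 1) * (dr + ds + dt)\<^sup>2)
      - (u / r\<^sup>2 + 2 / r) * dr\<^sup>2 - ((n - r - s + 1) / s\<^sup>2 + 2 / s) * ds\<^sup>2
      - 2 * dr * ds * (1 / r + 1 / s) - 2 * dt * dr / r < 0"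
proof -
  have u: "u > 0" using pos region by linarith
  have P: "Polygamma 1 (r + 1) > 0" "Polygamma 1 (s + 1) > 0" "Polygamma 1 (u + 1) > 0"
    using pos u by (auto intro!: Polygamma_real_odd_pos simp: add_pos_pos elim!: nonpos_Ints_cases)
  have Pt: "Polygamma 1 (t + 1) \<ge> 1 / (t + 1)"
    using Polygamma1_ge[of "t + 1"] pos by simp
  have cross1: "- 2 * dt * dr / r \<le> dt\<^sup>2 / (t + 1) + (t + 1) / r\<^sup>2 * dr\<^sup>2"
  proof -
    have "0 \<le> (dt / sqrt (t + 1) + sqrt (t + 1) / r * dr)\<^sup>2" by simp
    also have "\<dots> = dt\<^sup>2 / (t + 1) + (t + 1) / r\<^sup>2 * dr\<^sup>2 + 2 * dt * dr / r"
      using pos by (simp add: power2_sum power_mult_distrib power_divide)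
    finally show ?thesis by simp
  qed
  have am: "- 2 * dr * ds \<le> dr\<^sup>2 + ds\<^sup>2"
    using zero_le_power2[of "dr + ds"] by (simp add: power2_sum)
  have inv: "1 / s \<le> 2 / r" "1 / r \<le> 2 / s"
    using pos region by (auto simp: field_simps)
  have cross2: "- 2 * dr * ds * (1 / r + 1 / s) \<le> 3 / r * dr\<^sup>2 + 3 / s * ds\<^sup>2"
  proof -
    have "- 2 * dr * ds * (1 / r + 1 / s) \<le> (dr\<^sup>2 + ds\<^sup>2) * (1 / r + 1 / s)"
      using am pos by (intro mult_right_mono) auto
    also have "\<dots> = dr\<^sup>2 * (1 / r + 1 / s) + ds\<^sup>2 * (1 / r + 1 / s)" by (simp add: algebra_simps)
    also have "\<dots> \<le> dr\<^sup>2 * (3 / r) + ds\<^sup>2 * (3 / s)"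
      using inv by (intro add_mono mult_left_mono) auto
    finally show ?thesis by (simp add: mult.commute)
  qed
  have cr: "(t + 1) / r\<^sup>2 + 3 / r \<le> u / r\<^sup>2 + 2 / r"
  proof -
    have "(t + 1) / r\<^sup>2 + 1 / r = (t + 1 + r) / r\<^sup>2"
      using pos by (simp add: add_divide_distrib power2_eq_square)
    also have "\<dots> \<le> u / r\<^sup>2"
      using pos region by (intro divide_right_mono) auto
    finally have "(t + 1) / r\<^sup>2 + 1 / r \<le> u / r\<^sup>2" .
    moreover have "3 / r = 1 / r + 2 / r" by (simp add: add_divide_distrib [symmetric])
    ultimately show ?thesis by linarith
  qed
  have cs: "3 / s < (n - r - s + 1) / s\<^sup>2 + 2 / s"
    using pos region by (simp add: field_simps power2_eq_square)
  have cr': "((t + 1) / r\<^sup>2 + 3 / r) * dr\<^sup>2 \<le> (u / r\<^sup>2 + 2 / r) * dr\<^sup>2"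
    by (intro mult_right_mono cr) auto
  have cs': "3 / s * ds\<^sup>2 \<le> ((n - r - s + 1) / s\<^sup>2 + 2 / s) * ds\<^sup>2"
    by (intro mult_right_mono less_imp_le[OF cs]) auto
  have Pt': "dt\<^sup>2 / (t + 1) \<le> Polygamma 1 (t + 1) * dt\<^sup>2"
    using mult_right_mono[OF Pt, of "dt\<^sup>2"] by simp
  \<comment> \<open>Absorbing the mixed terms may leave nothing over, so strictness is taken from
    the remaining trigamma terms; when only \<open>dt\<close> is non-zero, the one of
    \<open>u\<close> provides it.\<close>
  have strict: "Polygamma 1 (r + 1) * dr\<^sup>2 + Polygamma 1 (s + 1) * ds\<^sup>2
      + Polygamma 1 (u + 1) * (dr + ds + dt)\<^sup>2 > 0"
  proof (cases "dr = 0 \<and> ds = 0")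
    case True
    then show ?thesis using nz P by simp
  next
    case False
    then have "Polygamma 1 (r + 1) * dr\<^sup>2 + Polygamma 1 (s + 1) * ds\<^sup>2 > 0"
      using P by (auto intro: add_pos_nonneg add_nonneg_pos)
    then show ?thesis using P by (auto intro: add_pos_nonneg)
  qed
  show ?thesis
    using cross1 cross2 cr' cs' Pt' strict by (simp add: algebra_simps)
qed

text \<open>The region is cut out by linear inequalities and hence convex, so the segment joining
  two solutions stays inside it, where \<open>phase\<close> is strictly concave.\<close>

lemma saddle_point_unique_in_region:
  fixes n r s t r' s' t' :: real
  defines "region \<equiv> \<lambda>r s t. r > 0 \<and> s > 0 \<and> t > 0 \<and> r \<le> 2 * s \<and> s \<le> 2 * r \<and>
    t + 1 + 2 * r \<le> n - r - s - t \<and> 2 * s \<le> n - r - s"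
  assumes P: "region r s t" "saddle_r n r s t = 0" "saddle_s n r s t = 0" "saddle_t n r s t = 0"
    and Q: "region r' s' t'" "saddle_r n r' s' t' = 0" "saddle_s n r' s' t' = 0" "saddle_t n r' s' t' = 0"
  shows "r' = r \<and> s' = s \<and> t' = t"
proof (rule ccontr)
  assume neq: "\<not> (r' = r \<and> s' = s \<and> t' = t)"
  define dr ds dt where "dr = r' - r" and "ds = s' - s" and "dt = t' - t"
  have nz: "dr \<noteq> 0 \<or> ds \<noteq> 0 \<or> dt \<noteq> 0" using neq by (auto simp: dr_def ds_def dt_def)
  \<comment> \<open>The derivative of \<open>phase\<close> along the segment. It vanishes at both
    ends, while the mean value theorem makes it strictly decrease in between.\<close>
  define h where "h x = saddle_r n (r + x * dr) (s + x * ds) (t + x * dt) * dr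
    + saddle_s n (r + x * dr) (s + x * ds) (t + x * dt) * ds
    + saddle_t n (r + x * dr) (s + x * ds) (t + x * dt) * dt" for x
  have reg: "region (r + x * dr) (s + x * ds) (t + x * dt)" if x: "0 \<le> x" "x \<le> 1" for x
  proof -
    have conv: "r + x * dr = (1 - x) * r + x * r'" "s + x * ds = (1 - x) * s + x * s'"
      "t + x * dt = (1 - x) * t + x * t'"
      by (simp_all add: dr_def ds_def dt_def algebra_simps)
    have pos: "(1 - x) * a + x * b > 0" if "a > 0" "b > 0" for a b :: real
      using that x by (metis add_nonneg_pos add_pos_nonneg diff_ge_0_iff_ge diff_gt_0_iff_gt
          less_eq_real_def mult_nonneg_nonneg mult_pos_pos zero_less_one)
    have lin: "(1 - x) * a + x * b \<ge> 0" if "a \<ge> 0" "b \<ge> 0" for a b :: real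
      using that x by simp
    have "0 \<le> (1 - x) * (2 * s - r) + x * (2 * s' - r')"
      "0 \<le> (1 - x) * (2 * r - s) + x * (2 * r' - s')"
      "0 \<le> (1 - x) * (n - r - s - t - (t + 1 + 2 * r)) + x * (n - r' - s' - t' - (t' + 1 + 2 * r'))"
      "0 \<le> (1 - x) * (n - r - s - 2 * s) + x * (n - r' - s' - 2 * s')"
      using P(1) Q(1) by (intro lin; simp add: region_def)+
    then show ?thesis
      using P(1) Q(1) pos unfolding region_def conv by (simp add: algebra_simps)
  qed
  have "\<exists>x. 0 < x \<and> x < 1 \<and> h 1 - h 0 = (1 - 0) *
     (let r = r + x * dr; s = s + x * ds; t = t + x * dt; u = n - r - s - t in
      - (Polygamma 1 (r + 1) * dr\<^sup>2 + Polygamma 1 (s + 1) * ds\<^sup>2 + Polygamma 1 (t + 1) * dt\<^sup>2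
        + Polygamma 1 (u + 1) * (dr + ds + dt)\<^sup>2)
      - (u / r\<^sup>2 + 2 / r) * dr\<^sup>2 - ((n - r - s + 1) / s\<^sup>2 + 2 / s) * ds\<^sup>2
      - 2 * dr * ds * (1 / r + 1 / s) - 2 * dt * dr / r)"
  proof (rule MVT2)
    fix x :: real assume x: "0 \<le> x" "x \<le> 1"
    define R S T where "R = r + x * dr" and "S = s + x * ds" and "T = t + x * dt"
    have pos: "R > 0" "S > 0" "T > 0" "n - R - S - T > 0"
      using reg[OF x] by (auto simp: region_def R_def S_def T_def)
    have ni: "R + 1 \<notin> \<int>\<^sub>\<le>\<^sub>0" "S + 1 \<notin> \<int>\<^sub>\<le>\<^sub>0" "T + 1 \<notin> \<int>\<^sub>\<le>\<^sub>0" "n - R - S - T + 1 \<notin> \<int>\<^sub>\<le>\<^sub>0"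
      using pos by (auto elim!: nonpos_Ints_cases)
    define psu where "psu = Polygamma 1 (n - R - S - T + 1) * (- dr - ds - dt)"
    have dR: "((\<lambda>x. saddle_r n (r + x * dr) (s + x * ds) (t + x * dt)) has_real_derivative
      (- dr / R - ds / S + ((- dr - ds - dt) * R - (n - R - S - T) * dr) / (R * R)
       - Polygamma 1 (R + 1) * dr + psu)) (at x)"
      unfolding saddle_r_def psu_def using pos ni unfolding R_def S_def T_def
      by (auto intro!: derivative_eq_intros)
    have dS: "((\<lambda>x. saddle_s n (r + x * dr) (s + x * ds) (t + x * dt)) has_real_derivative
      (- dr / R - ds / S + ((- dr - ds) * S - (n - R - S + 1) * ds) / (S * S)
       - Polygamma 1 (S + 1) * ds + psu)) (at x)"
      unfolding saddle_s_def psu_def using pos ni unfolding R_def S_def T_def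
      by (auto intro!: derivative_eq_intros)
    have dT: "((\<lambda>x. saddle_t n (r + x * dr) (s + x * ds) (t + x * dt)) has_real_derivative
      (- dr / R - Polygamma 1 (T + 1) * dt + psu)) (at x)"
      unfolding saddle_t_def psu_def using pos ni unfolding R_def S_def T_def
      by (auto intro!: derivative_eq_intros)
    have e1: "((- dr - ds - dt) * R - (n - R - S - T) * dr) / (R * R) =
        (- dr - ds - dt) / R - (n - R - S - T) / R\<^sup>2 * dr"
      using pos by (simp add: field_simps power2_eq_square)
    have e2: "((- dr - ds) * S - (n - R - S + 1) * ds) / (S * S) =
        (- dr - ds) / S - (n - R - S + 1) / S\<^sup>2 * ds"
      using pos by (simp add: field_simps power2_eq_square)
    have "(h has_real_derivative
       ((- dr / R - ds / S + ((- dr - ds - dt) * R - (n - R - S - T) * dr) / (R * R)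
         - Polygamma 1 (R + 1) * dr + psu) * dr
       + (- dr / R - ds / S + ((- dr - ds) * S - (n - R - S + 1) * ds) / (S * S)
         - Polygamma 1 (S + 1) * ds + psu) * ds
       + (- dr / R - Polygamma 1 (T + 1) * dt + psu) * dt)) (at x)"
      unfolding h_def by (intro DERIV_add DERIV_cmult_right dR dS dT)
    also have "((- dr / R - ds / S + ((- dr - ds - dt) * R - (n - R - S - T) * dr) / (R * R)
         - Polygamma 1 (R + 1) * dr + psu) * dr
       + (- dr / R - ds / S + ((- dr - ds) * S - (n - R - S + 1) * ds) / (S * S)
         - Polygamma 1 (S + 1) * ds + psu) * ds
       + (- dr / R - Polygamma 1 (T + 1) * dt + psu) * dt) =
      - (Polygamma 1 (R + 1) * dr\<^sup>2 + Polygamma 1 (S + 1) * ds\<^sup>2 + Polygamma 1 (T + 1) * dt\<^sup>2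
        + Polygamma 1 (n - R - S - T + 1) * (dr + ds + dt)\<^sup>2)
      - ((n - R - S - T) / R\<^sup>2 + 2 / R) * dr\<^sup>2 - ((n - R - S + 1) / S\<^sup>2 + 2 / S) * ds\<^sup>2
      - 2 * dr * ds * (1 / R + 1 / S) - 2 * dt * dr / R"
      unfolding e1 e2 psu_def
      by (simp add: algebra_simps power2_eq_square add_divide_distrib diff_divide_distrib)
    finally show "(h has_real_derivative
     (let r = r + x * dr; s = s + x * ds; t = t + x * dt; u = n - r - s - t in
      - (Polygamma 1 (r + 1) * dr\<^sup>2 + Polygamma 1 (s + 1) * ds\<^sup>2 + Polygamma 1 (t + 1) * dt\<^sup>2
        + Polygamma 1 (u + 1) * (dr + ds + dt)\<^sup>2)
      - (u / r\<^sup>2 + 2 / r) * dr\<^sup>2 - ((n - r - s + 1) / s\<^sup>2 + 2 / s) * ds\<^sup>2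
      - 2 * dr * ds * (1 / r + 1 / s) - 2 * dt * dr / r)) (at x)"
      unfolding Let_def R_def S_def T_def .
  qed simp
  then obtain x where x: "0 < x" "x < 1" and eq: "h 1 - h 0 =
     (let r = r + x * dr; s = s + x * ds; t = t + x * dt; u = n - r - s - t in
      - (Polygamma 1 (r + 1) * dr\<^sup>2 + Polygamma 1 (s + 1) * ds\<^sup>2 + Polygamma 1 (t + 1) * dt\<^sup>2
        + Polygamma 1 (u + 1) * (dr + ds + dt)\<^sup>2)
      - (u / r\<^sup>2 + 2 / r) * dr\<^sup>2 - ((n - r - s + 1) / s\<^sup>2 + 2 / s) * ds\<^sup>2
      - 2 * dr * ds * (1 / r + 1 / s) - 2 * dt * dr / r)"
    by (simp only: mult_1 diff_zero) blast
  have "h 1 - h 0 < 0"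
    unfolding eq Let_def using reg[of x, unfolded region_def] less_imp_le[OF x(1)] less_imp_le[OF x(2)] nz
    by (elim meta_impE conjE) (assumption | rule saddle_point_segment_concave)+
  moreover have "h 0 = 0" "h 1 = 0"
    using P Q by (simp_all add: h_def dr_def ds_def dt_def)
  ultimately show False by simp
qed

section \<open>Location of the saddle points\<close>

text \<open>Exponentiating the digamma terms turns the third saddle point equation into a product
  relation, and \<open>expsi x\<close> is x up to an additive error between 1/2 and 1.\<close>

definition expsi :: "real \<Rightarrow> real" where
  "expsi x = exp (Digamma (x + 1))"

lemma expsi_pos: "expsi x > 0" and ln_expsi: "ln (expsi x) = Digamma (x + 1)"
  by (simp_all add: expsi_def)

lemma expsi_bounds:
  assumes "x > 0"
  shows "x + 1 / 2 \<le> expsi x" "expsi x \<le> x + 1" "expsi x \<le> x * exp (1 / (2 * x))"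
proof -
  have "exp (ln (x + 1 / 2)) \<le> expsi x" "expsi x \<le> exp (ln (x + 1))" "expsi x \<le> exp (ln x + 1 / (2 * x))"
    unfolding expsi_def exp_le_cancel_iff
    using assms by (intro Digamma_plus1_ge_ln_plus_half Digamma_plus1_le_ln_plus1 Digamma_plus1_le_ln_plus; simp)+
  then show "x + 1 / 2 \<le> expsi x" "expsi x \<le> x + 1" "expsi x \<le> x * exp (1 / (2 * x))"
    using assms by (simp_all add: exp_add)
qed

text \<open>The third equation eliminates \<open>Digamma (u + 1)\<close> from the other two; the
  terms \<open>ln r\<close> cancel at the same time.\<close>

lemma saddle_point_expsi:
  assumes "saddle_point n r s t"
  defines "u \<equiv> real n - r - s - t"
  shows "r > 0" "s > 0" "t > 0" "u > 0"
    and "expsi u = r * expsi t"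
    and "u / r + ln (expsi t) = ln s + Digamma (r + 1)"
    and "(t + u + 1) / s + ln (expsi t) = ln s + Digamma (s + 1)"
proof -
  note sp = assms(1)[unfolded saddle_point_iff]
  show pos: "r > 0" "s > 0" "t > 0" "u > 0" using sp by (auto simp: u_def)
  have psi: "Digamma (u + 1) = ln r + Digamma (t + 1)"
    using sp by (simp add: saddle_t_def u_def)
  show "expsi u = r * expsi t"
    using pos by (simp add: expsi_def psi exp_add)
  have "- ln r - ln s + u / r - Digamma (r + 1) + Digamma (u + 1) = 0"
    using sp by (simp add: saddle_r_def u_def)
  then show "u / r + ln (expsi t) = ln s + Digamma (r + 1)"
    by (simp add: ln_expsi psi)
  have "- ln r - ln s + (t + u + 1) / s - Digamma (s + 1) + Digamma (u + 1) = 0"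
    using sp by (simp add: saddle_s_def u_def)
  then show "(t + u + 1) / s + ln (expsi t) = ln s + Digamma (s + 1)"
    by (simp add: ln_expsi psi)
qed

text \<open>If r < 1, the first equation bounds \<open>expsi t\<close> by 2s, so t and u are at most
  2s and n is at most 1 + 5s. The second equation then keeps \<open>Digamma (s + 1)\<close> below 6,
  hence s below e^6, which bounds n.\<close>

lemma saddle_point_r_ge_1:
  assumes sp: "saddle_point n r s t" and n: "real n > 6 + 10 * exp 6"
  shows "r \<ge> 1"
proof (rule ccontr)
  assume "\<not> r \<ge> 1"
  then have r1: "r < 1" by simp
  define u where "u = real n - r - s - t"
  note S = saddle_point_expsi[OF sp, folded u_def]
  have "u / r > 0" using S by simp
  then have "ln (expsi t) < ln s + ln (r + 1)"
    using S(6) Digamma_plus1_le_ln_plus1[OF S(1)] by linarith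
  also have "\<dots> = ln (s * (r + 1))" using S by (simp add: ln_mult_pos)
  finally have "expsi t < s * (r + 1)" using S expsi_pos by simp
  also have "\<dots> \<le> s * 2" using S r1 by (intro mult_left_mono) auto
  finally have e: "expsi t \<le> 2 * s" by simp
  have "t \<le> 2 * s" using e expsi_bounds(1)[OF S(3)] by simp
  moreover have "r * expsi t \<le> 1 * expsi t" using r1 expsi_pos[of t] by (intro mult_right_mono) auto
  then have "u \<le> 2 * s" using e expsi_bounds(1)[OF S(4)] S(5) by linarith
  moreover have "real n = r + s + t + u" by (simp add: u_def)
  ultimately have tu: "t + u \<le> 4 * s" and ns: "real n \<le> 1 + 5 * s" using r1 by auto
  have "0 < exp (6::real)" by simp
  then have s1: "s \<ge> 1" using ns n by linarith
  have "(t + u + 1) / s \<le> 5"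
    using tu s1 by (simp add: field_simps)
  moreover have "ln (expsi t) \<le> ln 2 + ln s"
    using e expsi_pos[of t] S(2) by (simp add: ln_mult_pos [symmetric])
  moreover have "ln 2 \<le> (1::real)" using ln_le_minus_one[of "2::real"] by simp
  ultimately have "ln (s + 1 / 2) \<le> 6"
    using S(7) Digamma_plus1_ge_ln_plus_half[OF S(2)] by linarith
  then have "exp (ln (s + 1 / 2)) \<le> exp 6" by simp
  then have "s \<le> exp 6" using S(2) by simp
  then show False using ns n \<open>0 < exp (6::real)\<close> by linarith
qed

text \<open>A bound on s bounds everything: the second equation bounds \<open>expsi t\<close>, hence
  t and u/r, and then the first equation bounds r. Read contrapositively, s tends to infinity with
  n.\<close>

lemma saddle_point_s_large:
  assumes sp: "saddle_point n r s t" and M: "s \<le> M" "M \<ge> 1"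
  defines "K \<equiv> M * (M + 1)"
  shows "real n \<le> exp (K + ln (M + 1)) + M + K + exp (K + ln (M + 1)) * K"
proof -
  define u where "u = real n - r - s - t"
  note S = saddle_point_expsi[OF sp, folded u_def]
  have "(t + u + 1) / s > 0" using S by simp
  then have lt: "ln (expsi t) \<le> ln s + ln (s + 1)"
    using S(7) Digamma_plus1_le_ln_plus1[OF S(2)] by linarith
  also have "\<dots> = ln (s * (s + 1))" using S by (simp add: ln_mult_pos)
  finally have "expsi t \<le> s * (s + 1)" using S expsi_pos by simp
  also have "\<dots> \<le> K" unfolding K_def using M S by (intro mult_mono) auto
  finally have e: "expsi t \<le> K" .
  have "u \<le> r * expsi t" using expsi_bounds(1)[OF S(4)] S(5) by simp
  then have ur: "u / r \<le> expsi t" using S by (simp add: field_simps)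
  have "ln (s + 1) \<le> ln (M + 1)" using M S by simp
  then have "ln (r + 1 / 2) \<le> K + ln (M + 1)"
    using Digamma_plus1_ge_ln_plus_half[OF S(1)] S(6) ur e lt by linarith
  then have "exp (ln (r + 1 / 2)) \<le> exp (K + ln (M + 1))" by simp
  then have r: "r \<le> exp (K + ln (M + 1))" using S by simp
  have "r * expsi t \<le> exp (K + ln (M + 1)) * K"
    using r e S expsi_pos[of t] by (intro mult_mono) auto
  then have "u \<le> exp (K + ln (M + 1)) * K" using \<open>u \<le> r * expsi t\<close> by simp
  moreover have "t \<le> K" using e expsi_bounds(1)[OF S(3)] by simp
  moreover have "real n = r + s + t + u" by (simp add: u_def)
  ultimately show ?thesis using r M by linarith
qed

section \<open>Asymptotics along an arbitrary sequence of saddle points\<close>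

locale saddle_sequence =
  fixes r s t :: "nat \<Rightarrow> real"
  assumes saddle: "\<forall>\<^sub>F n in sequentially. saddle_point n (r n) (s n) (t n)"
begin

text \<open>\<open>u\<close> is the argument of the fourth factorial in the triple sum;
  \<open>m = t + u\<close> is the argument that takes the place of those of \<open>t\<close> and
  \<open>u\<close> once \<open>t\<close> has been summed out.\<close>

definition u where "u n = real n - r n - s n - t n"
definition m where "m n = real n - r n - s n"
definition \<tau> where "\<tau> n = expsi (t n)"

lemma m_eq: "m n = t n + u n"
  by (simp add: m_def u_def)

lemma ev_r: "\<forall>\<^sub>F n in sequentially. r n \<ge> 1"
proof -
  have "\<forall>\<^sub>F n :: nat in sequentially. real n > 6 + 10 * exp 6" by real_asymp
  with saddle show ?thesis by eventually_elim (rule saddle_point_r_ge_1)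
qed

lemma s_at_top: "filterlim s at_top sequentially"
  unfolding filterlim_at_top_ge[where c = 1]
proof (intro allI impI)
  fix M :: real assume M: "M \<ge> 1"
  define K where "K = M * (M + 1)"
  have "\<forall>\<^sub>F n :: nat in sequentially. real n > exp (K + ln (M + 1)) + M + K + exp (K + ln (M + 1)) * K"
    using filterlim_real_sequentially by (simp add: filterlim_at_top_dense)
  with saddle show "\<forall>\<^sub>F n in sequentially. M \<le> s n"
  proof eventually_elim
    case (elim n)
    show ?case
    proof (rule ccontr)
      assume "\<not> M \<le> s n"
      then show False
        using saddle_point_s_large[OF elim(1) _ M, folded K_def] elim(2) by simp
    qed
  qed
qed

lemma ev_s: "(\<forall>\<^sub>F x in at_top. P x) \<Longrightarrow> \<forall>\<^sub>F n in sequentially. P (s n)"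
  by (rule eventually_compose_filterlim[OF _ s_at_top])

text \<open>The working form of the system. It implies that \<open>(r + 1) * \<tau>\<close> lies
  between \<open>m + 1\<close> and \<open>m + 2\<close>, so that s, which is known to tend to
  infinity, can serve as the parameter: the two equations relate \<open>\<tau>\<close> and
  \<open>m\<close> to s, and r follows from their quotient.\<close>

lemma ev_basic:
  "\<forall>\<^sub>F n in sequentially. r n \<ge> 1 \<and> s n \<ge> 1 \<and> t n > 0 \<and> u n > 0 \<and>
     t n + 1 / 2 \<le> \<tau> n \<and> \<tau> n \<le> t n + 1 \<and> u n + 1 / 2 \<le> r n * \<tau> n \<and> r n * \<tau> n \<le> u n + 1 \<and>
     u n / r n + ln (\<tau> n) = ln (s n) + Digamma (r n + 1) \<and>
     m n + 1 = s n * (ln (s n) + Digamma (s n + 1) - ln (\<tau> n))"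
  using saddle ev_r ev_s[OF eventually_ge_at_top[of 1]]
proof eventually_elim
  case (elim n)
  note S = saddle_point_expsi[OF elim(1), folded u_def \<tau>_def]
  have "(t n + u n + 1) / s n = ln (s n) + Digamma (s n + 1) - ln (\<tau> n)" using S(7) by linarith
  then have "m n + 1 = s n * (ln (s n) + Digamma (s n + 1) - ln (\<tau> n))"
    using S(2) by (simp add: m_eq field_simps)
  then show ?case
    using elim S expsi_bounds[OF S(3)] expsi_bounds[OF S(4)] by (auto simp: \<tau>_def)
qed

text \<open>Both \<open>u / r\<close> and \<open>ln \<tau>\<close> are at most
  \<open>\<tau>\<close>, so the first equation gives 2 \<open>\<tau>\<close> at least
  \<open>ln s\<close>. This crude bound starts a bootstrap: it yields an upper bound for r, that one
  an upper bound for \<open>\<tau>\<close>, then a lower bound for \<open>m\<close>, and finally a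
  lower bound for r.\<close>

lemma ev_tau_ge: "\<forall>\<^sub>F n in sequentially. \<tau> n \<ge> ln (s n) / 2"
  using ev_basic
proof eventually_elim
  case (elim n)
  have "u n / r n \<le> \<tau> n" using elim by (simp add: field_simps)
  moreover have "ln (\<tau> n) \<le> \<tau> n" using elim ln_le_minus_one[of "\<tau> n"] by simp
  moreover have "Digamma (r n + 1) \<ge> 0"
    using Digamma_plus1_ge_ln_plus_half[of "r n"] ln_ge_zero[of "r n + 1 / 2"] elim by linarith
  ultimately show ?case using elim by linarith
qed

lemma ev_tau_ge_1: "\<forall>\<^sub>F n in sequentially. \<tau> n \<ge> 1"
proof -
  have "\<forall>\<^sub>F x :: real in at_top. ln x / 2 \<ge> 1" by real_asymp
  from ev_s[OF this] ev_tau_ge show ?thesis by eventually_elim linarith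
qed

text \<open>\<open>(r + 1) * \<tau>\<close> is at most \<open>m + 2\<close>, which is at most about
  2 s ln s, while \<open>\<tau>\<close> is at least half of \<open>ln s\<close>; this gives the
  factor 4, rounded up to 5.\<close>

lemma ev_r_le: "\<forall>\<^sub>F n in sequentially. r n + 1 \<le> 5 * s n"
proof -
  have "\<forall>\<^sub>F x :: real in at_top. 2 * x * ln (x + 1) + 1 \<le> 5 * x * (ln x / 2)"
    "\<forall>\<^sub>F x :: real in at_top. ln x / 2 > 0"
    by real_asymp+
  from this[THEN ev_s] ev_tau_ge ev_tau_ge_1 ev_basic show ?thesis
  proof eventually_elim
    case (elim n)
    have "(r n + 1) * (ln (s n) / 2) \<le> (r n + 1) * \<tau> n"
      using elim by (intro mult_left_mono) auto
    also have "\<dots> \<le> m n + 2" using elim by (simp add: m_eq algebra_simps)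
    also have "m n + 1 \<le> s n * (2 * ln (s n + 1))"
    proof -
      have "ln (\<tau> n) \<ge> 0" using elim by simp
      moreover have "ln (s n) \<le> ln (s n + 1)" using elim by simp
      moreover have "Digamma (s n + 1) \<le> ln (s n + 1)"
        using elim by (intro Digamma_plus1_le_ln_plus1) simp
      ultimately have "ln (s n) + Digamma (s n + 1) - ln (\<tau> n) \<le> 2 * ln (s n + 1)" by linarith
      then have "s n * (ln (s n) + Digamma (s n + 1) - ln (\<tau> n)) \<le> s n * (2 * ln (s n + 1))"
        using elim by (intro mult_left_mono) auto
      then show ?thesis using elim by simp
    qed
    then have "m n + 2 \<le> 2 * s n * ln (s n + 1) + 1" by simp
    also have "\<dots> \<le> 5 * s n * (ln (s n) / 2)" using elim by simp
    finally show ?case using elim by (simp only: mult_le_cancel_right)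
  qed
qed

text \<open>Since \<open>\<tau> - 1\<close> is at most \<open>u / r\<close>, the first equation and
  the bound on r leave \<open>2 * ln s + ln 5 + 1\<close>, and ln 5 is estimated by 4.\<close>

lemma ev_tau_le: "\<forall>\<^sub>F n in sequentially. \<tau> n \<le> 2 * ln (s n) + 5"
  using ev_basic ev_r_le ev_tau_ge_1
proof eventually_elim
  case (elim n)
  have "r n * \<tau> n - r n \<le> u n" using elim by linarith
  then have "\<tau> n - 1 \<le> u n / r n" using elim by (simp add: field_simps)
  moreover have "Digamma (r n + 1) \<le> ln (5 * s n)"
  proof -
    have "Digamma (r n + 1) \<le> ln (r n + 1)"
      using elim by (intro Digamma_plus1_le_ln_plus1) simp
    also have "\<dots> \<le> ln (5 * s n)" using elim by (subst ln_le_cancel_iff) auto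
    finally show ?thesis .
  qed
  moreover have "ln (5 * s n) = ln 5 + ln (s n)" using elim by (simp add: ln_mult_pos)
  moreover have "ln (5::real) \<le> 4" using ln_le_minus_one[of "5::real"] by simp
  moreover have "ln (\<tau> n) \<ge> 0" using elim by simp
  ultimately show ?case using elim by linarith
qed

lemma ev_m_ge: "\<forall>\<^sub>F n in sequentially. m n \<ge> s n * (2 * ln (s n) - ln (2 * ln (s n) + 5)) - 1"
  using ev_basic ev_tau_le ev_tau_ge_1
proof eventually_elim
  case (elim n)
  have "ln (\<tau> n) \<le> ln (2 * ln (s n) + 5)" using elim by (subst ln_le_cancel_iff) auto
  moreover have "ln (s n) \<le> Digamma (s n + 1)"
  proof -
    have "ln (s n) \<le> ln (s n + 1 / 2)" using elim by simp
    also have "\<dots> \<le> Digamma (s n + 1)" using elim by (intro Digamma_plus1_ge_ln_plus_half) simp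
    finally show ?thesis .
  qed
  ultimately have "2 * ln (s n) - ln (2 * ln (s n) + 5) \<le> ln (s n) + Digamma (s n + 1) - ln (\<tau> n)"
    by linarith
  then have "s n * (2 * ln (s n) - ln (2 * ln (s n) + 5)) \<le> s n * (ln (s n) + Digamma (s n + 1) - ln (\<tau> n))"
    using elim by (intro mult_left_mono) auto
  then show ?case using elim by linarith
qed

lemma ev_r_ge: "\<forall>\<^sub>F n in sequentially. r n \<ge> s n / 2"
proof -
  have "\<forall>\<^sub>F x :: real in at_top. x * (2 * ln x - ln (2 * ln x + 5)) - 1 \<ge> (x / 2 + 1) * (2 * ln x + 5)"
    "\<forall>\<^sub>F x :: real in at_top. 2 * ln x + 5 > 0"
    by real_asymp+
  from this[THEN ev_s] ev_m_ge ev_basic ev_tau_le show ?thesis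
  proof eventually_elim
    case (elim n)
    have "(s n / 2 + 1) * (2 * ln (s n) + 5) \<le> m n" using elim by linarith
    also have "\<dots> \<le> (r n + 1) * \<tau> n" using elim by (simp add: m_eq algebra_simps)
    also have "\<dots> \<le> (r n + 1) * (2 * ln (s n) + 5)" using elim by (intro mult_left_mono) auto
    finally show ?case using elim by (simp only: mult_le_cancel_right) auto
  qed
qed

lemma tau_over_ln_s: "(\<lambda>n. \<tau> n / ln (s n)) \<longlonglongrightarrow> 2"
proof (rule tendsto_sandwich)
  have ln_pos: "\<forall>\<^sub>F x :: real in at_top. ln x > 0" by real_asymp
  show "\<forall>\<^sub>F n in sequentially. (ln (s n) + ln (s n / 2) - ln (2 * ln (s n) + 5)) / ln (s n) \<le> \<tau> n / ln (s n)"
    using ev_s[OF ln_pos] ev_basic ev_r_ge ev_tau_le ev_tau_ge_1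
  proof eventually_elim
    case (elim n)
    have "u n / r n \<le> \<tau> n" using elim by (simp add: field_simps)
    moreover have "ln (\<tau> n) \<le> ln (2 * ln (s n) + 5)" using elim by (subst ln_le_cancel_iff) auto
    moreover have "ln (s n / 2) \<le> Digamma (r n + 1)"
    proof -
      have "ln (s n / 2) \<le> ln (r n + 1 / 2)" using elim by (subst ln_le_cancel_iff) auto
      also have "\<dots> \<le> Digamma (r n + 1)" using elim by (intro Digamma_plus1_ge_ln_plus_half) simp
      finally show ?thesis .
    qed
    ultimately show ?case using elim by (intro divide_right_mono) linarith+
  qed
  show "\<forall>\<^sub>F n in sequentially. \<tau> n / ln (s n) \<le> (2 * ln (s n) + 5) / ln (s n)"
    using ev_s[OF ln_pos] ev_tau_le
    by eventually_elim (intro divide_right_mono, linarith+)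
  have "((\<lambda>x :: real. (ln x + ln (x / 2) - ln (2 * ln x + 5)) / ln x) \<longlongrightarrow> 2) at_top"
    by real_asymp
  from filterlim_compose[OF this s_at_top]
  show "(\<lambda>n. (ln (s n) + ln (s n / 2) - ln (2 * ln (s n) + 5)) / ln (s n)) \<longlonglongrightarrow> 2" .
  have "((\<lambda>x :: real. (2 * ln x + 5) / ln x) \<longlongrightarrow> 2) at_top" by real_asymp
  from filterlim_compose[OF this s_at_top] show "(\<lambda>n. (2 * ln (s n) + 5) / ln (s n)) \<longlonglongrightarrow> 2" .
qed

lemma m_over_s_ln_s: "(\<lambda>n. m n / (s n * ln (s n))) \<longlonglongrightarrow> 2"
proof (rule tendsto_sandwich)
  have pos: "\<forall>\<^sub>F x :: real in at_top. x * ln x > 0" by real_asymp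
  show "\<forall>\<^sub>F n in sequentially. (s n * (2 * ln (s n) - ln (2 * ln (s n) + 5)) - 1) / (s n * ln (s n))
      \<le> m n / (s n * ln (s n))"
    using ev_s[OF pos] ev_m_ge
    by eventually_elim (intro divide_right_mono, linarith+)
  show "\<forall>\<^sub>F n in sequentially. m n / (s n * ln (s n)) \<le> s n * (ln (s n) + ln (s n + 1)) / (s n * ln (s n))"
    using ev_s[OF pos] ev_basic ev_tau_ge_1
  proof eventually_elim
    case (elim n)
    have "ln (\<tau> n) \<ge> 0" using elim by simp
    moreover have "Digamma (s n + 1) \<le> ln (s n + 1)"
      using elim by (intro Digamma_plus1_le_ln_plus1) simp
    ultimately have "s n * (ln (s n) + Digamma (s n + 1) - ln (\<tau> n)) \<le> s n * (ln (s n) + ln (s n + 1))"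
      using elim by (intro mult_left_mono) linarith+
    then show ?case using elim by (intro divide_right_mono) linarith+
  qed
  have "((\<lambda>x :: real. (x * (2 * ln x - ln (2 * ln x + 5)) - 1) / (x * ln x)) \<longlongrightarrow> 2) at_top"
    by real_asymp
  from filterlim_compose[OF this s_at_top]
  show "(\<lambda>n. (s n * (2 * ln (s n) - ln (2 * ln (s n) + 5)) - 1) / (s n * ln (s n))) \<longlonglongrightarrow> 2" .
  have "((\<lambda>x :: real. x * (ln x + ln (x + 1)) / (x * ln x)) \<longlongrightarrow> 2) at_top" by real_asymp
  from filterlim_compose[OF this s_at_top]
  show "(\<lambda>n. s n * (ln (s n) + ln (s n + 1)) / (s n * ln (s n))) \<longlonglongrightarrow> 2" .
qed

text \<open>\<open>m\<close> and \<open>\<tau>\<close> have the same limiting factor 2 relative to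
  \<open>s * ln s\<close> and \<open>ln s\<close>, and \<open>(r + 1) * \<tau>\<close> differs from
  \<open>m\<close> by at most 2; the quotient gives the claim.\<close>

lemma r_over_s: "(\<lambda>n. r n / s n) \<longlonglongrightarrow> 1"
proof -
  define \<theta> where "\<theta> n = ((r n + 1) * \<tau> n - m n) / (s n * ln (s n))" for n
  have pos: "\<forall>\<^sub>F x :: real in at_top. x * ln x > 0" "\<forall>\<^sub>F x :: real in at_top. ln x > 0"
    by real_asymp+
  have "\<theta> \<longlonglongrightarrow> 0"
  proof (rule tendsto_sandwich)
    show "\<forall>\<^sub>F n in sequentially. 0 \<le> \<theta> n"
      using ev_s[OF pos(1)] ev_basic unfolding \<theta>_def
      by eventually_elim (intro divide_nonneg_pos, auto simp: m_eq algebra_simps)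
    show "\<forall>\<^sub>F n in sequentially. \<theta> n \<le> 2 / (s n * ln (s n))"
      using ev_s[OF pos(1)] ev_basic unfolding \<theta>_def
      by eventually_elim (intro divide_right_mono, auto simp: m_eq algebra_simps)
    have "((\<lambda>x :: real. 2 / (x * ln x)) \<longlongrightarrow> 0) at_top" by real_asymp
    from filterlim_compose[OF this s_at_top] show "(\<lambda>n. 2 / (s n * ln (s n))) \<longlonglongrightarrow> 0" .
  qed simp
  moreover have "(\<lambda>n. 1 / s n) \<longlonglongrightarrow> 0"
    by (rule filterlim_compose[OF _ s_at_top]) real_asymp
  ultimately have "(\<lambda>n. (m n / (s n * ln (s n)) + \<theta> n) / (\<tau> n / ln (s n)) - 1 / s n) \<longlonglongrightarrow> (2 + 0) / 2 - 0"
    by (intro tendsto_intros m_over_s_ln_s tau_over_ln_s) auto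
  then have "(\<lambda>n. (m n / (s n * ln (s n)) + \<theta> n) / (\<tau> n / ln (s n)) - 1 / s n) \<longlonglongrightarrow> 1" by simp
  moreover have "\<forall>\<^sub>F n in sequentially. (m n / (s n * ln (s n)) + \<theta> n) / (\<tau> n / ln (s n)) - 1 / s n = r n / s n"
    using ev_s[OF pos(2)] ev_basic ev_tau_ge_1
  proof eventually_elim
    case (elim n)
    have "m n / (s n * ln (s n)) + \<theta> n = (r n + 1) * \<tau> n / (s n * ln (s n))"
      by (simp add: \<theta>_def add_divide_distrib [symmetric])
    then show ?case using elim by (simp add: field_simps)
  qed
  ultimately show ?thesis by (rule Lim_transform_eventually)
qed

lemma n_over_s_ln_s: "(\<lambda>n. real n / (s n * ln (s n))) \<longlonglongrightarrow> 2"
proof -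
  have "((\<lambda>x :: real. 1 / ln x) \<longlongrightarrow> 0) at_top" by real_asymp
  note l = filterlim_compose[OF this s_at_top]
  have "(\<lambda>n. r n / s n * (1 / ln (s n)) + 1 / ln (s n) + m n / (s n * ln (s n))) \<longlonglongrightarrow> 1 * 0 + 0 + 2"
    by (intro tendsto_intros r_over_s l m_over_s_ln_s)
  then have "(\<lambda>n. r n / s n * (1 / ln (s n)) + 1 / ln (s n) + m n / (s n * ln (s n))) \<longlonglongrightarrow> 2" by simp
  moreover have pos: "\<forall>\<^sub>F x :: real in at_top. ln x > 0" by real_asymp
  have "\<forall>\<^sub>F n in sequentially. r n / s n * (1 / ln (s n)) + 1 / ln (s n) + m n / (s n * ln (s n))
      = real n / (s n * ln (s n))"
    using ev_s[OF pos] ev_basic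
    by eventually_elim (auto simp: m_def field_simps)
  ultimately show ?thesis by (rule Lim_transform_eventually)
qed

text \<open>Taking logarithms in n ~ 2 s ln s inverts the relation, so the results in terms of s can
  be restated in terms of n.\<close>

lemma ln_over_ln_s: "(\<lambda>n. ln (real n) / ln (s n)) \<longlonglongrightarrow> 1"
proof -
  have "((\<lambda>x :: real. 1 / ln x) \<longlongrightarrow> 0) at_top" "((\<lambda>x :: real. ln (ln x) / ln x) \<longlongrightarrow> 0) at_top"
    by real_asymp+
  note l = this[THEN filterlim_compose[OF _ s_at_top]]
  have "(\<lambda>n. ln (real n / (s n * ln (s n))) * (1 / ln (s n)) + 1 + ln (ln (s n)) / ln (s n))
      \<longlonglongrightarrow> ln 2 * 0 + 1 + 0"
    by (intro tendsto_intros n_over_s_ln_s l) auto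
  then have "(\<lambda>n. ln (real n / (s n * ln (s n))) * (1 / ln (s n)) + 1 + ln (ln (s n)) / ln (s n))
      \<longlonglongrightarrow> 1" by simp
  moreover have pos: "\<forall>\<^sub>F x :: real in at_top. ln x > 0" by real_asymp
  have "\<forall>\<^sub>F n in sequentially. ln (real n / (s n * ln (s n))) * (1 / ln (s n)) + 1 + ln (ln (s n)) / ln (s n)
      = ln (real n) / ln (s n)"
    using ev_s[OF pos] ev_basic eventually_gt_at_top[of 0]
    by eventually_elim (auto simp: ln_div ln_mult_pos field_simps)
  ultimately show ?thesis by (rule Lim_transform_eventually)
qed

lemma lim_s: "(\<lambda>n. s n * ln (real n) / real n) \<longlonglongrightarrow> 1 / 2"
proof -
  have "(\<lambda>n. (ln (real n) / ln (s n)) / (real n / (s n * ln (s n)))) \<longlonglongrightarrow> 1 / 2"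
    by (intro tendsto_intros ln_over_ln_s n_over_s_ln_s) auto
  moreover have pos: "\<forall>\<^sub>F x :: real in at_top. ln x > 0" by real_asymp
  have "\<forall>\<^sub>F n in sequentially. (ln (real n) / ln (s n)) / (real n / (s n * ln (s n))) = s n * ln (real n) / real n"
    using ev_s[OF pos] ev_basic eventually_gt_at_top[of 0]
    by eventually_elim (auto simp: field_simps)
  ultimately show ?thesis by (rule Lim_transform_eventually)
qed

lemma lim_r: "(\<lambda>n. r n * ln (real n) / real n) \<longlonglongrightarrow> 1 / 2"
proof -
  have "(\<lambda>n. r n / s n * (s n * ln (real n) / real n)) \<longlonglongrightarrow> 1 * (1 / 2)"
    by (intro tendsto_intros r_over_s lim_s)
  then have "(\<lambda>n. r n / s n * (s n * ln (real n) / real n)) \<longlonglongrightarrow> 1 / 2" by simp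
  moreover have "\<forall>\<^sub>F n in sequentially. r n / s n * (s n * ln (real n) / real n) = r n * ln (real n) / real n"
    using ev_basic by eventually_elim auto
  ultimately show ?thesis by (rule Lim_transform_eventually)
qed

lemma lim_tau: "(\<lambda>n. \<tau> n / ln (real n)) \<longlonglongrightarrow> 2"
proof -
  have "(\<lambda>n. (\<tau> n / ln (s n)) / (ln (real n) / ln (s n))) \<longlonglongrightarrow> 2 / 1"
    by (intro tendsto_intros tau_over_ln_s ln_over_ln_s) auto
  then have "(\<lambda>n. (\<tau> n / ln (s n)) / (ln (real n) / ln (s n))) \<longlonglongrightarrow> 2" by simp
  moreover have pos: "\<forall>\<^sub>F x :: real in at_top. ln x > 0" by real_asymp
  have "\<forall>\<^sub>F n in sequentially. (\<tau> n / ln (s n)) / (ln (real n) / ln (s n)) = \<tau> n / ln (real n)"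
    using ev_s[OF pos] by eventually_elim (auto simp: field_simps)
  ultimately show ?thesis by (rule Lim_transform_eventually)
qed

lemma tau_at_top: "filterlim \<tau> at_top sequentially"
proof -
  have "filterlim (\<lambda>x :: real. ln x / 2) at_top at_top" by real_asymp
  from filterlim_at_top_mono[OF filterlim_compose[OF this s_at_top] ev_tau_ge] show ?thesis .
qed

lemma t_at_top: "filterlim t at_top sequentially"
proof -
  have "filterlim (\<lambda>n. \<tau> n + (-1)) at_top sequentially"
    by (rule filterlim_compose[OF _ tau_at_top]) real_asymp
  then show ?thesis
    by (rule filterlim_at_top_mono) (use ev_basic in eventually_elim, auto)
qed

lemma lim_tau_minus_t: "(\<lambda>n. \<tau> n - t n) \<longlonglongrightarrow> 1 / 2"
proof (rule tendsto_sandwich[of "\<lambda>_. 1 / 2" _ _ "\<lambda>n. t n * (exp (1 / (2 * t n)) - 1)"])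
  show "\<forall>\<^sub>F n in sequentially. 1 / 2 \<le> \<tau> n - t n"
    using ev_basic by eventually_elim auto
  show "\<forall>\<^sub>F n in sequentially. \<tau> n - t n \<le> t n * (exp (1 / (2 * t n)) - 1)"
    using ev_basic
  proof eventually_elim
    case (elim n)
    then show ?case using expsi_bounds(3)[of "t n"] by (simp add: \<tau>_def algebra_simps)
  qed
  have "((\<lambda>x :: real. x * (exp (1 / (2 * x)) - 1)) \<longlongrightarrow> 1 / 2) at_top" by real_asymp
  from filterlim_compose[OF this t_at_top]
  show "(\<lambda>n. t n * (exp (1 / (2 * t n)) - 1)) \<longlonglongrightarrow> 1 / 2" .
qed simp

lemma lim_t: "(\<lambda>n. t n / ln (real n)) \<longlonglongrightarrow> 2"
proof -
  have "(\<lambda>n :: nat. 1 / ln (real n)) \<longlonglongrightarrow> 0" by real_asymp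
  then have "(\<lambda>n. \<tau> n / ln (real n) - (\<tau> n - t n) * (1 / ln (real n))) \<longlonglongrightarrow> 2 - 1 / 2 * 0"
    by (intro tendsto_intros lim_tau lim_tau_minus_t)
  then show ?thesis by (simp add: diff_divide_distrib)
qed

lemma r_at_top: "filterlim r at_top sequentially"
proof -
  have "filterlim (\<lambda>x :: real. x / 2) at_top at_top" by real_asymp
  from filterlim_at_top_mono[OF filterlim_compose[OF this s_at_top] ev_r_ge] show ?thesis .
qed

lemma lim_t_over_r: "(\<lambda>n. t n / r n) \<longlonglongrightarrow> 0"
proof -
  have l: "(\<lambda>n :: nat. (ln (real n))\<^sup>2 / real n) \<longlonglongrightarrow> 0" by real_asymp
  have "(\<lambda>n. (t n / ln (real n)) / (r n * ln (real n) / real n) * ((ln (real n))\<^sup>2 / real n)) \<longlonglongrightarrow> 2 / (1 / 2) * 0"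
    by (intro tendsto_intros lim_t lim_r l) auto
  then have "(\<lambda>n. (t n / ln (real n)) / (r n * ln (real n) / real n) * ((ln (real n))\<^sup>2 / real n)) \<longlonglongrightarrow> 0" by simp
  moreover have pos: "\<forall>\<^sub>F n :: nat in sequentially. ln (real n) > 0" by real_asymp
  have "\<forall>\<^sub>F n in sequentially. (t n / ln (real n)) / (r n * ln (real n) / real n) * ((ln (real n))\<^sup>2 / real n) = t n / r n"
    using pos ev_basic eventually_gt_at_top[of 0]
    by eventually_elim (auto simp: field_simps power2_eq_square)
  ultimately show ?thesis by (rule Lim_transform_eventually)
qed

text \<open>The limit 1/2 is that of \<open>\<tau> - t\<close>: both
  \<open>(r * \<tau> - u) / r\<close> and \<open>t / r\<close> vanish. This second-order fact makes
  the first component of the gradient small and later contributes one half to the constant in the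
  exponent.\<close>

lemma lim_shift: "(\<lambda>n. m n / r n - t n) \<longlonglongrightarrow> 1 / 2"
proof -
  have inv_r: "(\<lambda>n. 1 / r n) \<longlonglongrightarrow> 0"
    by (rule filterlim_compose[OF _ r_at_top]) real_asymp
  have "(\<lambda>n. (r n * \<tau> n - u n) / r n) \<longlonglongrightarrow> 0"
  proof (rule tendsto_sandwich[of "\<lambda>_. 0" _ _ "\<lambda>n. 1 / r n"])
    show "\<forall>\<^sub>F n in sequentially. 0 \<le> (r n * \<tau> n - u n) / r n"
      using ev_basic by eventually_elim auto
    show "\<forall>\<^sub>F n in sequentially. (r n * \<tau> n - u n) / r n \<le> 1 / r n"
      using ev_basic by eventually_elim (intro divide_right_mono, auto)
  qed (use inv_r in auto)
  then have "(\<lambda>n. \<tau> n - t n - (r n * \<tau> n - u n) / r n + t n / r n) \<longlonglongrightarrow> 1 / 2 - 0 + 0"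
    by (intro tendsto_intros lim_tau_minus_t lim_t_over_r)
  then have "(\<lambda>n. \<tau> n - t n - (r n * \<tau> n - u n) / r n + t n / r n) \<longlonglongrightarrow> 1 / 2" by simp
  moreover have "\<forall>\<^sub>F n in sequentially. \<tau> n - t n - (r n * \<tau> n - u n) / r n + t n / r n = m n / r n - t n"
    using ev_basic by eventually_elim (auto simp: m_eq field_simps)
  ultimately show ?thesis by (rule Lim_transform_eventually)
qed

lemma lim_over_n:
  "(\<lambda>n. r n / real n) \<longlonglongrightarrow> 0" "(\<lambda>n. s n / real n) \<longlonglongrightarrow> 0" "(\<lambda>n. t n / real n) \<longlonglongrightarrow> 0"
  "(\<lambda>n. m n / real n) \<longlonglongrightarrow> 1" "(\<lambda>n. u n / real n) \<longlonglongrightarrow> 1"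
proof -
  have l: "(\<lambda>n :: nat. 1 / ln (real n)) \<longlonglongrightarrow> 0" "(\<lambda>n :: nat. ln (real n) / real n) \<longlonglongrightarrow> 0" by real_asymp+
  have pos: "\<forall>\<^sub>F n :: nat in sequentially. ln (real n) > 0" by real_asymp
  have "(\<lambda>n. r n * ln (real n) / real n * (1 / ln (real n))) \<longlonglongrightarrow> 1 / 2 * 0"
    by (intro tendsto_intros lim_r l)
  then show r: "(\<lambda>n. r n / real n) \<longlonglongrightarrow> 0"
    unfolding mult_zero_right by (rule Lim_transform_eventually) (use pos in eventually_elim, auto)
  have "(\<lambda>n. s n * ln (real n) / real n * (1 / ln (real n))) \<longlonglongrightarrow> 1 / 2 * 0"
    by (intro tendsto_intros lim_s l)
  then show s: "(\<lambda>n. s n / real n) \<longlonglongrightarrow> 0"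
    unfolding mult_zero_right by (rule Lim_transform_eventually) (use pos in eventually_elim, auto)
  have "(\<lambda>n. t n / ln (real n) * (ln (real n) / real n)) \<longlonglongrightarrow> 2 * 0"
    by (intro tendsto_intros lim_t l)
  then show t: "(\<lambda>n. t n / real n) \<longlonglongrightarrow> 0"
    unfolding mult_zero_right by (rule Lim_transform_eventually) (use pos in eventually_elim, auto)
  have "(\<lambda>n. 1 - r n / real n - s n / real n) \<longlonglongrightarrow> 1 - 0 - 0"
    by (intro tendsto_intros r s)
  then have m: "(\<lambda>n. 1 - r n / real n - s n / real n) \<longlonglongrightarrow> 1" by simp
  show m: "(\<lambda>n. m n / real n) \<longlonglongrightarrow> 1"
    by (rule Lim_transform_eventually[OF m])
       (use eventually_gt_at_top[of 0] in eventually_elim, auto simp: m_def field_simps)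
  have "(\<lambda>n. m n / real n - t n / real n) \<longlonglongrightarrow> 1 - 0"
    by (intro tendsto_intros m t)
  then show "(\<lambda>n. u n / real n) \<longlonglongrightarrow> 1"
    by (simp add: m_eq diff_divide_distrib [symmetric])
qed

text \<open>Places every saddle sequence eventually in the convex region where two solutions must
  coincide.\<close>

lemma ev_region:
  "\<forall>\<^sub>F n in sequentially. r n > 0 \<and> s n > 0 \<and> t n > 0 \<and> r n \<le> 2 * s n \<and> s n \<le> 2 * r n \<and>
    t n + 1 + 2 * r n \<le> real n - r n - s n - t n \<and> 2 * s n \<le> real n - r n - s n"
proof -
  have "\<forall>\<^sub>F n in sequentially. r n / s n < 2"
    using order_tendstoD(2)[OF r_over_s] by simp
  moreover have "\<forall>\<^sub>F n in sequentially. r n / real n < 1 / 10" "\<forall>\<^sub>F n in sequentially. s n / real n < 1 / 10"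
    "\<forall>\<^sub>F n in sequentially. t n / real n < 1 / 10"
    using lim_over_n(1-3)[THEN order_tendstoD(2), of "1/10"] by simp_all
  moreover have "\<forall>\<^sub>F n :: nat in sequentially. real n > 10" by real_asymp
  ultimately show ?thesis using ev_basic ev_r_ge
    by eventually_elim (auto simp: field_simps)
qed

end

text \<open>Picking a second saddle point whenever there is one yields two saddle sequences, so uniqueness
  follows from the asymptotics of a single sequence.\<close>

lemma saddle_point_ex1: "\<forall>\<^sub>F n in sequentially. \<exists>!(r, s, t). saddle_point n r s t"
proof -
  define P where "P n = (SOME x. case x of (r, s, t) \<Rightarrow> saddle_point n r s t)" for n
  define Q where "Q n = (if \<exists>x. x \<noteq> P n \<and> (case x of (r, s, t) \<Rightarrow> saddle_point n r s t)
     then SOME x. x \<noteq> P n \<and> (case x of (r, s, t) \<Rightarrow> saddle_point n r s t) else P n)" for n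
  have P: "\<forall>\<^sub>F n in sequentially. case P n of (r, s, t) \<Rightarrow> saddle_point n r s t"
    using saddle_point_exists
  proof eventually_elim
    case (elim n)
    then have "\<exists>x. case x of (r, s, t) \<Rightarrow> saddle_point n r s t" by auto
    then show ?case unfolding P_def by (rule someI_ex)
  qed
  have Q: "\<forall>\<^sub>F n in sequentially. case Q n of (r, s, t) \<Rightarrow> saddle_point n r s t"
    using P
  proof eventually_elim
    case (elim n)
    show ?case
    proof (cases "\<exists>x. x \<noteq> P n \<and> (case x of (r, s, t) \<Rightarrow> saddle_point n r s t)")
      case True
      from someI_ex[OF True] show ?thesis unfolding Q_def if_P[OF True] by simp
    next
      case False
      then have "Q n = P n" unfolding Q_def by (rule if_not_P)
      then show ?thesis using elim by simp
    qed
  qed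
  interpret P: saddle_sequence "\<lambda>n. fst (P n)" "\<lambda>n. fst (snd (P n))" "\<lambda>n. snd (snd (P n))"
    using P by unfold_locales (simp add: case_prod_beta)
  interpret Q: saddle_sequence "\<lambda>n. fst (Q n)" "\<lambda>n. fst (snd (Q n))" "\<lambda>n. snd (snd (Q n))"
    using Q by unfold_locales (simp add: case_prod_beta)
  show ?thesis using P P.saddle Q.saddle P.ev_region Q.ev_region
  proof eventually_elim
    case (elim n)
    obtain r s t where Pn: "P n = (r, s, t)" by (cases "P n")
    obtain r' s' t' where Qn: "Q n = (r', s', t')" by (cases "Q n")
    note E = elim(2-)[unfolded saddle_point_iff Pn Qn fst_conv snd_conv]
    have "r' = r \<and> s' = s \<and> t' = t"
      by (rule saddle_point_unique_in_region[OF E(3) _ _ _ E(4)]; use E(1,2) in blast)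
    then have QP: "Q n = P n" by (simp add: Pn Qn)
    have "x = P n" if "case x of (r, s, t) \<Rightarrow> saddle_point n r s t" for x
    proof (rule ccontr)
      assume "x \<noteq> P n"
      then have ex: "\<exists>x. x \<noteq> P n \<and> (case x of (r, s, t) \<Rightarrow> saddle_point n r s t)" using that by blast
      from someI_ex[OF ex] QP show False unfolding Q_def if_P[OF ex] by simp
    qed
    from ex1I[of "\<lambda>x. case x of (r, s, t) \<Rightarrow> saddle_point n r s t", OF elim(1) this]
    show ?case .
  qed
qed

section \<open>Lattice sums converging to the Gaussian integral\<close>

lemma gaussian_integral:
  fixes a :: real
  assumes "a > 0"
  shows "integrable lborel (\<lambda>x::real. exp (- a * x\<^sup>2))"
    and "(\<integral>x. exp (- a * x\<^sup>2) \<partial>lborel) = sqrt (pi / a)"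
proof -
  define \<sigma> where "\<sigma> = 1 / sqrt (2 * a)"
  have s: "\<sigma> > 0" and s2: "\<sigma>\<^sup>2 = 1 / (2 * a)"
    using assms by (simp_all add: \<sigma>_def power_divide)
  have eq: "exp (- a * x\<^sup>2) = sqrt (pi / a) * normal_density 0 \<sigma> x" for x
    using assms by (simp add: normal_density_def s2)
  show "integrable lborel (\<lambda>x::real. exp (- a * x\<^sup>2))"
    unfolding eq using s by (intro integrable_mult_right integrable_normal_density)
  show "(\<integral>x. exp (- a * x\<^sup>2) \<partial>lborel) = sqrt (pi / a)"
    unfolding eq using s by simp
qed

lemma gaussian_integral_2d:
  fixes a :: real
  assumes "a > 0"
  shows "integrable (lborel \<Otimes>\<^sub>M lborel) (\<lambda>(x, y). exp (- a * (x\<^sup>2 + y\<^sup>2)) :: real)"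
    and "(\<integral>z. (case z of (x, y) \<Rightarrow> exp (- a * (x\<^sup>2 + y\<^sup>2))) \<partial>(lborel \<Otimes>\<^sub>M lborel)) = pi / a"
proof -
  have eq: "exp (- a * (x\<^sup>2 + y\<^sup>2)) = exp (- a * x\<^sup>2) * exp (- a * y\<^sup>2)" for x y
    by (simp add: exp_add [symmetric] algebra_simps)
  show int: "integrable (lborel \<Otimes>\<^sub>M lborel) (\<lambda>(x, y). exp (- a * (x\<^sup>2 + y\<^sup>2)) :: real)"
    unfolding eq
  proof (rule lborel_pair.Fubini_integrable)
    show "(\<lambda>(x, y). exp (- a * x\<^sup>2) * exp (- a * y\<^sup>2) :: real) \<in> borel_measurable (lborel \<Otimes>\<^sub>M lborel)"
      by measurable
    show "integrable lborel (\<lambda>x. LINT y|lborel. norm (case (x, y) of (x, y) \<Rightarrow> exp (- a * x\<^sup>2) * exp (- a * y\<^sup>2)))"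
      by (simp add: abs_mult) (use gaussian_integral[OF assms] in simp)
    show "AE x in lborel. integrable lborel (\<lambda>y. case (x, y) of (x, y) \<Rightarrow> exp (- a * x\<^sup>2) * exp (- a * y\<^sup>2))"
      using gaussian_integral[OF assms] by simp
  qed
  have "(\<integral>z. (case z of (x, y) \<Rightarrow> exp (- a * (x\<^sup>2 + y\<^sup>2))) \<partial>(lborel \<Otimes>\<^sub>M lborel)) =
      (\<integral>x. (\<integral>y. exp (- a * (x\<^sup>2 + y\<^sup>2)) \<partial>lborel) \<partial>lborel)"
    by (subst lborel_pair.integral_fst'[OF int, symmetric]) simp
  also have "\<dots> = pi / a"
    unfolding eq using gaussian_integral[OF assms] assms
    by (simp add: real_sqrt_mult [symmetric] power2_eq_square [symmetric] del: real_sqrt_mult)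
  finally show "(\<integral>z. (case z of (x, y) \<Rightarrow> exp (- a * (x\<^sup>2 + y\<^sup>2))) \<partial>(lborel \<Otimes>\<^sub>M lborel)) = pi / a" .
qed

text \<open>The half-open cell of length \<open>1 / \<sigma>\<close> to the right of the rescaled
  lattice point of index i. Products of two cells have area \<open>1 / \<sigma>\<^sup>2\<close>, so
  a double sum over that factor is the integral of a step function.\<close>

definition lattice_cell :: "real \<Rightarrow> real \<Rightarrow> nat \<Rightarrow> real set" where
  "lattice_cell p \<sigma> i = {(real i - p) / \<sigma>..<(real i + 1 - p) / \<sigma>}"

lemma mem_lattice_cell_iff:
  assumes "\<sigma> > 0"
  shows "x \<in> lattice_cell p \<sigma> i \<longleftrightarrow> 0 \<le> p + \<sigma> * x \<and> i = nat \<lfloor>p + \<sigma> * x\<rfloor>"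
proof -
  have "x \<in> lattice_cell p \<sigma> i \<longleftrightarrow> real i \<le> p + \<sigma> * x \<and> p + \<sigma> * x < real i + 1"
    using assms by (auto simp: lattice_cell_def field_simps)
  also have "\<dots> \<longleftrightarrow> \<lfloor>p + \<sigma> * x\<rfloor> = int i"
    by (auto simp: floor_eq_iff)
  also have "\<dots> \<longleftrightarrow> 0 \<le> p + \<sigma> * x \<and> i = nat \<lfloor>p + \<sigma> * x\<rfloor>"
    by (metis nat_0_le nat_int of_nat_0_le_iff zero_le_floor)
  finally show ?thesis .
qed

lemma sum_indicator_lattice_cell:
  fixes h :: "nat \<Rightarrow> real"
  assumes "\<sigma> > 0"
  shows "(\<Sum>i\<le>N. h i * indicator (lattice_cell p \<sigma> i) x) =
    (if 0 \<le> p + \<sigma> * x \<and> nat \<lfloor>p + \<sigma> * x\<rfloor> \<le> N then h (nat \<lfloor>p + \<sigma> * x\<rfloor>) else 0)"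
proof (cases "0 \<le> p + \<sigma> * x")
  case True
  then have "(\<Sum>i\<le>N. h i * indicator (lattice_cell p \<sigma> i) x) =
      (\<Sum>i\<le>N. if i = nat \<lfloor>p + \<sigma> * x\<rfloor> then h i else 0)"
    by (intro sum.cong) (auto simp: indicator_def mem_lattice_cell_iff[OF assms])
  then show ?thesis using True by (simp add: sum.delta)
next
  case False
  then show ?thesis by (simp add: indicator_def mem_lattice_cell_iff[OF assms])
qed

lemma integral_lattice_cells:
  assumes "\<sigma> > 0"
  shows "integrable (lborel \<Otimes>\<^sub>M lborel)
      (\<lambda>(x, y). indicator (lattice_cell p \<sigma> i) x * indicator (lattice_cell q \<sigma> j) y :: real)"
    and "(\<integral>z. (case z of (x, y) \<Rightarrow> (indicator (lattice_cell p \<sigma> i) x * indicator (lattice_cell q \<sigma> j) y :: real))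
      \<partial>(lborel \<Otimes>\<^sub>M lborel)) = 1 / \<sigma>\<^sup>2"
proof -
  have em: "emeasure lborel (lattice_cell a \<sigma> k) = ennreal (1 / \<sigma>)" for a k
    using assms unfolding lattice_cell_def
    by (subst emeasure_lborel_Ico) (auto intro!: divide_right_mono simp: diff_divide_distrib [symmetric])
  have sets [measurable]: "lattice_cell a \<sigma> k \<in> sets lborel" for a k
    by (simp add: lattice_cell_def)
  have eq: "(\<lambda>(x, y). indicator (lattice_cell p \<sigma> i) x * indicator (lattice_cell q \<sigma> j) y :: real) =
      indicator (lattice_cell p \<sigma> i \<times> lattice_cell q \<sigma> j)"
    by (auto simp: indicator_def fun_eq_iff)
  have em2: "emeasure (lborel \<Otimes>\<^sub>M lborel) (lattice_cell p \<sigma> i \<times> lattice_cell q \<sigma> j) = ennreal (1 / \<sigma>\<^sup>2)"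
    using assms by (subst lborel.emeasure_pair_measure_Times[OF sets sets])
      (simp add: em ennreal_mult [symmetric] power2_eq_square)
  show "integrable (lborel \<Otimes>\<^sub>M lborel)
      (\<lambda>(x, y). indicator (lattice_cell p \<sigma> i) x * indicator (lattice_cell q \<sigma> j) y :: real)"
    unfolding eq by (intro integrable_real_indicator pair_measureI sets) (simp add: em2)
  show "(\<integral>z. (case z of (x, y) \<Rightarrow> (indicator (lattice_cell p \<sigma> i) x * indicator (lattice_cell q \<sigma> j) y :: real))
      \<partial>(lborel \<Otimes>\<^sub>M lborel)) = 1 / \<sigma>\<^sup>2"
  proof -
    have "(\<integral>z. (case z of (x, y) \<Rightarrow> (indicator (lattice_cell p \<sigma> i) x * indicator (lattice_cell q \<sigma> j) y :: real))
      \<partial>(lborel \<Otimes>\<^sub>M lborel)) = measure (lborel \<Otimes>\<^sub>M lborel) (lattice_cell p \<sigma> i \<times> lattice_cell q \<sigma> j)"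
      unfolding eq by (subst Bochner_Integration.integral_indicator) (simp_all add: space_pair_measure)
    then show ?thesis using em2 by (simp add: measure_def)
  qed
qed

text \<open>Dominated convergence for the step functions. The limit hypothesis is stated for all
  index sequences because the cell containing a fixed point moves with n; the centre hypotheses
  ensure that every fixed point is eventually covered by cells with indices up to
  \<open>N n\<close>.\<close>

lemma lattice_sum_gaussian:
  fixes f :: "nat \<Rightarrow> nat \<Rightarrow> nat \<Rightarrow> real" and p q \<sigma> :: "nat \<Rightarrow> real" and N :: "nat \<Rightarrow> nat"
  assumes \<sigma>: "filterlim \<sigma> at_top sequentially" and \<kappa>: "\<kappa> > 0" and C: "C \<ge> 0"
    and bound: "\<forall>\<^sub>F n in sequentially. \<forall>i\<le>N n. \<forall>j\<le>N n.
      \<bar>f n i j\<bar> \<le> C * exp (- \<kappa> * (((real i - p n) / \<sigma> n)\<^sup>2 + ((real j - q n) / \<sigma> n)\<^sup>2))"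
    and lim: "\<And>x y i j. (\<lambda>n. (real (i n) - p n) / \<sigma> n) \<longlonglongrightarrow> x \<Longrightarrow> (\<lambda>n. (real (j n) - q n) / \<sigma> n) \<longlonglongrightarrow> y \<Longrightarrow>
      (\<lambda>n. f n (i n) (j n)) \<longlonglongrightarrow> exp (- (1 / 2) * (x\<^sup>2 + y\<^sup>2))"
    and centre: "filterlim (\<lambda>n. p n / \<sigma> n) at_top sequentially" "filterlim (\<lambda>n. q n / \<sigma> n) at_top sequentially"
      "filterlim (\<lambda>n. (real (N n) - p n) / \<sigma> n) at_top sequentially"
      "filterlim (\<lambda>n. (real (N n) - q n) / \<sigma> n) at_top sequentially"
  shows "(\<lambda>n. (\<Sum>i\<le>N n. \<Sum>j\<le>N n. f n i j) / (\<sigma> n)\<^sup>2) \<longlonglongrightarrow> 2 * pi"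
proof -
  \<comment> \<open>Domination is required for every n, the bound holds only eventually;
    \<open>g n\<close> is set to zero at the remaining n.\<close>
  define good where "good n \<longleftrightarrow> \<sigma> n \<ge> 1 \<and> (\<forall>i\<le>N n. \<forall>j\<le>N n.
      \<bar>f n i j\<bar> \<le> C * exp (- \<kappa> * (((real i - p n) / \<sigma> n)\<^sup>2 + ((real j - q n) / \<sigma> n)\<^sup>2)))" for n
  have ev_good: "\<forall>\<^sub>F n in sequentially. good n"
    using bound \<sigma>[unfolded filterlim_at_top, rule_format, of 1]
    by eventually_elim (simp add: good_def)
  define g where "g n = (\<lambda>(x, y). if good n then \<Sum>i\<le>N n. \<Sum>j\<le>N n. f n i j *
      (indicator (lattice_cell (p n) (\<sigma> n) i) x * indicator (lattice_cell (q n) (\<sigma> n) j) y) else 0)" for n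
  have g_eq: "g n (x, y) = (if 0 \<le> p n + \<sigma> n * x \<and> nat \<lfloor>p n + \<sigma> n * x\<rfloor> \<le> N n \<and>
       0 \<le> q n + \<sigma> n * y \<and> nat \<lfloor>q n + \<sigma> n * y\<rfloor> \<le> N n
     then f n (nat \<lfloor>p n + \<sigma> n * x\<rfloor>) (nat \<lfloor>q n + \<sigma> n * y\<rfloor>) else 0)" if "good n" for n x y
  proof -
    have s: "\<sigma> n > 0" using that by (auto simp: good_def)
    have "g n (x, y) = (\<Sum>i\<le>N n. (\<Sum>j\<le>N n. f n i j * indicator (lattice_cell (q n) (\<sigma> n) j) y) *
       indicator (lattice_cell (p n) (\<sigma> n) i) x)"
      using that by (simp only: g_def prod.case if_True sum_distrib_left mult_ac)
    then show ?thesis unfolding sum_indicator_lattice_cell[OF s] by simp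
  qed
  have int_g: "integral\<^sup>L (lborel \<Otimes>\<^sub>M lborel) (g n) = (\<Sum>i\<le>N n. \<Sum>j\<le>N n. f n i j) / (\<sigma> n)\<^sup>2"
    if "good n" for n
  proof -
    have s: "\<sigma> n > 0" using that by (auto simp: good_def)
    note cells = integral_lattice_cells[OF s]
    have geq: "g n = (\<lambda>z. \<Sum>i\<le>N n. \<Sum>j\<le>N n. f n i j * (case z of (x, y) \<Rightarrow>
      indicator (lattice_cell (p n) (\<sigma> n) i) x * indicator (lattice_cell (q n) (\<sigma> n) j) y))"
      using that by (auto simp: g_def fun_eq_iff)
    have "integral\<^sup>L (lborel \<Otimes>\<^sub>M lborel) (g n) = (\<Sum>i\<le>N n. \<Sum>j\<le>N n. f n i j * (1 / (\<sigma> n)\<^sup>2))"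
      unfolding geq by (subst Bochner_Integration.integral_sum,
          intro Bochner_Integration.integrable_sum integrable_mult_right cells,
          intro sum.cong refl,
          subst Bochner_Integration.integral_sum,
          intro integrable_mult_right cells,
          simp only: integral_mult_right_zero cells)
    then show ?thesis by (simp add: sum_divide_distrib)
  qed
  \<comment> \<open>Moving from a point to the corner of its cell halves the rate and costs
    \<open>exp \<kappa>\<close> in each coordinate.\<close>
  define w where "w = (\<lambda>z. C * exp (2 * \<kappa>) *
     (case z of (x, y) \<Rightarrow> exp (- (\<kappa> / 2) * (x\<^sup>2 + y\<^sup>2))) :: real)"
  \<comment> \<open>With displacement d of absolute value at most 1, the inequality (x + d)^2 >=
    x^2/2 - d^2 is a restatement of (x + 2d)^2 >= 0.\<close>
  have sq: "((real (nat \<lfloor>a + b * x\<rfloor>) - a) / b)\<^sup>2 \<ge> x\<^sup>2 / 2 - 1"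
    and close: "\<bar>(real (nat \<lfloor>a + b * x\<rfloor>) - a) / b - x\<bar> \<le> 1 / b"
    if "b \<ge> 1" "0 \<le> a + b * x" for a b x :: real
  proof -
    define d where "d = (real (nat \<lfloor>a + b * x\<rfloor>) - a) / b - x"
    have "real (nat \<lfloor>a + b * x\<rfloor>) = of_int \<lfloor>a + b * x\<rfloor>" using that by simp
    then have "\<bar>real (nat \<lfloor>a + b * x\<rfloor>) - (a + b * x)\<bar> \<le> 1" by linarith
    moreover have "d = (real (nat \<lfloor>a + b * x\<rfloor>) - (a + b * x)) / b"
      using that by (simp add: d_def field_simps)
    ultimately show c: "\<bar>(real (nat \<lfloor>a + b * x\<rfloor>) - a) / b - x\<bar> \<le> 1 / b"
      using that unfolding d_def [symmetric] by (simp add: abs_divide divide_right_mono)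
    moreover have "1 / b \<le> 1" using that by simp
    ultimately have "\<bar>d\<bar> \<le> 1" by (simp add: d_def)
    then have "d\<^sup>2 \<le> 1" by (simp add: abs_square_le_1)
    moreover have "0 \<le> (x + 2 * d)\<^sup>2" by simp
    then have "0 \<le> x\<^sup>2 + 4 * x * d + 4 * d\<^sup>2" by (simp add: power2_sum algebra_simps power2_eq_square)
    ultimately have "(x + d)\<^sup>2 \<ge> x\<^sup>2 / 2 - 1" by (simp add: power2_sum)
    then show "((real (nat \<lfloor>a + b * x\<rfloor>) - a) / b)\<^sup>2 \<ge> x\<^sup>2 / 2 - 1" by (simp add: d_def)
  qed
  have "(\<lambda>n. integral\<^sup>L (lborel \<Otimes>\<^sub>M lborel) (g n)) \<longlonglongrightarrow>
      integral\<^sup>L (lborel \<Otimes>\<^sub>M lborel) (\<lambda>(x, y). exp (- (1 / 2) * (x\<^sup>2 + y\<^sup>2)) :: real)"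
  proof (rule integral_dominated_convergence)
    have cell [measurable]: "lattice_cell a b k \<in> sets borel" for a b k
      by (simp add: lattice_cell_def)
    show "(\<lambda>(x, y). exp (- (1 / 2) * (x\<^sup>2 + y\<^sup>2)) :: real) \<in> borel_measurable (lborel \<Otimes>\<^sub>M lborel)"
      by measurable
    show "g n \<in> borel_measurable (lborel \<Otimes>\<^sub>M lborel)" for n
      unfolding g_def by measurable
    show "integrable (lborel \<Otimes>\<^sub>M lborel) w"
      unfolding w_def using \<kappa> by (intro integrable_mult_right gaussian_integral_2d) simp
    show "AE z in lborel \<Otimes>\<^sub>M lborel. norm (g n z) \<le> w z" for n
    proof (rule AE_I2, clarify)
      fix x y :: real
      have w0: "w (x, y) \<ge> 0" using C by (simp add: w_def)
      show "norm (g n (x, y)) \<le> w (x, y)"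
      proof (cases "good n \<and> 0 \<le> p n + \<sigma> n * x \<and> nat \<lfloor>p n + \<sigma> n * x\<rfloor> \<le> N n \<and>
       0 \<le> q n + \<sigma> n * y \<and> nat \<lfloor>q n + \<sigma> n * y\<rfloor> \<le> N n")
        case False
        then have "g n (x, y) = 0"
          by (cases "good n") (auto simp: g_eq, simp add: g_def)
        then show ?thesis using w0 by simp
      next
        case True
        define i j where "i = nat \<lfloor>p n + \<sigma> n * x\<rfloor>" and "j = nat \<lfloor>q n + \<sigma> n * y\<rfloor>"
        have s: "\<sigma> n \<ge> 1" using True by (auto simp: good_def)
        have "norm (g n (x, y)) \<le> C * exp (- \<kappa> * (((real i - p n) / \<sigma> n)\<^sup>2 + ((real j - q n) / \<sigma> n)\<^sup>2))"
        proof -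
          have "g n (x, y) = f n i j" using True by (simp add: g_eq i_def j_def)
          moreover have "i \<le> N n" "j \<le> N n" using True by (simp_all only: i_def j_def)
          ultimately show ?thesis using True by (simp add: good_def)
        qed
        also have "\<dots> \<le> C * exp (- \<kappa> * ((x\<^sup>2 / 2 - 1) + (y\<^sup>2 / 2 - 1)))"
        proof -
          have "(x\<^sup>2 / 2 - 1) + (y\<^sup>2 / 2 - 1) \<le> ((real i - p n) / \<sigma> n)\<^sup>2 + ((real j - q n) / \<sigma> n)\<^sup>2"
            unfolding i_def j_def using True s by (intro add_mono sq) auto
          then have "\<kappa> * ((x\<^sup>2 / 2 - 1) + (y\<^sup>2 / 2 - 1)) \<le> \<kappa> * (((real i - p n) / \<sigma> n)\<^sup>2 + ((real j - q n) / \<sigma> n)\<^sup>2)"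
            using \<kappa> by (intro mult_left_mono) auto
          then show ?thesis using C by (intro mult_left_mono) auto
        qed
        also have "\<dots> = w (x, y)"
          by (simp add: w_def mult.assoc exp_add [symmetric] algebra_simps)
        finally show ?thesis .
      qed
    qed
    show "AE z in lborel \<Otimes>\<^sub>M lborel. (\<lambda>n. g n z) \<longlonglongrightarrow> (case z of (x, y) \<Rightarrow> exp (- (1 / 2) * (x\<^sup>2 + y\<^sup>2)))"
    proof (rule AE_I2, clarify)
      fix x y :: real
      define i j where "i n = nat \<lfloor>p n + \<sigma> n * x\<rfloor>" and "j n = nat \<lfloor>q n + \<sigma> n * y\<rfloor>" for n
      have ev_s: "\<forall>\<^sub>F n in sequentially. \<sigma> n \<ge> 1"
        using \<sigma>[unfolded filterlim_at_top, rule_format, of 1] .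
      have inv: "(\<lambda>n. 1 / \<sigma> n) \<longlonglongrightarrow> 0"
        by (rule filterlim_compose[OF _ \<sigma>]) real_asymp
      have range: "\<forall>\<^sub>F n in sequentially. 0 \<le> a n + \<sigma> n * z \<and> nat \<lfloor>a n + \<sigma> n * z\<rfloor> \<le> N n"
        if a: "filterlim (\<lambda>n. a n / \<sigma> n) at_top sequentially"
          "filterlim (\<lambda>n. (real (N n) - a n) / \<sigma> n) at_top sequentially" for a :: "nat \<Rightarrow> real" and z :: real
        using a(1)[unfolded filterlim_at_top, rule_format, of "- z"]
          a(2)[unfolded filterlim_at_top, rule_format, of z] ev_s
      proof eventually_elim
        case (elim n)
        have 1: "0 \<le> a n + \<sigma> n * z" using elim by (simp add: field_simps)
        have "a n + \<sigma> n * z \<le> real (N n)" using elim by (simp add: field_simps)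
        then have "nat \<lfloor>a n + \<sigma> n * z\<rfloor> \<le> N n" using 1 by linarith
        with 1 show ?case by simp
      qed
      have conv: "(\<lambda>n. (real (nat \<lfloor>a n + \<sigma> n * z\<rfloor>) - a n) / \<sigma> n) \<longlonglongrightarrow> z"
        if a: "filterlim (\<lambda>n. a n / \<sigma> n) at_top sequentially"
          "filterlim (\<lambda>n. (real (N n) - a n) / \<sigma> n) at_top sequentially" for a :: "nat \<Rightarrow> real" and z :: real
      proof -
        have "(\<lambda>n. (real (nat \<lfloor>a n + \<sigma> n * z\<rfloor>) - a n) / \<sigma> n - z) \<longlonglongrightarrow> 0"
          by (rule Lim_null_comparison[OF _ inv])
             (use range[OF a, of z] ev_s in \<open>eventually_elim, unfold real_norm_def, intro close; blast\<close>)
        then show ?thesis by (simp add: LIM_zero_iff)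
      qed
      have "(\<lambda>n. f n (i n) (j n)) \<longlonglongrightarrow> exp (- (1 / 2) * (x\<^sup>2 + y\<^sup>2))"
        unfolding i_def j_def by (intro lim conv centre)
      moreover have "\<forall>\<^sub>F n in sequentially. f n (i n) (j n) = g n (x, y)"
        using ev_good range[OF centre(1,3), of x] range[OF centre(2,4), of y]
        by eventually_elim (simp add: g_eq i_def j_def)
      ultimately show "(\<lambda>n. g n (x, y)) \<longlonglongrightarrow> exp (- (1 / 2) * (x\<^sup>2 + y\<^sup>2))"
        by (rule Lim_transform_eventually)
    qed
  qed
  also have "integral\<^sup>L (lborel \<Otimes>\<^sub>M lborel) (\<lambda>(x, y). exp (- (1 / 2) * (x\<^sup>2 + y\<^sup>2)) :: real) = 2 * pi"
    using gaussian_integral_2d(2)[of "1 / 2"] by simp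
  finally show ?thesis
    by (rule Lim_transform_eventually) (use ev_good in eventually_elim, rule int_g)
qed

section \<open>The double sum and its logarithm\<close>

definition summand :: "nat \<Rightarrow> nat \<Rightarrow> nat \<Rightarrow> real" where
  "summand n i j = (if i + j \<le> n then fact n / (fact i * fact j * fact (n - i - j))
      * real j ^ (n - i - j + 1) * (1 + real i) ^ (n - i - j) else 0)"

lemma summand_nonneg: "summand n i j \<ge> 0"
  by (simp add: summand_def)

lemma c_eq_sum_summand: "c n = (\<Sum>i\<le>n. \<Sum>j\<le>n. summand n i j)"
  unfolding c_def
proof (intro sum.cong refl)
  fix i j
  show "(\<Sum>t\<le>n. if i + j + t \<le> n then fact n / (fact i * fact j * fact t * fact (n - i - j - t))
            * real i ^ (n - i - j - t) * real j ^ (n - i - j + 1) else 0) = summand n i j"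
  proof (cases "i + j \<le> n")
    case False
    then show ?thesis by (simp add: summand_def)
  next
    case True
    define k where "k = n - i - j"
    have "(\<Sum>t\<le>n. if i + j + t \<le> n then fact n / (fact i * fact j * fact t * fact (n - i - j - t))
            * real i ^ (n - i - j - t) * real j ^ (n - i - j + 1) else 0)
       = (\<Sum>t\<le>k. fact n / (fact i * fact j * fact t * fact (k - t))
            * real i ^ (k - t) * real j ^ (k + 1))"
      by (intro sum.mono_neutral_cong_right) (use True in \<open>auto simp: k_def\<close>)
    also have "\<dots> = (\<Sum>t\<le>k. fact n / (fact i * fact j * fact k) * real j ^ (k + 1) *
        (real (k choose t) * 1 ^ t * real i ^ (k - t)))"
      by (intro sum.cong refl) (simp add: binomial_fact field_simps)
    also have "\<dots> = fact n / (fact i * fact j * fact k) * real j ^ (k + 1) * (1 + real i) ^ k"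
      unfolding binomial_ring[of 1 "real i" k] by (simp add: sum_distrib_left)
    finally show ?thesis using True by (simp add: summand_def k_def)
  qed
qed

definition logsum :: "real \<Rightarrow> real \<Rightarrow> real \<Rightarrow> real" where
  "logsum n x y = ln_Gamma (n + 1) - ln_Gamma (x + 1) - ln_Gamma (y + 1) - ln_Gamma (n - x - y + 1)
     + (n - x - y + 1) * ln y + (n - x - y) * ln (1 + x)"

definition logsum_x :: "real \<Rightarrow> real \<Rightarrow> real \<Rightarrow> real" where
  "logsum_x n x y = - Digamma (x + 1) + Digamma (n - x - y + 1) - ln y - ln (1 + x) + (n - x - y) / (1 + x)"

definition logsum_y :: "real \<Rightarrow> real \<Rightarrow> real \<Rightarrow> real" where
  "logsum_y n x y = - Digamma (y + 1) + Digamma (n - x - y + 1) - ln y + (n - x - y + 1) / y - ln (1 + x)"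

text \<open>The negative of the Hessian form of \<open>logsum n\<close> at \<open>(x, y)\<close>,
  evaluated in the direction \<open>(a, b)\<close>.\<close>

definition logsum_quad :: "real \<Rightarrow> real \<Rightarrow> real \<Rightarrow> real \<Rightarrow> real \<Rightarrow> real" where
  "logsum_quad n x y a b = (Polygamma 1 (x + 1) + 2 / (1 + x) + (n - x - y) / (1 + x)\<^sup>2) * a\<^sup>2
     + (Polygamma 1 (y + 1) + 2 / y + (n - x - y + 1) / y\<^sup>2) * b\<^sup>2
     + Polygamma 1 (n - x - y + 1) * (a + b)\<^sup>2 + 2 * a * b * (1 / y + 1 / (1 + x))"

lemma summand_eq_exp:
  assumes "i + j \<le> n" "j \<ge> 1"
  shows "summand n i j = exp (logsum (real n) (real i) (real j))"
proof -
  define k where "k = n - i - j"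
  have k: "real n - real i - real j = real k" using assms by (simp add: k_def)
  have lnG: "ln_Gamma (real l + 1) = ln (fact l)" for l
    using ln_Gamma_real_conv_fact[of "Suc l"] by (simp add: add.commute)
  have "exp (logsum n i j) = fact n / fact i / fact j / fact k * exp ((real k + 1) * ln j) * exp (real k * ln (1 + real i))"
    unfolding logsum_def k lnG by (simp add: exp_add exp_diff)
  also have "(real k + 1) * ln j = real (k + 1) * ln j" by simp
  also have "exp (real (k + 1) * ln j) = real j ^ (k + 1)"
    using assms unfolding exp_of_nat_mult by simp
  also have "exp (real k * ln (1 + real i)) = (1 + real i) ^ k"
    unfolding exp_of_nat_mult by simp
  finally show ?thesis using assms(1) by (simp add: summand_def k_def)
qed

lemma taylor_second_order:
  fixes f f' f'' :: "real \<Rightarrow> real"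
  assumes "\<And>x. 0 \<le> x \<Longrightarrow> x \<le> 1 \<Longrightarrow> (f has_real_derivative f' x) (at x)"
    and "\<And>x. 0 \<le> x \<Longrightarrow> x \<le> 1 \<Longrightarrow> (f' has_real_derivative f'' x) (at x)"
  shows "\<exists>\<xi>. 0 < \<xi> \<and> \<xi> < 1 \<and> f 1 = f 0 + f' 0 + f'' \<xi> / 2"
proof -
  define d where "d = (\<lambda>k::nat. if k = 0 then f else if k = 1 then f' else f'')"
  have "\<exists>t>0. t < 1 \<and> f 1 = (\<Sum>m<2. d m 0 / fact m * 1 ^ m) + d 2 t / fact 2 * 1 ^ 2"
    by (rule Maclaurin) (use assms in \<open>auto simp: d_def less_2_cases_iff\<close>)
  then show ?thesis by (simp add: d_def numeral_2_eq_2)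
qed

lemma logsum_taylor:
  assumes dom: "0 \<le> x" "0 < y" "x + y \<le> n" "0 \<le> x0" "0 < y0" "x0 + y0 \<le> n"
  defines "a \<equiv> x - x0" and "b \<equiv> y - y0"
  shows "\<exists>\<xi>. 0 < \<xi> \<and> \<xi> < 1 \<and> logsum n x y = logsum n x0 y0 + (logsum_x n x0 y0 * a + logsum_y n x0 y0 * b)
     - logsum_quad n (x0 + \<xi> * a) (y0 + \<xi> * b) a b / 2"
proof -
  define F where "F z = logsum n (x0 + z * a) (y0 + z * b)" for z
  define F' where "F' z = logsum_x n (x0 + z * a) (y0 + z * b) * a + logsum_y n (x0 + z * a) (y0 + z * b) * b" for z
  define F'' where "F'' z = - logsum_quad n (x0 + z * a) (y0 + z * b) a b" for z
  have dom': "0 \<le> x0 + z * a" "0 < y0 + z * b" "0 \<le> n - (x0 + z * a) - (y0 + z * b)"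
    if z: "0 \<le> z" "z \<le> 1" for z
  proof -
    have conv: "x0 + z * a = (1 - z) * x0 + z * x" "y0 + z * b = (1 - z) * y0 + z * y"
      by (simp_all add: a_def b_def algebra_simps)
    show "0 \<le> x0 + z * a" unfolding conv using dom z by simp
    show "0 < y0 + z * b"
    proof (cases "z = 1")
      case False
      then have "(1 - z) * y0 > 0" using dom z by simp
      then show ?thesis unfolding conv using dom z by (simp add: add_pos_nonneg)
    qed (use dom in \<open>simp add: b_def\<close>)
    have "n - (x0 + z * a) - (y0 + z * b) = (1 - z) * (n - x0 - y0) + z * (n - x - y)"
      unfolding conv by (simp add: algebra_simps)
    also have "\<dots> \<ge> 0" using dom z by simp
    finally show "0 \<le> n - (x0 + z * a) - (y0 + z * b)" .
  qed
  have "\<exists>\<xi>. 0 < \<xi> \<and> \<xi> < 1 \<and> F 1 = F 0 + F' 0 + F'' \<xi> / 2"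
  proof (rule taylor_second_order)
    fix z :: real assume z: "0 \<le> z" "z \<le> 1"
    define X Y where "X = x0 + z * a" and "Y = y0 + z * b"
    have pos: "0 \<le> X" "0 < Y" "0 \<le> n - X - Y"
      using dom'[OF z] by (simp_all add: X_def Y_def)
    have ni: "X + 1 \<notin> \<int>\<^sub>\<le>\<^sub>0" "Y + 1 \<notin> \<int>\<^sub>\<le>\<^sub>0" "n - X - Y + 1 \<notin> \<int>\<^sub>\<le>\<^sub>0"
      using pos by (auto elim!: nonpos_Ints_cases)
    have "(F has_real_derivative
       (- (Digamma (X + 1) * a) - Digamma (Y + 1) * b - Digamma (n - X - Y + 1) * (- a - b)
        + ((- a - b) * ln Y + (b / Y) * (n - X - Y + 1)) + ((- a - b) * ln (1 + X) + (a / (1 + X)) * (n - X - Y)))) (at z)"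
      unfolding F_def logsum_def using pos ni unfolding X_def Y_def
      by (auto intro!: derivative_eq_intros)
    also have "- (Digamma (X + 1) * a) - Digamma (Y + 1) * b - Digamma (n - X - Y + 1) * (- a - b)
        + ((- a - b) * ln Y + (b / Y) * (n - X - Y + 1)) + ((- a - b) * ln (1 + X) + (a / (1 + X)) * (n - X - Y)) = F' z"
      unfolding F'_def logsum_x_def logsum_y_def X_def [symmetric] Y_def [symmetric]
      by (simp add: ring_distribs mult_ac add_divide_distrib diff_divide_distrib)
    finally show "(F has_real_derivative F' z) (at z)" .
    define psu where "psu = Polygamma 1 (n - X - Y + 1) * (- a - b)"
    have dx: "((\<lambda>z. logsum_x n (x0 + z * a) (y0 + z * b)) has_real_derivative
       (- (Polygamma 1 (X + 1) * a) + psu - b / Y - a / (1 + X)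
         + ((- a - b) * (1 + X) - (n - X - Y) * a) / ((1 + X) * (1 + X)))) (at z)"
      unfolding logsum_x_def psu_def using pos ni unfolding X_def Y_def
      by (auto intro!: derivative_eq_intros)
    have dy: "((\<lambda>z. logsum_y n (x0 + z * a) (y0 + z * b)) has_real_derivative
       (- (Polygamma 1 (Y + 1) * b) + psu - b / Y
         + ((- a - b) * Y - (n - X - Y + 1) * b) / (Y * Y) - a / (1 + X))) (at z)"
      unfolding logsum_y_def psu_def using pos ni unfolding X_def Y_def
      by (auto intro!: derivative_eq_intros)
    have e1: "((- a - b) * (1 + X) - (n - X - Y) * a) / ((1 + X) * (1 + X)) =
        (- a - b) / (1 + X) - (n - X - Y) / (1 + X)\<^sup>2 * a"
      using pos by (simp add: divide_simps power2_eq_square)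
    have e2: "((- a - b) * Y - (n - X - Y + 1) * b) / (Y * Y) = (- a - b) / Y - (n - X - Y + 1) / Y\<^sup>2 * b"
      using pos by (simp add: divide_simps power2_eq_square)
    have "(F' has_real_derivative
       ((- (Polygamma 1 (X + 1) * a) + psu - b / Y - a / (1 + X)
         + ((- a - b) * (1 + X) - (n - X - Y) * a) / ((1 + X) * (1 + X))) * a
       + (- (Polygamma 1 (Y + 1) * b) + psu - b / Y
         + ((- a - b) * Y - (n - X - Y + 1) * b) / (Y * Y) - a / (1 + X)) * b)) (at z)"
      unfolding F'_def by (intro DERIV_add DERIV_cmult_right dx dy)
    also have "(- (Polygamma 1 (X + 1) * a) + psu - b / Y - a / (1 + X)
         + ((- a - b) * (1 + X) - (n - X - Y) * a) / ((1 + X) * (1 + X))) * a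
       + (- (Polygamma 1 (Y + 1) * b) + psu - b / Y
         + ((- a - b) * Y - (n - X - Y + 1) * b) / (Y * Y) - a / (1 + X)) * b = F'' z"
      unfolding e1 e2 psu_def F''_def logsum_quad_def X_def [symmetric] Y_def [symmetric]
      by (simp add: algebra_simps power2_eq_square add_divide_distrib diff_divide_distrib)
    finally show "(F' has_real_derivative F'' z) (at z)" .
  qed
  then show ?thesis by (simp add: F_def F'_def F''_def a_def b_def)
qed

text \<open>Each mixed term, with denominator z equal to \<open>1 + x\<close> or \<open>y\<close>,
  is bounded by half of the diagonal term m/z^2 in one variable and 2/m in the other. Half of each
  diagonal term remains, and m >= n/2 with z <= B turns it into n/(4B^2), and 2/m into 4/n.\<close>

lemma logsum_quad_ge:
  assumes x: "0 \<le> x" "1 + x \<le> B" and y: "0 < y" "y \<le> B" and m: "n - x - y \<ge> n / 2" and n: "n > 0"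
  shows "logsum_quad n x y a b \<ge> (n / (4 * B\<^sup>2) - 4 / n) * (a\<^sup>2 + b\<^sup>2)"
proof -
  define m where "m = n - x - y"
  have m0: "m > 0" "m \<ge> n / 2" using m n by (simp_all add: m_def)
  have P: "Polygamma 1 (x + 1) \<ge> 0" "Polygamma 1 (y + 1) \<ge> 0" "Polygamma 1 (m + 1) \<ge> 0"
    using x y m0 by (intro less_imp_le Polygamma_real_odd_pos; auto elim!: nonpos_Ints_cases)+
  have cross: "- (2 * c * d / z) \<le> m / (2 * z\<^sup>2) * c\<^sup>2 + 2 / m * d\<^sup>2" if "z > 0" for c d z :: real
  proof -
    have "0 \<le> (sqrt (m / 2) / z * c + sqrt (2 / m) * d)\<^sup>2" by simp
    also have "\<dots> = m / (2 * z\<^sup>2) * c\<^sup>2 + 2 / m * d\<^sup>2 + 2 * (sqrt (m / 2) * sqrt (2 / m)) * c * d / z"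
      using m0 that by (simp add: power2_sum power_mult_distrib power_divide)
    also have "sqrt (m / 2) * sqrt (2 / m) = 1"
      using m0 by (simp add: real_sqrt_mult [symmetric])
    finally show ?thesis by simp
  qed
  have half: "m / (2 * z\<^sup>2) \<ge> n / (4 * B\<^sup>2)" if z: "0 < z" "z \<le> B" for z
  proof -
    have "n / (4 * B\<^sup>2) \<le> n / (4 * z\<^sup>2)"
      using z n by (intro divide_left_mono mult_left_mono power_mono) auto
    also have "\<dots> = n / 2 / (2 * z\<^sup>2)" by simp
    also have "\<dots> \<le> m / (2 * z\<^sup>2)" using m0 by (intro divide_right_mono) auto
    finally show ?thesis .
  qed
  have m4: "2 / m \<le> 4 / n" using m0 n by (simp add: field_simps)
  have pick: "m / z\<^sup>2 * d\<^sup>2 - m / (2 * z\<^sup>2) * d\<^sup>2 - 2 / m * d\<^sup>2 \<ge> (n / (4 * B\<^sup>2) - 4 / n) * d\<^sup>2"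
    if z: "0 < z" "z \<le> B" for z d
  proof -
    have "(n / (4 * B\<^sup>2) - 4 / n) * d\<^sup>2 \<le> (m / (2 * z\<^sup>2) - 2 / m) * d\<^sup>2"
      using half[OF z] m4 by (intro mult_right_mono) auto
    also have "\<dots> = m / z\<^sup>2 * d\<^sup>2 - m / (2 * z\<^sup>2) * d\<^sup>2 - 2 / m * d\<^sup>2"
      by (simp add: algebra_simps)
    finally show ?thesis .
  qed
  have ge: "logsum_quad n x y a b \<ge> m / (1 + x)\<^sup>2 * a\<^sup>2 + m / y\<^sup>2 * b\<^sup>2 + 2 * b * a / y + 2 * a * b / (1 + x)"
  proof -
    have "m / (1 + x)\<^sup>2 * a\<^sup>2 \<le> (Polygamma 1 (x + 1) + 2 / (1 + x) + m / (1 + x)\<^sup>2) * a\<^sup>2"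
      using P x by (intro mult_right_mono) auto
    moreover have "m / y\<^sup>2 * b\<^sup>2 \<le> (Polygamma 1 (y + 1) + 2 / y + (m + 1) / y\<^sup>2) * b\<^sup>2"
    proof (intro mult_right_mono)
      have "m / y\<^sup>2 \<le> (m + 1) / y\<^sup>2" by (intro divide_right_mono) auto
      then show "m / y\<^sup>2 \<le> Polygamma 1 (y + 1) + 2 / y + (m + 1) / y\<^sup>2"
        using P y by (simp add: add_nonneg_nonneg add_increasing)
    qed simp
    moreover have "0 \<le> Polygamma 1 (m + 1) * (a + b)\<^sup>2" using P by simp
    moreover have "2 * a * b * (1 / y + 1 / (1 + x)) = 2 * b * a / y + 2 * a * b / (1 + x)"
      by (simp add: algebra_simps)
    ultimately show ?thesis unfolding logsum_quad_def m_def [symmetric] by linarith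
  qed
  have "1 + x > 0" using x by simp
  have combine: "k1 + k2 \<le> g" if "p1 + p2 + c1 + c2 \<le> g" "k1 \<le> p1 - h1 - q1" "k2 \<le> p2 - h2 - q2"
    "- c2 \<le> h1 + q2" "- c1 \<le> h2 + q1" for g p1 p2 c1 c2 k1 k2 h1 h2 q1 q2 :: real
    using that by linarith
  show ?thesis unfolding distrib_left
    by (rule combine[OF ge pick[OF \<open>1 + x > 0\<close> x(2), of a] pick[OF y, of b]
          cross[OF \<open>1 + x > 0\<close>, of a b] cross[OF y(1), of b a]])
qed

section \<open>Monotonicity of the summands beyond \<open>2 * n / ln n\<close>\<close>

lemma power_Suc_le_exp:
  fixes x :: real
  assumes "x > 0"
  shows "(x + 1) ^ k \<le> x ^ k * exp (real k / x)"
proof -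
  have "(x + 1) ^ k = x ^ k * (1 + 1 / x) ^ k"
    using assms by (simp add: power_mult_distrib [symmetric] algebra_simps)
  also have "(1 + 1 / x) ^ k \<le> exp (1 / x) ^ k"
    using assms by (intro power_mono exp_ge_add_one_self) (auto intro: add_nonneg_nonneg)
  also have "exp (1 / x) ^ k = exp (real k / x)"
    by (simp add: exp_of_nat_mult [symmetric])
  finally show ?thesis using assms by simp
qed

lemma exp_div_le_sqrt:
  assumes "n \<ge> 2" "x \<ge> 2 * real n / ln (real n)" "k \<le> n"
  shows "exp (real k / x) \<le> sqrt (real n)"
proof -
  have L: "ln (real n) > 0" using assms by simp
  have "2 * real n / ln (real n) > 0" using assms L by simp
  then have x: "x > 0" using assms by linarith
  have "real k / x \<le> real n / x" using x assms by (intro divide_right_mono) auto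
  also have "\<dots> \<le> ln (real n) / 2" using assms x L by (simp add: field_simps)
  finally have "exp (real k / x) \<le> exp (ln (real n) / 2)" by simp
  also have "\<dots> = sqrt (real n)" using assms by (simp add: ln_sqrt [symmetric])
  finally show ?thesis .
qed

text \<open>For \<open>i \<ge> 2 * n / ln n\<close> the only growing factor \<open>((2 + i) / (1 + i)) ^ k \<le> exp (k / (1 + i))\<close>
  is at most \<open>sqrt n\<close>, which loses against \<open>k / (1 + i)\<^sup>2\<close>.\<close>

lemma summand_Suc_fst_le:
  assumes n: "n \<ge> 2" and i: "real i \<ge> 2 * real n / ln (real n)"
    and big: "real n * sqrt (real n) \<le> (2 * real n / ln (real n))\<^sup>2"
  shows "summand n (Suc i) j \<le> summand n i j"
proof (cases "Suc i + j \<le> n \<and> j \<ge> 1")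
  case False
  then consider "\<not> Suc i + j \<le> n" | "j = 0" by linarith
  then have "summand n (Suc i) j = 0" by cases (simp_all add: summand_def)
  then show ?thesis using summand_nonneg by simp
next
  case True
  define k where "k = n - Suc i - j"
  have k: "n - i - j = Suc k" "n - Suc i - j = k" "Suc k \<le> n" using True by (auto simp: k_def)
  define A where "A = fact n / (fact i * fact j * fact k) * real j ^ (k + 1) * (1 + real i) ^ k"
  have A: "A \<ge> 0" by (simp add: A_def)
  have T1: "summand n (Suc i) j = fact n / (fact i * fact j * fact k) * real j ^ (k + 1) / (1 + real i) * (1 + real i + 1) ^ k"
  proof -
    have "summand n (Suc i) j = fact n / (fact (Suc i) * fact j * fact k) * real j ^ (k + 1) * (1 + real (Suc i)) ^ k"
      unfolding summand_def k(2) using True by simp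
    then show ?thesis by (simp add: mult_ac add_ac)
  qed
  have T0: "summand n i j = A * (real j * (1 + real i) / (1 + real k))"
  proof -
    have "summand n i j = fact n / (fact i * fact j * fact (Suc k)) * real j ^ (Suc k + 1) * (1 + real i) ^ Suc k"
      unfolding summand_def k(1) using True by simp
    also have "\<dots> = A * (real j * (1 + real i) / (1 + real k))"
      by (simp add: A_def mult_ac)
    finally show ?thesis .
  qed
  have L: "2 * real n / ln (real n) > 0" using n by simp
  have "(1 + real i + 1) ^ k \<le> (1 + real i) ^ k * exp (real k / (1 + real i))"
    by (rule power_Suc_le_exp) simp
  also have "\<dots> \<le> (1 + real i) ^ k * sqrt (real n)"
    using n i k by (intro mult_left_mono exp_div_le_sqrt) auto
  finally have "summand n (Suc i) j \<le> fact n / (fact i * fact j * fact k) * real j ^ (k + 1) / (1 + real i) * ((1 + real i) ^ k * sqrt (real n))"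
    unfolding T1 by (intro mult_left_mono) auto
  also have "\<dots> = A * (sqrt (real n) / (1 + real i))" by (simp add: A_def)
  also have "\<dots> \<le> A * (real j * (1 + real i) / (1 + real k))"
  proof (rule mult_left_mono[OF _ A])
    have "(1 + real k) * sqrt (real n) \<le> real n * sqrt (real n)"
      using k by (intro mult_right_mono) auto
    also have "\<dots> \<le> (1 + real i)\<^sup>2"
      using big power_mono[of "2 * real n / ln (real n)" "1 + real i" 2] i L by linarith
    also have "\<dots> \<le> real j * (1 + real i)\<^sup>2" using True by simp
    finally show "sqrt (real n) / (1 + real i) \<le> real j * (1 + real i) / (1 + real k)"
      by (simp add: divide_simps power2_eq_square mult_ac)
  qed
  finally show ?thesis unfolding T0 .
qed

text \<open>The quotient of consecutive summands is (1 + 1/j)^k (1 + k) / (j^2 (1 + i)). Its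
  numerator is at most n sqrt(n), and by \<open>big\<close> this is at most j^2.\<close>

lemma summand_Suc_snd_le:
  assumes n: "n \<ge> 2" and j: "real j \<ge> 2 * real n / ln (real n)"
    and big: "real n * sqrt (real n) \<le> (2 * real n / ln (real n))\<^sup>2"
  shows "summand n i (Suc j) \<le> summand n i j"
proof (cases "i + Suc j \<le> n")
  case False
  then show ?thesis by (auto simp: summand_def summand_nonneg)
next
  case True
  define k where "k = n - i - Suc j"
  have k: "n - i - j = Suc k" "n - i - Suc j = k" "Suc k \<le> n" using True by (auto simp: k_def)
  have L: "2 * real n / ln (real n) > 0" using n by simp
  then have j0: "real j > 0" using j by linarith
  define A where "A = fact n / (fact i * fact j * fact k) * real j ^ k * (1 + real i) ^ k"
  have A: "A \<ge> 0" by (simp add: A_def)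
  have T1: "summand n i (Suc j) = fact n / (fact i * fact j * fact k) * (1 + real i) ^ k * (real j + 1) ^ k"
  proof -
    have "summand n i (Suc j) = fact n / (fact i * fact (Suc j) * fact k) * real (Suc j) ^ (k + 1) * (1 + real i) ^ k"
      unfolding summand_def k(2) using True by simp
    also have "\<dots> = (fact n / (fact i * fact j * fact k) * (1 + real i) ^ k * (real j + 1) ^ k)
        * ((1 + real j) / (1 + real j))"
      by (simp add: mult_ac add_ac)
    finally show ?thesis by simp
  qed
  have T0: "summand n i j = A * ((real j)\<^sup>2 * (1 + real i) / (1 + real k))"
  proof -
    have "summand n i j = fact n / (fact i * fact j * fact (Suc k)) * real j ^ (Suc k + 1) * (1 + real i) ^ Suc k"
      unfolding summand_def k(1) using True by simp
    also have "\<dots> = A * ((real j)\<^sup>2 * (1 + real i) / (1 + real k))"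
      by (simp add: A_def power2_eq_square mult_ac)
    finally show ?thesis .
  qed
  have "(real j + 1) ^ k \<le> real j ^ k * exp (real k / real j)"
    by (rule power_Suc_le_exp) (rule j0)
  also have "\<dots> \<le> real j ^ k * sqrt (real n)"
    using n j k by (intro mult_left_mono exp_div_le_sqrt) auto
  finally have "summand n i (Suc j) \<le> fact n / (fact i * fact j * fact k) * (1 + real i) ^ k * (real j ^ k * sqrt (real n))"
    unfolding T1 by (intro mult_left_mono) auto
  also have "\<dots> = A * sqrt (real n)" by (simp add: A_def)
  also have "\<dots> \<le> A * ((real j)\<^sup>2 * (1 + real i) / (1 + real k))"
  proof (rule mult_left_mono[OF _ A])
    have "(1 + real k) * sqrt (real n) \<le> real n * sqrt (real n)"
      using k by (intro mult_right_mono) auto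
    also have "\<dots> \<le> (real j)\<^sup>2"
      using big power_mono[of "2 * real n / ln (real n)" "real j" 2] j L by linarith
    also have "\<dots> \<le> (real j)\<^sup>2 * (1 + real i)" by (simp add: algebra_simps)
    finally show "sqrt (real n) \<le> (real j)\<^sup>2 * (1 + real i) / (1 + real k)"
      by (simp add: divide_simps mult_ac)
  qed
  finally show ?thesis unfolding T0 .
qed

text \<open>Reduces the tail to the edge of the box, where the Gaussian bound valid inside the box
  is already exponentially small.\<close>

lemma summand_le_clamped:
  assumes n: "n \<ge> 2" and N: "real N \<ge> 2 * real n / ln (real n)"
    and big: "real n * sqrt (real n) \<le> (2 * real n / ln (real n))\<^sup>2"
  shows "summand n i j \<le> summand n (min i N) (min j N)"
proof -
  have 1: "summand n (N + k) j \<le> summand n N j" for k j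
  proof (induction k)
    case (Suc k)
    have "summand n (Suc (N + k)) j \<le> summand n (N + k) j"
      by (rule summand_Suc_fst_le[OF n _ big]) (use N in simp)
    with Suc show ?case by simp
  qed simp
  have 2: "summand n i (N + k) \<le> summand n i N" for k i
  proof (induction k)
    case (Suc k)
    have "summand n i (Suc (N + k)) \<le> summand n i (N + k)"
      by (rule summand_Suc_snd_le[OF n _ big]) (use N in simp)
    with Suc show ?case by simp
  qed simp
  have "summand n i j \<le> summand n (min i N) j"
    using 1[of "i - N" j] by (cases "i \<le> N") auto
  also have "\<dots> \<le> summand n (min i N) (min j N)"
    using 2[of "min i N" "j - N"] by (cases "j \<le> N") auto
  finally show ?thesis .
qed

section \<open>The Gaussian shape of the summands\<close>

definition width :: "nat \<Rightarrow> real" where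
  "width n = sqrt (real n) / (2 * ln (real n))"

text \<open>About four times the saddle coordinates n/(2 ln n), and at the same time the threshold
  from which the summands are nonincreasing.\<close>

definition cutoff :: "nat \<Rightarrow> nat" where
  "cutoff n = nat \<lceil>2 * real n / ln (real n)\<rceil>"

lemma width_at_top: "filterlim width at_top sequentially"
  unfolding width_def [abs_def] by real_asymp

lemma width_square: "(width n)\<^sup>2 = real n / (4 * (ln (real n))\<^sup>2)"
  by (simp add: width_def power_divide power_mult_distrib)

lemma cutoff_bounds:
  assumes "n \<ge> 2"
  shows "2 * real n / ln (real n) \<le> real (cutoff n)" "real (cutoff n) \<le> 2 * real n / ln (real n) + 1"
proof -
  have "2 * real n / ln (real n) \<ge> 0" using assms by simp
  then show "2 * real n / ln (real n) \<le> real (cutoff n)" "real (cutoff n) \<le> 2 * real n / ln (real n) + 1"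
    unfolding cutoff_def by linarith+
qed

context saddle_sequence
begin

definition G where "G n = logsum (real n) (r n) (s n)"

text \<open>Numerical consequences of the limits. The value 17 is chosen for 17^2 >= 288, used in
  the Gaussian bound; 3/4 and 1/4 add up to the 1 used in the gradient estimate.\<close>

lemma ev_size:
  "\<forall>\<^sub>F n in sequentially. n \<ge> 2 \<and> ln (real n) \<ge> 17 \<and> 1 \<le> r n \<and> 1 \<le> s n \<and>
     r n \<le> real n / ln (real n) \<and> s n \<le> real n / ln (real n) \<and> real n \<le> 3 * (r n * ln (real n)) \<and>
     t n \<le> 3 * ln (real n) \<and> 0 < t n \<and> real n \<le> 2 * u n \<and> real n \<le> 2 * m n \<and> r n + s n \<le> real n \<and>
     \<bar>m n / r n - t n\<bar> \<le> 3 / 4 \<and> t n / r n \<le> 1 / 4"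
proof -
  have 1: "\<forall>\<^sub>F n :: nat in sequentially. n \<ge> 2" "\<forall>\<^sub>F n :: nat in sequentially. ln (real n) \<ge> 17"
    by real_asymp+
  have "\<forall>\<^sub>F n in sequentially. r n * ln (real n) / real n < 1" "\<forall>\<^sub>F n in sequentially. s n * ln (real n) / real n < 1"
    "\<forall>\<^sub>F n in sequentially. 1 / 3 < r n * ln (real n) / real n" "\<forall>\<^sub>F n in sequentially. t n / ln (real n) < 3"
    "\<forall>\<^sub>F n in sequentially. 1 / 2 < u n / real n" "\<forall>\<^sub>F n in sequentially. 1 / 2 < m n / real n"
    "\<forall>\<^sub>F n in sequentially. m n / r n - t n < 3 / 4" "\<forall>\<^sub>F n in sequentially. - 3 / 4 < m n / r n - t n"
    "\<forall>\<^sub>F n in sequentially. t n / r n < 1 / 4"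
    by (rule order_tendstoD[OF lim_r] order_tendstoD[OF lim_s] order_tendstoD[OF lim_t]
          order_tendstoD[OF lim_over_n(5)] order_tendstoD[OF lim_over_n(4)]
          order_tendstoD[OF lim_shift] order_tendstoD[OF lim_t_over_r], simp)+
  with 1 ev_basic show ?thesis
  proof eventually_elim
    case (elim n)
    have L: "ln (real n) > 0" "real n > 0" using elim by auto
    have "m n > 0" using elim by (simp add: m_eq)
    then have "r n + s n \<le> real n" by (simp add: m_def)
    moreover have "\<bar>m n / r n - t n\<bar> \<le> 3 / 4" using elim by linarith
    ultimately show ?case using elim L by (simp add: field_simps)
  qed
qed

text \<open>Subtracting the saddle point equations leaves
  \<open>Digamma (m + 1) - Digamma (u + 1)\<close>, of order t/u, then
  \<open>ln (1 + r) - ln r\<close>, of order 1/r, and in the first component also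
  \<open>m / (1 + r) - u / r\<close>. They contribute 7, 3 and 3 to the constant 13.\<close>

lemma ev_gradient:
  "\<forall>\<^sub>F n in sequentially. \<bar>logsum_x n (r n) (s n)\<bar> \<le> 13 * (ln (real n) / real n) \<and>
     \<bar>logsum_y n (r n) (s n)\<bar> \<le> 13 * (ln (real n) / real n)"
  using ev_size saddle
proof eventually_elim
  case (elim n)
  define l where "l = ln (real n) / real n"
  have pos: "r n > 0" "s n > 0" "t n > 0" "u n > 0" "m n > 0" "real n > 0" "ln (real n) > 0"
    using elim by auto
  have um: "u n = m n - t n" by (simp add: m_eq)
  have tu: "t n / u n \<le> 6 * l"
  proof -
    have "t n * real n \<le> (3 * ln (real n)) * (2 * u n)" using elim by (intro mult_mono) auto
    then show ?thesis using pos by (simp add: l_def field_simps)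
  qed
  have inv_r: "1 / r n \<le> 3 * l" using elim pos by (simp add: l_def field_simps)
  have inv_m: "1 / (2 * m n) \<le> l"
  proof -
    have "1 / (2 * m n) \<le> 1 / real n" using elim pos by (simp add: field_simps)
    also have "\<dots> \<le> l" unfolding l_def using elim pos by (intro divide_right_mono) auto
    finally show ?thesis .
  qed
  have psi: "0 \<le> Digamma (m n + 1) - Digamma (u n + 1)" "Digamma (m n + 1) - Digamma (u n + 1) \<le> 7 * l"
  proof -
    show "0 \<le> Digamma (m n + 1) - Digamma (u n + 1)"
      using pos um Digamma_real_mono[of "u n + 1" "m n + 1"] by simp
    have "ln (m n) - ln (u n) \<le> t n / u n"
    proof -
      have "ln (m n) - ln (u n) = ln (m n / u n)" using pos by (simp add: ln_div)
      also have "\<dots> \<le> m n / u n - 1" using pos by (intro ln_le_minus_one) simp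
      also have "\<dots> = t n / u n" using pos um by (simp add: field_simps)
      finally show ?thesis .
    qed
    moreover have "ln (u n) \<le> ln (u n + 1 / 2)" using pos by simp
    ultimately show "Digamma (m n + 1) - Digamma (u n + 1) \<le> 7 * l"
      using Digamma_plus1_le_ln_plus[OF pos(5)] Digamma_plus1_ge_ln_plus_half[OF pos(4)] tu inv_m
      by linarith
  qed
  have lnr: "0 \<le> ln (1 + r n) - ln (r n)" "ln (1 + r n) - ln (r n) \<le> 3 * l"
  proof -
    show "0 \<le> ln (1 + r n) - ln (r n)" using pos by simp
    have "ln (1 + r n) - ln (r n) = ln ((1 + r n) / r n)" using pos by (simp add: ln_div)
    also have "\<dots> \<le> (1 + r n) / r n - 1" using pos by (intro ln_le_minus_one) simp
    also have "\<dots> = 1 / r n" using pos by (simp add: field_simps)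
    finally show "ln (1 + r n) - ln (r n) \<le> 3 * l" using inv_r by linarith
  qed
  \<comment> \<open>Each fraction is of order ln n; the difference is O(1/r) only because
    \<open>m / r - t\<close> is bounded.\<close>
  have frac: "\<bar>m n / (1 + r n) - u n / r n\<bar> \<le> 3 * l"
  proof -
    have "m n / (1 + r n) - u n / r n = (t n - m n / r n + t n / r n) / (1 + r n)"
      unfolding um using pos(1) by (simp add: field_simps)
    also have "\<bar>\<dots>\<bar> \<le> 1 / (1 + r n)"
    proof -
      have "t n / r n \<ge> 0" using pos by simp
      then have "\<bar>t n - m n / r n + t n / r n\<bar> \<le> 1" using elim by linarith
      then show ?thesis using pos by (simp add: abs_divide divide_right_mono)
    qed
    also have "\<dots> \<le> 1 / r n" using pos by (intro divide_left_mono) auto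
    finally show ?thesis using inv_r by linarith
  qed
  have sp: "saddle_r n (r n) (s n) (t n) = 0" "saddle_s n (r n) (s n) (t n) = 0"
    using elim by (simp_all add: saddle_point_iff)
  have "logsum_x n (r n) (s n) = (Digamma (m n + 1) - Digamma (u n + 1)) - (ln (1 + r n) - ln (r n))
      + (m n / (1 + r n) - u n / r n)"
    using sp(1) unfolding saddle_r_def logsum_x_def m_def [symmetric] um [symmetric] by linarith
  moreover have "logsum_y n (r n) (s n) = (Digamma (m n + 1) - Digamma (u n + 1)) - (ln (1 + r n) - ln (r n))"
    using sp(2) unfolding saddle_s_def logsum_y_def m_def [symmetric] um [symmetric] by linarith
  ultimately show ?case using psi lnr frac unfolding l_def [symmetric] by linarith
qed

text \<open>The gradient, at most 13 ln n / n, times a displacement of at most 3 n / ln n is at most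
  39 per coordinate over the whole box, so the linear terms cost only the factor
  \<open>exp 78\<close>. Half of the quadratic bound L^2/(72n), measured in units of
  \<open>width\<close>, gives the rate 1/(144 * 4) = 1/576.\<close>

lemma ev_summand_bound:
  "\<forall>\<^sub>F n in sequentially. \<forall>i\<le>cutoff n. \<forall>j\<le>cutoff n.
     \<bar>summand n i j / exp (G n)\<bar> \<le> exp 78 *
        exp (- (1 / 576) * (((real i - r n) / width n)\<^sup>2 + ((real j - s n) / width n)\<^sup>2))"
proof -
  have small: "\<forall>\<^sub>F n :: nat in sequentially. 2 * (2 * real n / ln (real n) + 1) \<le> real n / 2"
    "\<forall>\<^sub>F n :: nat in sequentially. 2 * real n / ln (real n) + 2 \<le> 3 * real n / ln (real n)"
    by real_asymp+
  show ?thesis using small ev_size ev_gradient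
  proof eventually_elim
    case (elim n)
    define L where "L = ln (real n)"
    define B where "B = 3 * real n / L"
    have n: "n \<ge> 2" and L: "L \<ge> 17" "real n > 0" using elim by (auto simp: L_def)
    have B: "real (cutoff n) + 1 \<le> B" and cutoff_n: "2 * real (cutoff n) \<le> real n / 2"
      using cutoff_bounds[OF n] elim by (simp_all add: B_def L_def)
    have rB: "r n + 1 \<le> B" "s n + 1 \<le> B" "r n + s n \<le> real n / 2"
    proof -
      have "real n / ln (real n) \<le> 2 * real n / ln (real n)" using n by (intro divide_right_mono) auto
      then have rs: "r n \<le> 2 * real n / ln (real n)" "s n \<le> 2 * real n / ln (real n)" using elim by linarith+
      then show "r n + 1 \<le> B" "s n + 1 \<le> B"
        using elim unfolding B_def L_def by linarith+
      have "v + w \<le> y" if "v \<le> z" "w \<le> z" "2 * (z + 1) \<le> y" for v w z y :: real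
        using that by argo
      from this[OF rs elim(1)] show "r n + s n \<le> real n / 2" .
    qed
    have pos: "r n > 0" "s n > 0" using elim by auto
    show ?case
    proof (intro allI impI)
      fix i j assume ij: "i \<le> cutoff n" "j \<le> cutoff n"
      define a b where "a = real i - r n" and "b = real j - s n"
      show "\<bar>summand n i j / exp (G n)\<bar> \<le> exp 78 *
        exp (- (1 / 576) * (((real i - r n) / width n)\<^sup>2 + ((real j - s n) / width n)\<^sup>2))"
      proof (cases "j = 0")
        case True
        then show ?thesis by (simp add: summand_def)
      next
        case False
        have ij_real: "real i \<le> real (cutoff n)" "real j \<le> real (cutoff n)" using ij by simp_all
        then have ijn: "real i + real j \<le> real n / 2" using cutoff_n by linarith
        then have "i + j \<le> n" by linarith
        then have T: "summand n i j = exp (logsum n i j)"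
          using False by (intro summand_eq_exp) auto
        obtain \<xi> where \<xi>: "0 < \<xi>" "\<xi> < 1"
          and eq: "logsum n i j = G n + (logsum_x n (r n) (s n) * a + logsum_y n (r n) (s n) * b)
            - logsum_quad n (r n + \<xi> * a) (s n + \<xi> * b) a b / 2"
          using logsum_taylor[of "real i" "real j" "real n" "r n" "s n", folded a_def b_def G_def]
            False ijn elim pos by auto
        define X Y where "X = r n + \<xi> * a" and "Y = s n + \<xi> * b"
        have conv: "X = (1 - \<xi>) * r n + \<xi> * real i" "Y = (1 - \<xi>) * s n + \<xi> * real j"
          by (simp_all add: X_def Y_def a_def b_def algebra_simps)
        have X0: "X \<ge> 0" "Y > 0"
          unfolding conv using \<xi> pos by (auto intro!: add_nonneg_nonneg add_pos_nonneg mult_pos_pos)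
        have cvx: "(1 - \<xi>) * v + \<xi> * w \<le> z" if "v \<le> z" "w \<le> z" for v w z :: real
        proof -
          have "(1 - \<xi>) * v + \<xi> * w \<le> (1 - \<xi>) * z + \<xi> * z"
            using that \<xi> by (intro add_mono mult_left_mono) auto
          then show ?thesis by (simp add: algebra_simps)
        qed
        have "X \<le> B - 1" "Y \<le> B - 1"
          unfolding conv using rB B ij_real by (intro cvx; linarith)+
        moreover have "X + Y \<le> real n / 2"
        proof -
          have "X + Y = (1 - \<xi>) * (r n + s n) + \<xi> * (real i + real j)"
            unfolding conv by (simp add: algebra_simps)
          also have "\<dots> \<le> real n / 2" using rB ijn by (intro cvx) auto
          finally show ?thesis .
        qed
        ultimately have "logsum_quad n X Y a b \<ge> (real n / (4 * B\<^sup>2) - 4 / real n) * (a\<^sup>2 + b\<^sup>2)"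
          using X0 L by (intro logsum_quad_ge) auto
        \<comment> \<open>The main term is L^2/(36n); half of it is given up to absorb 4/n, which
          uses L >= 17.\<close>
        moreover have "real n / (4 * B\<^sup>2) - 4 / real n \<ge> L\<^sup>2 / (72 * real n)"
        proof -
          have "real n / (4 * B\<^sup>2) = L\<^sup>2 / (36 * real n)"
            using L by (simp add: B_def power_divide power_mult_distrib power2_eq_square)
          moreover have "4 / real n \<le> L\<^sup>2 / (72 * real n)"
          proof -
            have "288 \<le> L\<^sup>2" using power_mono[of 17 L 2] L by simp
            then show ?thesis using L by (simp add: field_simps)
          qed
          moreover have "L\<^sup>2 / (36 * real n) = 2 * (L\<^sup>2 / (72 * real n))" by simp
          ultimately show ?thesis by linarith
        qed
        ultimately have quad: "logsum_quad n X Y a b \<ge> L\<^sup>2 / (72 * real n) * (a\<^sup>2 + b\<^sup>2)"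
          by (meson mult_right_mono order_trans sum_power2_ge_zero)
        have ab: "\<bar>a\<bar> \<le> B" "\<bar>b\<bar> \<le> B"
          unfolding a_def b_def using ij_real B rB pos by linarith+
        have lin: "\<bar>g * d\<bar> \<le> 39" if "\<bar>g\<bar> \<le> 13 * (ln (real n) / real n)" "\<bar>d\<bar> \<le> B" for g d
        proof -
          have "\<bar>g * d\<bar> \<le> (13 * (ln (real n) / real n)) * B"
            unfolding abs_mult using that by (intro mult_mono) auto
          also have "\<dots> = 39" using L n by (simp add: B_def L_def)
          finally show ?thesis .
        qed
        have "logsum n i j - G n \<le> 78 - L\<^sup>2 / (144 * real n) * (a\<^sup>2 + b\<^sup>2)"
        proof -
          have "\<bar>logsum_x n (r n) (s n) * a\<bar> \<le> 39" "\<bar>logsum_y n (r n) (s n) * b\<bar> \<le> 39"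
            using elim ab by (auto intro!: lin)
          moreover have "L\<^sup>2 / (144 * real n) * (a\<^sup>2 + b\<^sup>2) = L\<^sup>2 / (72 * real n) * (a\<^sup>2 + b\<^sup>2) / 2"
            by simp
          moreover have "l - g \<le> 78 - q" if "\<bar>v\<bar> \<le> 39" "\<bar>w\<bar> \<le> 39" "q = k / 2" "k \<le> z" "l = g + (v + w) - z / 2"
            for l g q v w k z :: real
            using that by (simp add: abs_le_iff)
          ultimately show ?thesis using eq quad unfolding X_def Y_def by blast
        qed
        moreover have "L\<^sup>2 / (144 * real n) * (a\<^sup>2 + b\<^sup>2) = (1 / 576) * ((a / width n)\<^sup>2 + (b / width n)\<^sup>2)"
          using L unfolding power_divide[of _ "width n"] width_square L_def [symmetric] by (simp add: field_simps)
        ultimately have "exp (logsum n i j - G n) \<le> exp (78 + - (1 / 576) * ((a / width n)\<^sup>2 + (b / width n)\<^sup>2))"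
          unfolding exp_le_cancel_iff by linarith
        then show ?thesis unfolding T a_def b_def exp_add by (simp add: exp_diff)
      qed
    qed
  qed
qed

lemma summand_tendsto:
  assumes i: "(\<lambda>n. (real (i n) - r n) / width n) \<longlonglongrightarrow> x" and j: "(\<lambda>n. (real (j n) - s n) / width n) \<longlonglongrightarrow> y"
  shows "(\<lambda>n. summand n (i n) (j n) / exp (G n)) \<longlonglongrightarrow> exp (- (1 / 2) * (x\<^sup>2 + y\<^sup>2))"
proof -
  define a b where "a n = real (i n) - r n" and "b n = real (j n) - s n" for n
  define \<alpha> \<beta> where "\<alpha> n = a n / width n" and "\<beta> n = b n / width n" for n
  have \<alpha>: "\<alpha> \<longlonglongrightarrow> x" and \<beta>: "\<beta> \<longlonglongrightarrow> y"
    using i j unfolding \<alpha>_def [abs_def] \<beta>_def [abs_def] a_def b_def by simp_all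
  \<comment> \<open>The width relative to the scale n / ln n of the saddle coordinates. As it
    vanishes, all points within a bounded number of widths share the leading asymptotics of the
    saddle, and gradient times displacement tends to 0.\<close>
  define k where "k n = width n * ln (real n) / real n" for n
  have k: "k \<longlonglongrightarrow> 0" unfolding k_def [abs_def] width_def by real_asymp
  have pos_ev: "\<forall>\<^sub>F n :: nat in sequentially. width n > 0 \<and> ln (real n) > 1 \<and> real n > 0"
    unfolding width_def by (intro eventually_conj; real_asymp)
  have ak: "\<forall>\<^sub>F n in sequentially. a n * ln (real n) / real n = \<alpha> n * k n \<and> b n * ln (real n) / real n = \<beta> n * k n"
    using pos_ev by eventually_elim (auto simp: \<alpha>_def \<beta>_def k_def)
  have iL: "(\<lambda>n. real (i n) * ln (real n) / real n) \<longlonglongrightarrow> 1 / 2"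
  proof -
    have "(\<lambda>n. r n * ln (real n) / real n + \<alpha> n * k n) \<longlonglongrightarrow> 1 / 2 + x * 0"
      by (intro tendsto_intros lim_r \<alpha> k)
    then have "(\<lambda>n. r n * ln (real n) / real n + \<alpha> n * k n) \<longlonglongrightarrow> 1 / 2" by simp
    then show ?thesis
      by (rule Lim_transform_eventually)
         (use ak in \<open>eventually_elim, simp add: a_def left_diff_distrib diff_divide_distrib\<close>)
  qed
  have jL: "(\<lambda>n. real (j n) * ln (real n) / real n) \<longlonglongrightarrow> 1 / 2"
  proof -
    have "(\<lambda>n. s n * ln (real n) / real n + \<beta> n * k n) \<longlonglongrightarrow> 1 / 2 + y * 0"
      by (intro tendsto_intros lim_s \<beta> k)
    then have "(\<lambda>n. s n * ln (real n) / real n + \<beta> n * k n) \<longlonglongrightarrow> 1 / 2" by simp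
    then show ?thesis
      by (rule Lim_transform_eventually)
         (use ak in \<open>eventually_elim, simp add: b_def left_diff_distrib diff_divide_distrib\<close>)
  qed
  have big: "\<forall>\<^sub>F n :: nat in sequentially. ln (real n) > 4" by real_asymp
  have ev_ij: "\<forall>\<^sub>F n in sequentially. i n + j n \<le> n \<and> j n \<ge> 1"
  proof -
    have "\<forall>\<^sub>F n in sequentially. real (i n) * ln (real n) / real n < 1"
      "\<forall>\<^sub>F n in sequentially. real (j n) * ln (real n) / real n < 1"
      "\<forall>\<^sub>F n in sequentially. 0 < real (j n) * ln (real n) / real n"
      by (rule order_tendstoD[OF iL] order_tendstoD[OF jL], simp)+
    then show ?thesis using pos_ev big
    proof eventually_elim
      case (elim n)
      have "real (i n) * 2 \<le> real (i n) * ln (real n)" "real (j n) * 2 \<le> real (j n) * ln (real n)"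
        using elim by (intro mult_left_mono; simp)+
      moreover have "real (i n) * ln (real n) < real n" "real (j n) * ln (real n) < real n"
        using elim by (simp_all add: field_simps)
      ultimately have "real (i n) + real (j n) \<le> real n" by linarith
      moreover have "j n \<noteq> 0" using elim by (intro notI) simp
      ultimately show ?case by linarith
    qed
  qed
  define eqn where "eqn n \<xi> \<longleftrightarrow> 0 < \<xi> \<and> \<xi> < 1 \<and> summand n (i n) (j n) = exp (G n + (logsum_x n (r n) (s n) * a n
      + logsum_y n (r n) (s n) * b n) - logsum_quad n (r n + \<xi> * a n) (s n + \<xi> * b n) (a n) (b n) / 2)" for n \<xi>
  \<comment> \<open>The intermediate point of Taylor's formula varies with n; it is fixed as a
    sequence, of which only membership in (0, 1) matters.\<close>
  define \<xi> where "\<xi> n = (SOME z. eqn n z)" for n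
  have ev_eqn: "\<forall>\<^sub>F n in sequentially. eqn n (\<xi> n)"
    using ev_ij ev_size
  proof eventually_elim
    case (elim n)
    have "real (i n) + real (j n) \<le> real n" using elim by linarith
    then have "\<exists>z. eqn n z"
      using logsum_taylor[of "real (i n)" "real (j n)" "real n" "r n" "s n", folded a_def b_def G_def]
        elim summand_eq_exp[of "i n" "j n" n] by (auto simp: eqn_def)
    then show ?case unfolding \<xi>_def by (rule someI_ex)
  qed
  have grad: "(\<lambda>n. g n * d n) \<longlonglongrightarrow> 0"
    if g: "\<forall>\<^sub>F n in sequentially. \<bar>g n\<bar> \<le> 13 * (ln (real n) / real n)"
      and d: "\<forall>\<^sub>F n in sequentially. d n * ln (real n) / real n = e n * k n" and e: "e \<longlonglongrightarrow> z"
    for g d e :: "nat \<Rightarrow> real" and z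
  proof (rule Lim_null_comparison)
    show "\<forall>\<^sub>F n in sequentially. norm (g n * d n) \<le> 13 * \<bar>e n * k n\<bar>"
      using g d pos_ev
    proof eventually_elim
      case (elim n)
      have "norm (g n * d n) \<le> 13 * (ln (real n) / real n) * \<bar>d n\<bar>"
        unfolding real_norm_def abs_mult using elim by (intro mult_right_mono) auto
      also have "\<dots> = 13 * \<bar>d n * ln (real n) / real n\<bar>"
      proof -
        have "\<bar>ln (real n)\<bar> = ln (real n)" "\<bar>real n\<bar> = real n" using elim by auto
        then show ?thesis by (simp only: abs_mult abs_divide) simp
      qed
      finally show ?case using elim by simp
    qed
    have "(\<lambda>n. 13 * \<bar>e n * k n\<bar>) \<longlonglongrightarrow> 13 * \<bar>z * 0\<bar>" by (intro tendsto_intros e k)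
    then show "(\<lambda>n. 13 * \<bar>e n * k n\<bar>) \<longlonglongrightarrow> 0" by simp
  qed
  have gx: "(\<lambda>n. logsum_x n (r n) (s n) * a n) \<longlonglongrightarrow> 0"
    by (rule grad[OF _ _ \<alpha>]) (use ev_gradient in eventually_elim, simp, use ak in eventually_elim, simp)
  have gy: "(\<lambda>n. logsum_y n (r n) (s n) * b n) \<longlonglongrightarrow> 0"
    by (rule grad[OF _ _ \<beta>]) (use ev_gradient in eventually_elim, simp, use ak in eventually_elim, simp)
  define X Y where "X n = r n + \<xi> n * a n" and "Y n = s n + \<xi> n * b n" for n
  have \<xi>k: "(\<lambda>n. \<xi> n * (e n * k n)) \<longlonglongrightarrow> 0" if e: "e \<longlonglongrightarrow> z" for e :: "nat \<Rightarrow> real" and z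
  proof (rule Lim_null_comparison)
    show "\<forall>\<^sub>F n in sequentially. norm (\<xi> n * (e n * k n)) \<le> \<bar>e n * k n\<bar>"
      using ev_eqn by eventually_elim (auto simp: eqn_def abs_mult intro!: mult_left_le_one_le)
    have "(\<lambda>n. \<bar>e n * k n\<bar>) \<longlonglongrightarrow> \<bar>z * 0\<bar>" by (intro tendsto_intros e k)
    then show "(\<lambda>n. \<bar>e n * k n\<bar>) \<longlonglongrightarrow> 0" by simp
  qed
  have XL: "(\<lambda>n. X n * ln (real n) / real n) \<longlonglongrightarrow> 1 / 2"
  proof -
    have "(\<lambda>n. r n * ln (real n) / real n + \<xi> n * (\<alpha> n * k n)) \<longlonglongrightarrow> 1 / 2 + 0"
      by (intro tendsto_add lim_r \<xi>k[OF \<alpha>])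
    then have "(\<lambda>n. r n * ln (real n) / real n + \<xi> n * (\<alpha> n * k n)) \<longlonglongrightarrow> 1 / 2" by simp
    then show ?thesis
      by (rule Lim_transform_eventually)
         (use ak in \<open>eventually_elim, simp add: X_def ring_distribs add_divide_distrib mult.assoc flip: times_divide_eq_right\<close>)
  qed
  have YL: "(\<lambda>n. Y n * ln (real n) / real n) \<longlonglongrightarrow> 1 / 2"
  proof -
    have "(\<lambda>n. s n * ln (real n) / real n + \<xi> n * (\<beta> n * k n)) \<longlonglongrightarrow> 1 / 2 + 0"
      by (intro tendsto_add lim_s \<xi>k[OF \<beta>])
    then have "(\<lambda>n. s n * ln (real n) / real n + \<xi> n * (\<beta> n * k n)) \<longlonglongrightarrow> 1 / 2" by simp
    then show ?thesis
      by (rule Lim_transform_eventually)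
         (use ak in \<open>eventually_elim, simp add: Y_def ring_distribs add_divide_distrib mult.assoc flip: times_divide_eq_right\<close>)
  qed
  have lnr: "(\<lambda>n :: nat. ln (real n) / real n) \<longlonglongrightarrow> 0" and inv_ln: "(\<lambda>n :: nat. 1 / ln (real n)) \<longlonglongrightarrow> 0"
    and inv_n: "(\<lambda>n :: nat. 1 / real n) \<longlonglongrightarrow> 0"
    by real_asymp+
  \<comment> \<open>Normalised reciprocals of the coordinates:
    \<open>(width n)\<^sup>2 * (M n / (1 + X n)\<^sup>2)\<close> equals (M/n) A1^2 / 4, so the limit
    2 makes the rescaled diagonal entries tend to 1.\<close>
  define A1 A2 M where "A1 n = real n / (ln (real n) * (1 + X n))" and "A2 n = real n / (ln (real n) * Y n)"
    and "M n = real n - X n - Y n" for n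
  have A1: "A1 \<longlonglongrightarrow> 2"
  proof -
    have "(\<lambda>n. 1 / (ln (real n) / real n + X n * ln (real n) / real n)) \<longlonglongrightarrow> 1 / (0 + 1 / 2)"
      by (intro tendsto_intros lnr XL) auto
    then have "(\<lambda>n. 1 / (ln (real n) / real n + X n * ln (real n) / real n)) \<longlonglongrightarrow> 2" by simp
    then show ?thesis
      by (rule Lim_transform_eventually)
         (use pos_ev in \<open>eventually_elim, simp add: A1_def add_divide_distrib [symmetric] algebra_simps\<close>)
  qed
  have A2: "A2 \<longlonglongrightarrow> 2"
  proof -
    have "(\<lambda>n. 1 / (Y n * ln (real n) / real n)) \<longlonglongrightarrow> 1 / (1 / 2)"
      by (intro tendsto_intros YL) auto
    then have "(\<lambda>n. 1 / (Y n * ln (real n) / real n)) \<longlonglongrightarrow> 2" by simp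
    then show ?thesis
      by (rule Lim_transform_eventually) (use pos_ev in \<open>eventually_elim, simp add: A2_def mult_ac\<close>)
  qed
  have Mn: "(\<lambda>n. M n / real n) \<longlonglongrightarrow> 1"
  proof -
    have "(\<lambda>n. 1 - X n * ln (real n) / real n * (1 / ln (real n)) - Y n * ln (real n) / real n * (1 / ln (real n)))
       \<longlonglongrightarrow> 1 - 1 / 2 * 0 - 1 / 2 * 0"
      by (intro tendsto_intros XL YL inv_ln)
    then have "(\<lambda>n. 1 - X n * ln (real n) / real n * (1 / ln (real n)) - Y n * ln (real n) / real n * (1 / ln (real n)))
       \<longlonglongrightarrow> 1" by simp
    then show ?thesis
      by (rule Lim_transform_eventually) (use pos_ev in \<open>eventually_elim, auto simp: M_def field_simps\<close>)
  qed
  have X_big: "\<forall>\<^sub>F n in sequentially. X n \<ge> 1 \<and> Y n \<ge> 1 \<and> M n \<ge> 1"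
  proof -
    have "\<forall>\<^sub>F n :: nat in sequentially. 4 * ln (real n) \<le> real n" "\<forall>\<^sub>F n :: nat in sequentially. 2 \<le> real n"
      by real_asymp+
    moreover have "\<forall>\<^sub>F n in sequentially. 1 / 4 < X n * ln (real n) / real n"
      "\<forall>\<^sub>F n in sequentially. 1 / 4 < Y n * ln (real n) / real n" "\<forall>\<^sub>F n in sequentially. 1 / 2 < M n / real n"
      by (rule order_tendstoD[OF XL] order_tendstoD[OF YL] order_tendstoD[OF Mn], simp)+
    ultimately show ?thesis using pos_ev
    proof eventually_elim
      case (elim n)
      have *: "1 \<le> z" if "1 / 4 < z * ln (real n) / real n" for z
      proof (rule ccontr)
        assume "\<not> 1 \<le> z"
        then have "z * ln (real n) \<le> 1 * ln (real n)" using elim by (intro mult_right_mono) auto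
        moreover have "real n < 4 * (z * ln (real n))" using that elim by (simp add: field_simps)
        ultimately show False using elim by linarith
      qed
      have "1 \<le> M n" using elim by (simp add: field_simps)
      with * elim show ?case by blast
    qed
  qed
  have P0: "(\<lambda>n. (width n)\<^sup>2 * Polygamma 1 (z n + 1)) \<longlonglongrightarrow> 0"
    if z: "\<forall>\<^sub>F n in sequentially. z n \<ge> 1" "(\<lambda>n. (width n)\<^sup>2 / z n) \<longlonglongrightarrow> 0" for z :: "nat \<Rightarrow> real"
  proof (rule Lim_null_comparison[OF _ z(2)])
    show "\<forall>\<^sub>F n in sequentially. norm ((width n)\<^sup>2 * Polygamma 1 (z n + 1)) \<le> (width n)\<^sup>2 / z n"
      using z(1)
    proof eventually_elim
      case (elim n)
      have "0 \<le> Polygamma 1 (z n + 1)" using Polygamma1_ge[of "z n + 1"] elim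
        by (smt (verit) divide_nonneg_pos)
      moreover have "(width n)\<^sup>2 * Polygamma 1 (z n + 1) \<le> (width n)\<^sup>2 * (1 / z n)"
        using elim by (intro mult_left_mono Polygamma1_plus1_le) auto
      ultimately show ?case by simp
    qed
  qed
  have s1X: "(\<lambda>n. (width n)\<^sup>2 / (1 + X n)) \<longlonglongrightarrow> 0"
  proof -
    have "(\<lambda>n. A1 n * (1 / ln (real n)) / 4) \<longlonglongrightarrow> 2 * 0 / 4" by (intro tendsto_intros A1 inv_ln) auto
    then have "(\<lambda>n. A1 n * (1 / ln (real n)) / 4) \<longlonglongrightarrow> 0" by simp
    then show ?thesis
      by (rule Lim_transform_eventually)
         (use pos_ev X_big in \<open>eventually_elim, simp only: A1_def width_square, simp add: power2_eq_square mult_ac\<close>)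
  qed
  have sX: "(\<lambda>n. (width n)\<^sup>2 / X n) \<longlonglongrightarrow> 0"
  proof (rule Lim_null_comparison)
    have "(\<lambda>n. 2 * ((width n)\<^sup>2 / (1 + X n))) \<longlonglongrightarrow> 2 * 0" by (intro tendsto_intros s1X)
    then show "(\<lambda>n. 2 * ((width n)\<^sup>2 / (1 + X n))) \<longlonglongrightarrow> 0" by simp
    show "\<forall>\<^sub>F n in sequentially. norm ((width n)\<^sup>2 / X n) \<le> 2 * ((width n)\<^sup>2 / (1 + X n))"
      using X_big pos_ev
    proof eventually_elim
      case (elim n)
      have "(width n)\<^sup>2 * (1 / X n) \<le> (width n)\<^sup>2 * (2 / (1 + X n))"
        using elim by (intro mult_left_mono) (auto simp: field_simps)
      then show ?case using elim by (simp add: mult_ac)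
    qed
  qed
  have sY: "(\<lambda>n. (width n)\<^sup>2 / Y n) \<longlonglongrightarrow> 0"
  proof -
    have "(\<lambda>n. A2 n * (1 / ln (real n)) / 4) \<longlonglongrightarrow> 2 * 0 / 4" by (intro tendsto_intros A2 inv_ln) auto
    then have "(\<lambda>n. A2 n * (1 / ln (real n)) / 4) \<longlonglongrightarrow> 0" by simp
    then show ?thesis
      by (rule Lim_transform_eventually)
         (use pos_ev X_big in \<open>eventually_elim, simp only: A2_def width_square, simp add: power2_eq_square mult_ac\<close>)
  qed
  have sM: "(\<lambda>n. (width n)\<^sup>2 / M n) \<longlonglongrightarrow> 0"
  proof -
    have "(\<lambda>n. 1 / (M n / real n) * (1 / ln (real n))\<^sup>2 / 4) \<longlonglongrightarrow> 1 / 1 * 0\<^sup>2 / 4"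
      by (intro tendsto_intros Mn inv_ln) auto
    then have "(\<lambda>n. 1 / (M n / real n) * (1 / ln (real n))\<^sup>2 / 4) \<longlonglongrightarrow> 0" by simp
    then show ?thesis
      by (rule Lim_transform_eventually)
         (use pos_ev X_big in \<open>eventually_elim, simp add: width_square power_divide\<close>)
  qed
  have cX: "(\<lambda>n. (width n)\<^sup>2 * (M n / (1 + X n)\<^sup>2)) \<longlonglongrightarrow> 1"
  proof -
    have "(\<lambda>n. M n / real n * (A1 n)\<^sup>2 / 4) \<longlonglongrightarrow> 1 * 2\<^sup>2 / 4" by (intro tendsto_intros Mn A1) auto
    then have "(\<lambda>n. M n / real n * (A1 n)\<^sup>2 / 4) \<longlonglongrightarrow> 1" by simp
    then show ?thesis
      by (rule Lim_transform_eventually)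
         (use pos_ev X_big in \<open>eventually_elim, simp only: A1_def width_square, simp add: power2_eq_square mult_ac\<close>)
  qed
  have cY: "(\<lambda>n. (width n)\<^sup>2 * ((M n + 1) / (Y n)\<^sup>2)) \<longlonglongrightarrow> 1"
  proof -
    have "(\<lambda>n. (M n / real n + 1 / real n) * (A2 n)\<^sup>2 / 4) \<longlonglongrightarrow> (1 + 0) * 2\<^sup>2 / 4"
      by (intro tendsto_intros Mn A2 inv_n) auto
    then have "(\<lambda>n. (M n / real n + 1 / real n) * (A2 n)\<^sup>2 / 4) \<longlonglongrightarrow> 1" by simp
    then show ?thesis
      by (rule Lim_transform_eventually)
         (use pos_ev X_big in \<open>eventually_elim, simp only: A2_def width_square, simp add: power2_eq_square mult_ac add_divide_distrib [symmetric]\<close>)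
  qed
  \<comment> \<open>The Hessian form in rescaled coordinates. The trigamma and mixed terms are O(1 /
    ln n), so only the two squares survive in the limit.\<close>
  define quad where "quad n = ((width n)\<^sup>2 * Polygamma 1 (X n + 1) + 2 * ((width n)\<^sup>2 / (1 + X n)) + (width n)\<^sup>2 * (M n / (1 + X n)\<^sup>2)) * (\<alpha> n)\<^sup>2
     + ((width n)\<^sup>2 * Polygamma 1 (Y n + 1) + 2 * ((width n)\<^sup>2 / Y n) + (width n)\<^sup>2 * ((M n + 1) / (Y n)\<^sup>2)) * (\<beta> n)\<^sup>2
     + (width n)\<^sup>2 * Polygamma 1 (M n + 1) * (\<alpha> n + \<beta> n)\<^sup>2
     + 2 * \<alpha> n * \<beta> n * ((width n)\<^sup>2 / Y n + (width n)\<^sup>2 / (1 + X n))" for n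
  have "quad \<longlonglongrightarrow> (0 + 2 * 0 + 1) * x\<^sup>2 + (0 + 2 * 0 + 1) * y\<^sup>2 + 0 * (x + y)\<^sup>2 + 2 * x * y * (0 + 0)"
    unfolding quad_def [abs_def]
    by (intro tendsto_intros P0 \<alpha> \<beta> cX cY sX sY sM s1X) (use X_big in \<open>eventually_elim, simp\<close>)+
  then have quad: "quad \<longlonglongrightarrow> x\<^sup>2 + y\<^sup>2" by simp
  have "(\<lambda>n. exp (logsum_x n (r n) (s n) * a n + logsum_y n (r n) (s n) * b n - quad n / 2)) \<longlonglongrightarrow>
      exp (0 + 0 - (x\<^sup>2 + y\<^sup>2) / 2)"
    by (intro tendsto_intros gx gy quad) auto
  moreover have "\<forall>\<^sub>F n in sequentially. exp (logsum_x n (r n) (s n) * a n + logsum_y n (r n) (s n) * b n - quad n / 2)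
      = summand n (i n) (j n) / exp (G n)"
    using ev_eqn pos_ev
  proof eventually_elim
    case (elim n)
    have ab: "a n = \<alpha> n * width n" "b n = \<beta> n * width n" using elim by (simp_all add: \<alpha>_def \<beta>_def)
    have "logsum_quad n (X n) (Y n) (a n) (b n) = quad n"
      unfolding logsum_quad_def quad_def M_def ab
      by (simp add: power_mult_distrib) (simp add: algebra_simps power2_eq_square)
    then show ?case using elim by (simp add: eqn_def X_def [symmetric] Y_def [symmetric] exp_add exp_diff)
  qed
  ultimately have "(\<lambda>n. summand n (i n) (j n) / exp (G n)) \<longlonglongrightarrow> exp (0 + 0 - (x\<^sup>2 + y\<^sup>2) / 2)"
    by (rule Lim_transform_eventually)
  then show ?thesis by simp
qed

end

section \<open>The value at the saddle point\<close>

context saddle_sequence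
begin

section \<open>The sum over the box and the tail outside it\<close>

lemma centre_conditions:
  "filterlim (\<lambda>n. r n / width n) at_top sequentially" "filterlim (\<lambda>n. s n / width n) at_top sequentially"
  "filterlim (\<lambda>n. (real (cutoff n) - r n) / width n) at_top sequentially"
  "filterlim (\<lambda>n. (real (cutoff n) - s n) / width n) at_top sequentially"
proof -
  have pos: "\<forall>\<^sub>F n :: nat in sequentially. ln (real n) > 0" by real_asymp
  have wpos: "\<forall>\<^sub>F n :: nat in sequentially. width n > 0" unfolding width_def by real_asymp
  have R: "filterlim (\<lambda>n. real n / ln (real n) / width n) at_top sequentially"
    unfolding width_def by real_asymp
  have mult: "filterlim (\<lambda>n. x n / width n) at_top sequentially"
    if x: "(\<lambda>n. x n * ln (real n) / real n) \<longlonglongrightarrow> 1 / 2" for x :: "nat \<Rightarrow> real"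
  proof -
    have "filterlim (\<lambda>n. x n * ln (real n) / real n * (real n / ln (real n) / width n)) at_top sequentially"
      by (rule filterlim_tendsto_pos_mult_at_top[OF x _ R]) simp
    moreover have "\<forall>\<^sub>F n in sequentially. x n * ln (real n) / real n * (real n / ln (real n) / width n) = x n / width n"
      using pos eventually_gt_at_top[of 0] by eventually_elim auto
    ultimately show ?thesis by (simp add: filterlim_cong)
  qed
  show "filterlim (\<lambda>n. r n / width n) at_top sequentially" "filterlim (\<lambda>n. s n / width n) at_top sequentially"
    by (rule mult lim_r lim_s)+
  have far: "\<forall>\<^sub>F n in sequentially. real n / ln (real n) / width n \<le> (real (cutoff n) - r n) / width n \<and>
     real n / ln (real n) / width n \<le> (real (cutoff n) - s n) / width n"
    using ev_size wpos
  proof eventually_elim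
    case (elim n)
    have "2 * (real n / ln (real n)) \<le> real (cutoff n)" using cutoff_bounds(1)[of n] elim by simp
    then have "real n / ln (real n) \<le> real (cutoff n) - r n" "real n / ln (real n) \<le> real (cutoff n) - s n"
      using elim by linarith+
    then show ?case using elim by (intro conjI divide_right_mono) auto
  qed
  show "filterlim (\<lambda>n. (real (cutoff n) - r n) / width n) at_top sequentially"
    by (rule filterlim_at_top_mono[OF R]) (use far in eventually_elim, auto)
  show "filterlim (\<lambda>n. (real (cutoff n) - s n) / width n) at_top sequentially"
    by (rule filterlim_at_top_mono[OF R]) (use far in eventually_elim, auto)
qed

lemma cutoff_sum_tendsto:
  "(\<lambda>n. (\<Sum>i\<le>cutoff n. \<Sum>j\<le>cutoff n. summand n i j / exp (G n)) / (width n)\<^sup>2) \<longlonglongrightarrow> 2 * pi"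
  by (rule lattice_sum_gaussian[OF width_at_top _ _ ev_summand_bound summand_tendsto centre_conditions]) auto

lemma tail_tendsto:
  "(\<lambda>n. (c n - (\<Sum>i\<le>cutoff n. \<Sum>j\<le>cutoff n. summand n i j)) / exp (G n) / (width n)\<^sup>2) \<longlonglongrightarrow> 0"
proof (rule Lim_null_comparison)
  \<comment> \<open>A clamped index lies at distance at least n / ln n from the saddle in some
    coordinate; its square is 4n in units of \<open>width\<close>. This beats the at most (n + 1)^2
    terms of the tail.\<close>
  define \<epsilon> where "\<epsilon> n = exp 78 * exp (- (1 / 576) * (4 * real n))" for n :: nat
  have ev: "\<forall>\<^sub>F n :: nat in sequentially. 2 * real n / ln (real n) + 1 \<le> real n"
    "\<forall>\<^sub>F n :: nat in sequentially. real n * sqrt (real n) \<le> (2 * real n / ln (real n))\<^sup>2"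
    by real_asymp+
  show "(\<lambda>n :: nat. (real n + 1)\<^sup>2 * \<epsilon> n / (width n)\<^sup>2) \<longlonglongrightarrow> 0"
    unfolding \<epsilon>_def width_def by real_asymp
  show "\<forall>\<^sub>F n in sequentially. norm ((c n - (\<Sum>i\<le>cutoff n. \<Sum>j\<le>cutoff n. summand n i j)) / exp (G n) / (width n)\<^sup>2)
      \<le> (real n + 1)\<^sup>2 * \<epsilon> n / (width n)\<^sup>2"
    using ev ev_size ev_summand_bound
  proof eventually_elim
    case (elim n)
    define N where "N = cutoff n"
    have n: "n \<ge> 2" and L: "ln (real n) > 0" using elim by auto
    note bb = cutoff_bounds[OF n, folded N_def]
    have Nn: "N \<le> n" using bb elim by linarith
    have far: "((real N - z) / width n)\<^sup>2 \<ge> 4 * real n" if "z \<le> real n / ln (real n)" for z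
    proof -
      have "2 * (real n / ln (real n)) \<le> real N" using bb(1) by simp
      then have "real n / ln (real n) \<le> real N - z" using that by linarith
      then have "(real n / ln (real n))\<^sup>2 \<le> (real N - z)\<^sup>2" using L by (intro power_mono) auto
      then have "(real n / ln (real n))\<^sup>2 / (width n)\<^sup>2 \<le> (real N - z)\<^sup>2 / (width n)\<^sup>2"
        by (intro divide_right_mono) auto
      moreover have "(real n / ln (real n))\<^sup>2 / (width n)\<^sup>2 = 4 * real n"
        unfolding width_square using n L by (simp add: power_divide power2_eq_square)
      ultimately show ?thesis by (simp add: power_divide)
    qed
    have out: "summand n i j / exp (G n) \<le> \<epsilon> n" if "N < i \<or> N < j" for i j
    proof -
      define i' j' where "i' = min i N" and "j' = min j N"
      have "summand n i j \<le> summand n i' j'"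
        unfolding i'_def j'_def by (rule summand_le_clamped[OF n bb(1) elim(2)])
      then have "summand n i j / exp (G n) \<le> summand n i' j' / exp (G n)"
        by (intro divide_right_mono) auto
      also have "\<dots> \<le> \<bar>summand n i' j' / exp (G n)\<bar>" by (rule abs_ge_self)
      also have "\<dots> \<le> exp 78 * exp (- (1 / 576) * (((real i' - r n) / width n)\<^sup>2 + ((real j' - s n) / width n)\<^sup>2))"
        using elim by (simp add: i'_def j'_def N_def)
      also have "\<dots> \<le> \<epsilon> n"
      proof -
        have "4 * real n \<le> ((real i' - r n) / width n)\<^sup>2 + ((real j' - s n) / width n)\<^sup>2"
        proof (cases "N < i")
          case True
          then have "4 * real n \<le> ((real i' - r n) / width n)\<^sup>2"
            using far[of "r n"] elim by (simp add: i'_def)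
          then show ?thesis by (simp add: add_increasing2)
        next
          case False
          then have "4 * real n \<le> ((real j' - s n) / width n)\<^sup>2"
            using far[of "s n"] elim that by (simp add: j'_def)
          then show ?thesis by (simp add: add_increasing)
        qed
        then show ?thesis unfolding \<epsilon>_def by simp
      qed
      finally show ?thesis .
    qed
    define A where "A = {..n} \<times> {..n} - {..N} \<times> {..N}"
    have cn: "c n - (\<Sum>i\<le>N. \<Sum>j\<le>N. summand n i j) = (\<Sum>(i, j)\<in>A. summand n i j)"
      unfolding c_eq_sum_summand sum.cartesian_product A_def
      by (subst sum_diff) (use Nn in auto)
    have "0 \<le> (\<Sum>(i, j)\<in>A. summand n i j)"
      by (intro sum_nonneg) (auto simp: summand_nonneg)
    moreover have "(\<Sum>(i, j)\<in>A. summand n i j) / exp (G n) \<le> (real n + 1)\<^sup>2 * \<epsilon> n"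
    proof -
      have "(\<Sum>(i, j)\<in>A. summand n i j) / exp (G n) = (\<Sum>z\<in>A. (case z of (i, j) \<Rightarrow> summand n i j) / exp (G n))"
        by (rule sum_divide_distrib)
      also have "\<dots> \<le> (\<Sum>z\<in>A. \<epsilon> n)"
        by (intro sum_mono) (auto simp: A_def intro!: out)
      also have "\<dots> = real (card A) * \<epsilon> n" by simp
      also have "\<dots> \<le> real (card ({..n} \<times> {..n})) * \<epsilon> n"
        by (intro mult_right_mono of_nat_mono card_mono) (auto simp: A_def \<epsilon>_def)
      also have "real (card ({..n} \<times> {..n})) = (real n + 1)\<^sup>2"
        by (simp add: card_cartesian_product power2_eq_square algebra_simps)
      finally show ?thesis .
    qed
    ultimately have "\<bar>(\<Sum>(i, j)\<in>A. summand n i j) / exp (G n)\<bar> \<le> (real n + 1)\<^sup>2 * \<epsilon> n"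
      by simp
    then have "\<bar>(\<Sum>(i, j)\<in>A. summand n i j) / exp (G n)\<bar> / (width n)\<^sup>2 \<le> (real n + 1)\<^sup>2 * \<epsilon> n / (width n)\<^sup>2"
      by (rule divide_right_mono) simp
    then show ?case
      unfolding N_def [symmetric] cn real_norm_def abs_divide[of _ "(width n)\<^sup>2"] abs_power2 .
  qed
qed

lemma c_tendsto: "(\<lambda>n. c n / (exp (G n) * (width n)\<^sup>2)) \<longlonglongrightarrow> 2 * pi"
proof -
  have "(\<lambda>n. (\<Sum>i\<le>cutoff n. \<Sum>j\<le>cutoff n. summand n i j / exp (G n)) / (width n)\<^sup>2
     + (c n - (\<Sum>i\<le>cutoff n. \<Sum>j\<le>cutoff n. summand n i j)) / exp (G n) / (width n)\<^sup>2) \<longlonglongrightarrow> 2 * pi + 0"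
    by (intro tendsto_add cutoff_sum_tendsto tail_tendsto)
  then show ?thesis
    by (simp add: sum_divide_distrib [symmetric] add_divide_distrib [symmetric] diff_divide_distrib)
qed

section \<open>Comparison of the peak with the claimed exponent\<close>

definition E where
  "E n = real n / s n * (real n - r n + 1 / 2) - 3 * real n + 2 * r n + 2 * s n + t n + 1"

text \<open>The logarithm of the peak, up to the powers of \<open>n\<close>, \<open>r\<close>, \<open>s\<close> and constants split off by Stirling's
  formula and \<open>n\<close>-th powers of \<open>n / s\<close>.\<close>

definition H where
  "H n = (2 * m n + r n) * ln (s n) + m n * ln (1 + r n) - r n * ln (r n) - m n * ln (m n)"

text \<open>Exact, with the digamma errors kept as \<open>err\<close>. The second saddle point
  equation is weighted by \<open>m\<close> and the difference of the first two by \<open>r\<close>;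
  this reproduces the coefficients of \<open>ln s\<close> and \<open>ln r\<close> in
  \<open>H\<close>, with \<open>ln u\<close> and \<open>ln r\<close> standing for
  \<open>ln m\<close> and \<open>ln (1 + r)\<close> in the terms weighted by
  \<open>m\<close>.\<close>

lemma H_minus_E_eq:
  fixes err :: "real \<Rightarrow> real"
  defines "err \<equiv> \<lambda>x. Digamma (x + 1) - ln x - 1 / (2 * x)"
  assumes sp: "saddle_point n (r n) (s n) (t n)"
  shows "H n - E n = (m n * ln (u n / m n) + t n) + (m n * ln (1 + 1 / r n) - m n / r n) + (m n / r n - t n)
     + m n / (2 * u n) - 1 + m n * (err (u n) - err (s n)) + r n * (err (r n) - err (s n))"
proof -
  have pos: "r n > 0" "s n > 0" "t n > 0" "u n > 0" "m n > 0"
    using sp by (auto simp: saddle_point_iff u_def m_def)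
  define R S U M lr ls lu lm l1 where "R = r n" and "S = s n" and "U = u n" and "M = m n"
    and "lr = ln (r n)" and "ls = ln (s n)" and "lu = ln (u n)" and "lm = ln (m n)" and "l1 = ln (1 + r n)"
  have l: "ln (u n / m n) = lu - lm" "ln (1 + 1 / r n) = l1 - lr"
  proof -
    show "ln (u n / m n) = lu - lm" using pos by (simp add: ln_div lu_def lm_def)
    have "1 + 1 / r n = (1 + r n) / r n" using pos by (simp add: field_simps)
    then show "ln (1 + 1 / r n) = l1 - lr" using pos by (simp add: ln_div l1_def lr_def)
  qed
  have sp_r: "- lr - ls + U / R - Digamma (R + 1) + Digamma (U + 1) = 0"
    and sp_s: "- lr - ls + (M + 1) / S - Digamma (S + 1) + Digamma (U + 1) = 0"
    using sp by (simp_all add: saddle_point_iff saddle_r_def saddle_s_def lr_def ls_def U_def R_def S_def M_def u_def m_def)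
  have eq2: "err U - err S = lr + 2 * ls - lu - (M + 1 / 2) / S - 1 / (2 * U)"
  proof -
    have "(M + 1) / S - 1 / (2 * S) = (M + 1 / 2) / S" using pos by (simp add: S_def field_simps)
    moreover have "err U = Digamma (U + 1) - lu - 1 / (2 * U)" "err S = Digamma (S + 1) - ls - 1 / (2 * S)"
      by (simp_all add: err_def lu_def ls_def U_def S_def)
    ultimately show ?thesis using sp_s by linarith
  qed
  have eq1: "err R - err S = ls - lr - (M + 1 / 2) / S + (U - 1 / 2) / R"
  proof -
    have "(M + 1) / S - 1 / (2 * S) = (M + 1 / 2) / S" "U / R - 1 / (2 * R) = (U - 1 / 2) / R"
      using pos by (simp_all add: S_def R_def field_simps)
    moreover have "err R = Digamma (R + 1) - lr - 1 / (2 * R)" "err S = Digamma (S + 1) - ls - 1 / (2 * S)"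
      by (simp_all add: err_def lr_def ls_def R_def S_def)
    ultimately show ?thesis using sp_s sp_r by linarith
  qed
  have n: "real n = M + R + S" by (simp add: M_def R_def S_def m_def)
  have t: "t n = M - U" by (simp add: M_def U_def m_eq)
  have nz: "R \<noteq> 0" "S \<noteq> 0" "U \<noteq> 0" using pos by (simp_all add: R_def S_def U_def)
  have "M * (err U - err S) + R * (err R - err S) =
      M * lr + (2 * M + R) * ls - M * lu - R * lr - (M + R) * (M + 1 / 2) / S - M / (2 * U) + (U - 1 / 2)"
    unfolding eq1 eq2 using nz by (simp add: field_simps)
  moreover have "E n = (M + R) * (M + 1 / 2) / S - M + 1 / 2 + t n + 1"
    unfolding E_def R_def [symmetric] S_def [symmetric] n using nz by (simp add: field_simps)
  moreover have "H n = (2 * M + R) * ls + M * l1 - R * lr - M * lm"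
    by (simp add: H_def M_def R_def ls_def l1_def lr_def lm_def)
  ultimately show ?thesis
    unfolding l unfolding R_def [symmetric] S_def [symmetric] M_def [symmetric] U_def [symmetric]
    using t by (simp add: algebra_simps)
qed

lemma lim_over_squares:
  "(\<lambda>n. real n / (r n)\<^sup>2) \<longlonglongrightarrow> 0" "(\<lambda>n. real n / (s n)\<^sup>2) \<longlonglongrightarrow> 0" "(\<lambda>n. (t n)\<^sup>2 / real n) \<longlonglongrightarrow> 0"
proof -
  have pos: "\<forall>\<^sub>F n :: nat in sequentially. ln (real n) > 0" by real_asymp
  have l: "(\<lambda>n :: nat. (ln (real n))\<^sup>2 / real n) \<longlonglongrightarrow> 0" by real_asymp
  have *: "(\<lambda>n. real n / (x n)\<^sup>2) \<longlonglongrightarrow> 0" if x: "(\<lambda>n. x n * ln (real n) / real n) \<longlonglongrightarrow> 1 / 2" for x :: "nat \<Rightarrow> real"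
  proof -
    have "(\<lambda>n. 1 / (x n * ln (real n) / real n)\<^sup>2 * ((ln (real n))\<^sup>2 / real n)) \<longlonglongrightarrow> 1 / (1 / 2)\<^sup>2 * 0"
      by (intro tendsto_intros x l) auto
    then have "(\<lambda>n. 1 / (x n * ln (real n) / real n)\<^sup>2 * ((ln (real n))\<^sup>2 / real n)) \<longlonglongrightarrow> 0" by simp
    then show ?thesis
      by (rule Lim_transform_eventually)
         (use pos eventually_gt_at_top[of 0] in \<open>eventually_elim, simp add: power_divide power_mult_distrib power2_eq_square\<close>)
  qed
  show "(\<lambda>n. real n / (r n)\<^sup>2) \<longlonglongrightarrow> 0" "(\<lambda>n. real n / (s n)\<^sup>2) \<longlonglongrightarrow> 0"
    by (rule * lim_r lim_s)+
  have "(\<lambda>n. (t n / ln (real n))\<^sup>2 * ((ln (real n))\<^sup>2 / real n)) \<longlonglongrightarrow> 2\<^sup>2 * 0"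
    by (intro tendsto_intros lim_t l)
  then have "(\<lambda>n. (t n / ln (real n))\<^sup>2 * ((ln (real n))\<^sup>2 / real n)) \<longlonglongrightarrow> 0" by simp
  then show "(\<lambda>n. (t n)\<^sup>2 / real n) \<longlonglongrightarrow> 0"
    by (rule Lim_transform_eventually)
       (use pos eventually_gt_at_top[of 0] in \<open>eventually_elim, simp add: power_divide\<close>)
qed

text \<open>The only terms with non-zero limits are \<open>m / r - t\<close> and
  \<open>m / (2 * u)\<close>, both tending to 1/2, and the constant -1. The rest is bounded by
  multiples of t^2/n, n/r^2, n/s^2 and n/u^2.\<close>

lemma H_minus_E_tendsto: "(\<lambda>n. H n - E n) \<longlonglongrightarrow> 0"
proof -
  define err :: "real \<Rightarrow> real" where "err x = Digamma (x + 1) - ln x - 1 / (2 * x)" for x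
  note sq = lim_over_squares
  have inv_n: "(\<lambda>n :: nat. 1 / real n) \<longlonglongrightarrow> 0" by real_asymp
  have pos: "\<forall>\<^sub>F n in sequentially. 0 < r n \<and> 0 < s n \<and> 0 < t n \<and> 0 < u n \<and> 0 < m n \<and> r n \<le> real n \<and> m n \<le> real n
     \<and> real n \<le> 2 * u n \<and> real n \<le> 2 * m n \<and> 0 < real n"
    using ev_size by eventually_elim (auto simp: m_def)
  have errs: "(\<lambda>n. x n * (err (y n) - err (z n))) \<longlonglongrightarrow> 0"
    if x: "\<forall>\<^sub>F n in sequentially. 0 \<le> x n \<and> x n \<le> real n \<and> 0 < y n \<and> 0 < z n"
      and yz: "(\<lambda>n. real n / (y n)\<^sup>2) \<longlonglongrightarrow> 0" "(\<lambda>n. real n / (z n)\<^sup>2) \<longlonglongrightarrow> 0" for x y z :: "nat \<Rightarrow> real"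
  proof (rule Lim_null_comparison)
    have "(\<lambda>n. (real n / (y n)\<^sup>2 + real n / (z n)\<^sup>2) / 8) \<longlonglongrightarrow> (0 + 0) / 8"
      by (intro tendsto_intros yz) auto
    then show "(\<lambda>n. (real n / (y n)\<^sup>2 + real n / (z n)\<^sup>2) / 8) \<longlonglongrightarrow> 0" by simp
    show "\<forall>\<^sub>F n in sequentially. norm (x n * (err (y n) - err (z n))) \<le> (real n / (y n)\<^sup>2 + real n / (z n)\<^sup>2) / 8"
      using x
    proof eventually_elim
      case (elim n)
      have "\<bar>err (y n)\<bar> \<le> 1 / (8 * (y n)\<^sup>2)" "\<bar>err (z n)\<bar> \<le> 1 / (8 * (z n)\<^sup>2)"
        unfolding err_def using elim by (auto intro!: Digamma_plus1_approx)
      then have "\<bar>err (y n) - err (z n)\<bar> \<le> 1 / (8 * (y n)\<^sup>2) + 1 / (8 * (z n)\<^sup>2)" by linarith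
      then have "x n * \<bar>err (y n) - err (z n)\<bar> \<le> real n * (1 / (8 * (y n)\<^sup>2) + 1 / (8 * (z n)\<^sup>2))"
        using elim by (intro mult_mono) auto
      also have "\<dots> = (real n / (y n)\<^sup>2 + real n / (z n)\<^sup>2) / 8" by (simp add: algebra_simps)
      finally show ?case using elim by (simp add: abs_mult)
    qed
  qed
  have un: "(\<lambda>n. real n / (u n)\<^sup>2) \<longlonglongrightarrow> 0"
  proof -
    have "(\<lambda>n. 1 / (u n / real n)\<^sup>2 * (1 / real n)) \<longlonglongrightarrow> 1 / 1\<^sup>2 * 0"
      by (intro tendsto_intros lim_over_n inv_n) auto
    then have "(\<lambda>n. 1 / (u n / real n)\<^sup>2 * (1 / real n)) \<longlonglongrightarrow> 0" by simp
    then show ?thesis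
      by (rule Lim_transform_eventually)
         (use eventually_gt_at_top[of 0] in \<open>eventually_elim, simp add: power_divide power2_eq_square\<close>)
  qed
  have e1: "(\<lambda>n. m n * (err (u n) - err (s n))) \<longlonglongrightarrow> 0"
    by (rule errs[OF _ un sq(2)]) (use pos in eventually_elim, auto)
  have e2: "(\<lambda>n. r n * (err (r n) - err (s n))) \<longlonglongrightarrow> 0"
    by (rule errs[OF _ sq(1,2)]) (use pos in eventually_elim, auto)
  have tm: "(\<lambda>n. t n / m n) \<longlonglongrightarrow> 0"
  proof -
    have "(\<lambda>n. (t n / real n) / (m n / real n)) \<longlonglongrightarrow> 0 / 1" by (intro tendsto_intros lim_over_n) auto
    then have "(\<lambda>n. (t n / real n) / (m n / real n)) \<longlonglongrightarrow> 0" by simp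
    then show ?thesis
      by (rule Lim_transform_eventually) (use eventually_gt_at_top[of 0] in \<open>eventually_elim, simp\<close>)
  qed
  have e3: "(\<lambda>n. m n * ln (u n / m n) + t n) \<longlonglongrightarrow> 0"
  proof (rule Lim_null_comparison)
    have "(\<lambda>n. 4 * ((t n)\<^sup>2 / real n)) \<longlonglongrightarrow> 4 * 0" by (intro tendsto_intros sq)
    then show "(\<lambda>n. 4 * ((t n)\<^sup>2 / real n)) \<longlonglongrightarrow> 0" by simp
    have "\<forall>\<^sub>F n in sequentially. t n / m n < 1 / 2" by (rule order_tendstoD[OF tm]) simp
    with pos show "\<forall>\<^sub>F n in sequentially. norm (m n * ln (u n / m n) + t n) \<le> 4 * ((t n)\<^sup>2 / real n)"
    proof eventually_elim
      case (elim n)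
      \<comment> \<open>Since u/m = 1 + x and m x = -t, the expression is m (ln(1 + x) - x), which
        is quadratic in x.\<close>
      define x where "x = - (t n / m n)"
      have x: "\<bar>x\<bar> \<le> 1 / 2" using elim by (simp add: x_def)
      have um: "u n / m n = 1 + x" using elim by (simp add: x_def m_eq field_simps)
      have "m n * ln (u n / m n) + t n = m n * (ln (1 + x) - x)"
        unfolding um using elim by (simp add: x_def algebra_simps)
      also have "norm \<dots> = m n * \<bar>ln (1 + x) - x\<bar>" using elim by (simp add: abs_mult)
      also have "\<dots> \<le> m n * (2 * x\<^sup>2)"
        using elim abs_ln_one_plus_x_minus_x_bound[OF x] by (intro mult_left_mono) auto
      also have "\<dots> = 2 * (t n)\<^sup>2 / m n" using elim by (simp add: x_def power_divide power2_eq_square)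
      also have "\<dots> \<le> 2 * (t n)\<^sup>2 / (real n / 2)" using elim by (intro divide_left_mono) auto
      finally show ?case by simp
    qed
  qed
  have e4: "(\<lambda>n. m n * ln (1 + 1 / r n) - m n / r n) \<longlonglongrightarrow> 0"
  proof (rule Lim_null_comparison)
    have "(\<lambda>n. 2 * (real n / (r n)\<^sup>2)) \<longlonglongrightarrow> 2 * 0" by (intro tendsto_intros sq)
    then show "(\<lambda>n. 2 * (real n / (r n)\<^sup>2)) \<longlonglongrightarrow> 0" by simp
    have "\<forall>\<^sub>F n in sequentially. 2 \<le> r n" using r_at_top by (simp add: filterlim_at_top)
    with pos show "\<forall>\<^sub>F n in sequentially. norm (m n * ln (1 + 1 / r n) - m n / r n) \<le> 2 * (real n / (r n)\<^sup>2)"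
    proof eventually_elim
      case (elim n)
      have x: "\<bar>1 / r n\<bar> \<le> 1 / 2" using elim by (simp add: field_simps)
      have "m n * ln (1 + 1 / r n) - m n / r n = m n * (ln (1 + 1 / r n) - 1 / r n)"
        by (simp add: algebra_simps)
      also have "norm \<dots> = m n * \<bar>ln (1 + 1 / r n) - 1 / r n\<bar>" using elim by (simp add: abs_mult)
      also have "\<dots> \<le> real n * (2 * (1 / r n)\<^sup>2)"
        using elim abs_ln_one_plus_x_minus_x_bound[OF x] by (intro mult_mono) auto
      finally show ?case by (simp add: power_divide mult.commute)
    qed
  qed
  have e5: "(\<lambda>n. m n / (2 * u n)) \<longlonglongrightarrow> 1 / 2"
  proof -
    have "(\<lambda>n. (m n / real n) / (2 * (u n / real n))) \<longlonglongrightarrow> 1 / (2 * 1)"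
      by (intro tendsto_intros lim_over_n) auto
    then have "(\<lambda>n. (m n / real n) / (2 * (u n / real n))) \<longlonglongrightarrow> 1 / 2" by simp
    then show ?thesis
      by (rule Lim_transform_eventually) (use eventually_gt_at_top[of 0] in \<open>eventually_elim, simp\<close>)
  qed
  have "(\<lambda>n. (m n * ln (u n / m n) + t n) + (m n * ln (1 + 1 / r n) - m n / r n) + (m n / r n - t n)
     + m n / (2 * u n) - 1 + m n * (err (u n) - err (s n)) + r n * (err (r n) - err (s n)))
     \<longlonglongrightarrow> 0 + 0 + 1 / 2 + 1 / 2 - 1 + 0 + 0"
    by (intro tendsto_add tendsto_diff tendsto_const e1 e2 e3 e4 e5 lim_shift)
  then have "(\<lambda>n. (m n * ln (u n / m n) + t n) + (m n * ln (1 + 1 / r n) - m n / r n) + (m n / r n - t n)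
     + m n / (2 * u n) - 1 + m n * (err (u n) - err (s n)) + r n * (err (r n) - err (s n))) \<longlonglongrightarrow> 0"
    by simp
  then show ?thesis
    by (rule Lim_transform_eventually)
       (use saddle in \<open>eventually_elim, simp only: H_minus_E_eq err_def\<close>)
qed

definition approx where
  "approx n = exp (E n) * (real n / s n) ^ n * (r n powr (1 / 2) * s n powr (3 / 2) / real n)"

lemma m_at_top: "filterlim m at_top sequentially"
proof -
  have "filterlim (\<lambda>n :: nat. real n / 2) at_top sequentially" by real_asymp
  then show ?thesis
    by (rule filterlim_at_top_mono) (use ev_size in \<open>eventually_elim, simp\<close>)
qed

text \<open>After taking logarithms, the four Stirling errors contribute minus ln(2 pi), which
  cancels the Gaussian factor. The squared width against the remaining powers of n, r and s gives
  1/4 times two factors tending to 2.\<close>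

lemma gaussian_approx: "(\<lambda>n. 2 * pi * (exp (G n) * (width n)\<^sup>2) / approx n) \<longlonglongrightarrow> 1"
proof -
  define Q where "Q n = (ln (2 * pi) + stirling_error (real n) - stirling_error (r n) - stirling_error (s n) - stirling_error (m n))
     + (H n - E n) + ln (1 / (r n * ln (real n) / real n) * (1 / (s n * ln (real n) / real n)) / 4)
     - ln (m n / real n) / 2" for n
  have st: "(\<lambda>n. stirling_error (x n)) \<longlonglongrightarrow> ln (2 * pi) / 2" if "filterlim x at_top sequentially" for x :: "nat \<Rightarrow> real"
    by (rule filterlim_compose[OF stirling_error_tendsto that])
  have "Q \<longlonglongrightarrow> (ln (2 * pi) + ln (2 * pi) / 2 - ln (2 * pi) / 2 - ln (2 * pi) / 2 - ln (2 * pi) / 2) + 0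
     + ln (1 / (1 / 2) * (1 / (1 / 2)) / 4) - ln 1 / 2"
    unfolding Q_def [abs_def]
    by (intro tendsto_intros st filterlim_real_sequentially r_at_top s_at_top m_at_top H_minus_E_tendsto
        lim_r lim_s lim_over_n(4)) auto
  then have "Q \<longlonglongrightarrow> 0" by simp
  then have "(\<lambda>n. exp (Q n)) \<longlonglongrightarrow> exp 0" by (intro tendsto_intros)
  then have "(\<lambda>n. exp (Q n)) \<longlonglongrightarrow> 1" by simp
  moreover have "\<forall>\<^sub>F n in sequentially. exp (Q n) = 2 * pi * (exp (G n) * (width n)\<^sup>2) / approx n"
    using ev_size
  proof eventually_elim
    case (elim n)
    define L where "L = ln (real n)"
    have pos: "r n > 0" "s n > 0" "m n > 0" "real n > 0" "L > 0" using elim by (auto simp: L_def)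
    have wpos: "(width n)\<^sup>2 > 0" unfolding width_square using pos by (simp add: L_def)
    have apos: "approx n > 0" unfolding approx_def using pos by simp
    have ln_approx: "ln (approx n) = E n + real n * (ln (real n) - ln (s n)) + (ln (r n) / 2 + 3 / 2 * ln (s n) - ln (real n))"
      unfolding approx_def using pos by (simp add: ln_mult_pos ln_div ln_realpow ln_powr)
    have ln_w: "ln ((width n)\<^sup>2) = ln (real n) - ln 4 - 2 * ln L"
      unfolding width_square using pos by (simp add: L_def ln_div ln_mult_pos ln_realpow)
    have lnQ: "ln (1 / (r n * L / real n) * (1 / (s n * L / real n)) / 4)
        = 2 * ln (real n) - ln (r n) - ln (s n) - 2 * ln L - ln 4"
      using pos by (simp add: ln_div ln_mult_pos)
    have lnm: "ln (m n / real n) = ln (m n) - ln (real n)" using pos by (simp add: ln_div)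
    have G: "G n = (real n * ln (real n) + ln (real n) / 2 - real n + stirling_error (real n))
      - (r n * ln (r n) + ln (r n) / 2 - r n + stirling_error (r n))
      - (s n * ln (s n) + ln (s n) / 2 - s n + stirling_error (s n))
      - (m n * ln (m n) + ln (m n) / 2 - m n + stirling_error (m n))
      + (m n + 1) * ln (s n) + m n * ln (1 + r n)"
      unfolding G_def logsum_def m_def [symmetric] using pos by (simp add: ln_Gamma_plus1_eq)
    have n: "real n = m n + r n + s n" by (simp add: m_def)
    have key: "ln (2 * pi) + G n + ln ((width n)\<^sup>2) - ln (approx n) = Q n"
    proof -
      have nl: "real n * ln (s n) = (m n + r n + s n) * ln (s n)" using n by simp
      show ?thesis
        unfolding Q_def L_def [symmetric] lnQ lnm ln_approx ln_w G H_def
        using n nl by (simp add: algebra_simps diff_divide_distrib)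
    qed
    have "2 * pi * (exp (G n) * (width n)\<^sup>2) / approx n
        = exp (ln (2 * pi)) * exp (G n) * exp (ln ((width n)\<^sup>2)) / exp (ln (approx n))"
      using wpos apos by simp
    also have "\<dots> = exp (ln (2 * pi) + G n + ln ((width n)\<^sup>2) - ln (approx n))"
      by (simp add: exp_add exp_diff)
    finally show ?case unfolding key by simp
  qed
  ultimately show ?thesis by (rule Lim_transform_eventually)
qed

lemma c_asymp_equiv: "c \<sim>[sequentially] approx"
proof (rule asymp_equivI')
  have "(\<lambda>n. c n / (exp (G n) * (width n)\<^sup>2) * (2 * pi * (exp (G n) * (width n)\<^sup>2) / approx n) / (2 * pi))
      \<longlonglongrightarrow> 2 * pi * 1 / (2 * pi)"
    by (intro tendsto_intros c_tendsto gaussian_approx) auto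
  then have "(\<lambda>n. c n / (exp (G n) * (width n)\<^sup>2) * (2 * pi * (exp (G n) * (width n)\<^sup>2) / approx n) / (2 * pi)) \<longlonglongrightarrow> 1"
    by simp
  then show "(\<lambda>n. c n / approx n) \<longlonglongrightarrow> 1"
  proof (rule Lim_transform_eventually)
    have "\<forall>\<^sub>F n in sequentially. width n > 0" unfolding width_def by real_asymp
    then show "\<forall>\<^sub>F n in sequentially. c n / (exp (G n) * (width n)\<^sup>2) * (2 * pi * (exp (G n) * (width n)\<^sup>2) / approx n) / (2 * pi)
        = c n / approx n"
      by eventually_elim simp
  qed
qed

text \<open>r and s are both asymptotic to n/(2 ln n) and the exponents 1/2 and 3/2 add up to 2,
  whence the 4 and the square of the logarithm.\<close>

lemma prefactor_asymp_equiv: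
  "(\<lambda>n. r n powr (1 / 2) * s n powr (3 / 2) / real n) \<sim>[sequentially] (\<lambda>n. real n / (4 * (ln (real n))\<^sup>2))"
proof (rule asymp_equivI')
  define \<rho> \<zeta> where "\<rho> n = r n * ln (real n) / real n" and "\<zeta> n = s n * ln (real n) / real n" for n
  have lim: "\<rho> \<longlonglongrightarrow> 1 / 2" "\<zeta> \<longlonglongrightarrow> 1 / 2"
    unfolding \<rho>_def [abs_def] \<zeta>_def [abs_def] by (rule lim_r lim_s)+
  have "(\<lambda>n. 4 * (\<rho> n powr (1 / 2) * \<zeta> n powr (3 / 2))) \<longlonglongrightarrow> 4 * ((1 / 2) powr (1 / 2) * (1 / 2) powr (3 / 2))"
    by (intro tendsto_intros lim) auto
  also have "(1 / 2) powr (1 / 2) * (1 / 2) powr (3 / 2) = ((1 / 2) powr 2 :: real)"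
    by (simp add: powr_add [symmetric])
  also have "\<dots> = 1 / 4" by (simp add: powr_numeral power2_eq_square)
  finally have "(\<lambda>n. 4 * (\<rho> n powr (1 / 2) * \<zeta> n powr (3 / 2))) \<longlonglongrightarrow> 1" by simp
  then show "(\<lambda>n. r n powr (1 / 2) * s n powr (3 / 2) / real n / (real n / (4 * (ln (real n))\<^sup>2))) \<longlonglongrightarrow> 1"
  proof (rule Lim_transform_eventually)
    show "\<forall>\<^sub>F n in sequentially. 4 * (\<rho> n powr (1 / 2) * \<zeta> n powr (3 / 2))
        = r n powr (1 / 2) * s n powr (3 / 2) / real n / (real n / (4 * (ln (real n))\<^sup>2))"
      using ev_size
    proof eventually_elim
      case (elim n)
      define q where "q = ln (real n) / real n"
      have q: "q > 0" using elim by (simp add: q_def)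
      have "\<rho> n powr (1 / 2) * \<zeta> n powr (3 / 2) = (r n powr (1 / 2) * s n powr (3 / 2)) * (q powr (1 / 2) * q powr (3 / 2))"
        using elim q by (simp add: \<rho>_def \<zeta>_def powr_mult q_def [symmetric] flip: times_divide_eq_right)
      also have "q powr (1 / 2) * q powr (3 / 2) = q\<^sup>2"
        using q by (simp add: powr_add [symmetric] powr_numeral)
      finally show ?case by (simp add: q_def power_divide power2_eq_square)
    qed
  qed
qed

end

theorem theorem11:
  shows "(\<forall>\<^sub>F n in sequentially. \<exists>!(r, s, t). saddle_point n r s t) \<and>
    (\<forall>r s t :: nat \<Rightarrow> real.
      (\<forall>\<^sub>F n in sequentially. saddle_point n (r n) (s n) (t n)) \<longrightarrow>
      c \<sim>[sequentially]
        (\<lambda>n. exp (real n / s n * (real n - r n + 1 / 2) - 3 * real n + 2 * r n + 2 * s n + t n + 1)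
               * (real n / s n) ^ n * (r n powr (1 / 2) * s n powr (3 / 2) / real n)) \<and>
      (\<lambda>n. exp (real n / s n * (real n - r n + 1 / 2) - 3 * real n + 2 * r n + 2 * s n + t n + 1)
               * (real n / s n) ^ n * (r n powr (1 / 2) * s n powr (3 / 2) / real n))
        \<sim>[sequentially]
        (\<lambda>n. exp (real n / s n * (real n - r n + 1 / 2) - 3 * real n + 2 * r n + 2 * s n + t n + 1)
               * (real n / s n) ^ n * (real n / (4 * (ln (real n))\<^sup>2))))"
proof (intro conjI allI impI)
  show "\<forall>\<^sub>F n in sequentially. \<exists>!(r, s, t). saddle_point n r s t"
    by (rule saddle_point_ex1)
  fix r s t :: "nat \<Rightarrow> real"
  assume sp: "\<forall>\<^sub>F n in sequentially. saddle_point n (r n) (s n) (t n)"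
  interpret saddle_sequence r s t by unfold_locales (rule sp)
  show "c \<sim>[sequentially]
        (\<lambda>n. exp (real n / s n * (real n - r n + 1 / 2) - 3 * real n + 2 * r n + 2 * s n + t n + 1)
               * (real n / s n) ^ n * (r n powr (1 / 2) * s n powr (3 / 2) / real n))"
    using c_asymp_equiv unfolding approx_def [abs_def] E_def .
  show "(\<lambda>n. exp (real n / s n * (real n - r n + 1 / 2) - 3 * real n + 2 * r n + 2 * s n + t n + 1)
               * (real n / s n) ^ n * (r n powr (1 / 2) * s n powr (3 / 2) / real n))
        \<sim>[sequentially]
        (\<lambda>n. exp (real n / s n * (real n - r n + 1 / 2) - 3 * real n + 2 * r n + 2 * s n + t n + 1)
               * (real n / s n) ^ n * (real n / (4 * (ln (real n))\<^sup>2)))"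
    \<comment> \<open>The exponential and the n-th power are common to both sides; leading
      asymptotics enter only through the algebraic prefactor.\<close>
    by (intro asymp_equiv_mult asymp_equiv_refl prefactor_asymp_equiv)
qed

end
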